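(* Fix any $\epsilon\in(0,1)$, and set $\alpha=1+1/f+3\epsilon$ and $\beta=1+\epsilon$. In the dynamic setting (defined in the context), starting from an empty edge set, one can maintain after every edge insertion/deletion an $(\alpha,\beta)$-partition of $G$ satisfying the invariant below, in $O(f\log(m+n)/\epsilon^2)$ amortized update time. Invariant: with $c^*_v=c_v/(f\alpha\beta)$, every node $v$ with $\ell(v)>0$ satisfies $c^*_v\le W_v\le f\alpha\beta\cdot c^*_v$, and every node $v$ with $\ell(v)=0$ satisfies $W_v\le f\alpha\beta\cdot c^*_v$.
   Context: Setting: hypergraph $G=(V,E)$ with $|V|=n$ nodes and at most $m$ edges at any time; node capacities $c_v>0$ with $c_{\min}=\min_v c_v$, multiplicity $\mu\ge1$ ($\mu$, $c_v$ polynomially bounded in $n$); $\mathcal{E}_v$ is the set of edges incident upon $v$, $\mathcal{V}_e=\{v:e\in\mathcal{E}_v\}$, and every edge satisfies $|\mathcal{V}_e|\le f$. Dynamic setting: $V$, $c_v$, $\mu$, $f$, $m$ are fixed; initially $E=\emptyset$; each update inserts or deletes one edge. Let $L=\lceil\log_\beta(m\mu\alpha/c_{\min})\rceil$. An $(\alpha,\beta)$-partition assigns each node a level $\ell(v)\in\{0,\dots,L\}$; an edge has level $\ell(e)=\max_{v\in\mathcal{V}_e}\ell(v)$ and weight $w(e)=\mu\beta^{-\ell(e)}$; $W_v=\sum_{e\in\mathcal{E}_v}w(e)$. Amortized update time $T$ means total time $O(t\cdot T)$ over any $t$ updates starting from the empty graph.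
   Formalization: "Polynomially bounded in n" is taken to bound 1/c_v as well as μ and c_v (with arbitrarily small capacities the levels, and so the update time, would be unbounded), and L is replaced by 0 when the ceiling is negative. *)

theory Defs
  imports Complex_Main
begin

section \<open>Hypergraphs and level partitions\<close>

text \<open>
  The node set is \<open>{..<n}\<close>.  Edges are identified by natural numbers, so that parallel
  edges are possible: the edge set is \<open>dom G\<close>, and \<open>G e = Some S\<close> means that the edge \<open>e\<close>
  connects exactly the nodes in \<open>S\<close>.
\<close>

type_synonym hypergraph = "nat \<Rightarrow> nat set option"

definition incident_edges :: "hypergraph \<Rightarrow> nat \<Rightarrow> nat set" where
  "incident_edges G v = {e. \<exists>S. G e = Some S \<and> v \<in> S}"

definition endpoints :: "hypergraph \<Rightarrow> nat \<Rightarrow> nat set" where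
  "endpoints G e = {v. e \<in> incident_edges G v}"

definition c_min :: "nat \<Rightarrow> (nat \<Rightarrow> real) \<Rightarrow> real" where
  "c_min n c = Min (c ` {..<n})"

text \<open>
  If \<open>m * \<mu> * \<alpha> < c_min n c\<close> the logarithm is negative; \<open>nat\<close> then leaves the single level 0.
\<close>

definition max_level :: "real \<Rightarrow> real \<Rightarrow> nat \<Rightarrow> nat \<Rightarrow> real \<Rightarrow> (nat \<Rightarrow> real) \<Rightarrow> nat" where
  "max_level \<alpha> \<beta> n m \<mu> c = nat \<lceil>log \<beta> (real m * \<mu> * \<alpha> / c_min n c)\<rceil>"

definition is_partition ::
  "real \<Rightarrow> real \<Rightarrow> nat \<Rightarrow> nat \<Rightarrow> real \<Rightarrow> (nat \<Rightarrow> real) \<Rightarrow> (nat \<Rightarrow> nat) \<Rightarrow> bool" where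
  "is_partition \<alpha> \<beta> n m \<mu> c \<l> \<longleftrightarrow> (\<forall>v<n. \<l> v \<in> {0..max_level \<alpha> \<beta> n m \<mu> c})"

definition edge_level :: "hypergraph \<Rightarrow> (nat \<Rightarrow> nat) \<Rightarrow> nat \<Rightarrow> nat" where
  "edge_level G \<l> e = Max (\<l> ` endpoints G e)"

definition edge_weight :: "real \<Rightarrow> real \<Rightarrow> hypergraph \<Rightarrow> (nat \<Rightarrow> nat) \<Rightarrow> nat \<Rightarrow> real" where
  "edge_weight \<beta> \<mu> G \<l> e = \<mu> / \<beta> ^ edge_level G \<l> e"

definition node_weight :: "real \<Rightarrow> real \<Rightarrow> hypergraph \<Rightarrow> (nat \<Rightarrow> nat) \<Rightarrow> nat \<Rightarrow> real" where
  "node_weight \<beta> \<mu> G \<l> v = (\<Sum>e\<in>incident_edges G v. edge_weight \<beta> \<mu> G \<l> e)"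

definition c_star :: "real \<Rightarrow> real \<Rightarrow> nat \<Rightarrow> (nat \<Rightarrow> real) \<Rightarrow> nat \<Rightarrow> real" where
  "c_star \<alpha> \<beta> f c v = c v / (real f * \<alpha> * \<beta>)"

definition partition_invariant ::
  "real \<Rightarrow> real \<Rightarrow> nat \<Rightarrow> nat \<Rightarrow> real \<Rightarrow> (nat \<Rightarrow> real) \<Rightarrow> hypergraph \<Rightarrow> (nat \<Rightarrow> nat) \<Rightarrow> bool" where
  "partition_invariant \<alpha> \<beta> n f \<mu> c G \<l> \<longleftrightarrow>
     (\<forall>v<n.
        (\<l> v > 0 \<longrightarrow> c_star \<alpha> \<beta> f c v \<le> node_weight \<beta> \<mu> G \<l> v \<and>
                     node_weight \<beta> \<mu> G \<l> v \<le> real f * \<alpha> * \<beta> * c_star \<alpha> \<beta> f c v) \<and>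
        (\<l> v = 0 \<longrightarrow> node_weight \<beta> \<mu> G \<l> v \<le> real f * \<alpha> * \<beta> * c_star \<alpha> \<beta> f c v))"


section \<open>Instances and edge updates\<close>

text \<open>
  The lower bound on the capacities is part of what it means for them to be polynomially
  bounded: it is what makes \<open>max_level\<close> of order \<open>log (m + n) / \<epsilon>\<close>.
\<close>

definition poly_bounded :: "real \<Rightarrow> nat \<Rightarrow> real \<Rightarrow> (nat \<Rightarrow> real) \<Rightarrow> bool" where
  "poly_bounded K n \<mu> c \<longleftrightarrow>
     \<mu> \<le> K * real n powr K \<and> (\<forall>v<n. c v \<le> K * real n powr K \<and> 1 / c v \<le> K * real n powr K)"

text \<open>
  \<open>Insert e xs\<close> inserts an edge with the identifier \<open>e\<close> on the nodes listed in \<open>xs\<close>.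
\<close>

datatype edge_update = Insert nat "nat list" | Delete nat

fun apply_update :: "edge_update \<Rightarrow> hypergraph \<Rightarrow> hypergraph" where
  "apply_update (Insert e xs) G = G(e := Some (set xs))"
| "apply_update (Delete e) G = G(e := None)"

definition graph_after :: "edge_update list \<Rightarrow> hypergraph" where
  "graph_after us = fold apply_update us Map.empty"

fun legal_update :: "nat \<Rightarrow> nat \<Rightarrow> nat \<Rightarrow> hypergraph \<Rightarrow> edge_update \<Rightarrow> bool" where
  "legal_update n m f G (Insert e xs) \<longleftrightarrow>
     e \<notin> dom G \<and> card (dom G) < m \<and>
     xs \<noteq> [] \<and> distinct xs \<and> set xs \<subseteq> {..<n} \<and> card (set xs) \<le> f"
| "legal_update n m f G (Delete e) \<longleftrightarrow> e \<in> dom G"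

definition legal_updates :: "nat \<Rightarrow> nat \<Rightarrow> nat \<Rightarrow> edge_update list \<Rightarrow> bool" where
  "legal_updates n m f us \<longleftrightarrow>
     (\<forall>i<length us. legal_update n m f (graph_after (take i us)) (us ! i))"


section \<open>Random access machine\<close>

text \<open>
  Programs run on a real RAM.  Its memory consists of banks of cells, each cell holding a
  natural number or a real number; a program names banks only by literals, hence uses finitely
  many, while cell addresses may be computed.  Arithmetic is exact and of unit cost.  To keep
  the unit-cost assumption harmless, natural numbers (and so addresses) have no
  multiplication, and there is no operation from reals to natural numbers.
\<close>

datatype iexp =
    INum nat
  | ICell nat iexp
  | IAdd iexp iexp
  | ISub iexp iexp

datatype rexp =
    ROfNat iexp
  | RCell nat iexp
  | RAdd rexp rexp
  | RSub rexp rexp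
  | RMul rexp rexp
  | RDiv rexp rexp

datatype bexp =
    ILess iexp iexp
  | RLess rexp rexp
  | BNot bexp
  | BAnd bexp bexp

datatype com =
    Skip
  | ISet nat iexp iexp
  | RSet nat iexp rexp
  | Seq com com
  | Cond bexp com com
  | While bexp com

record store =
  ibank :: "nat \<Rightarrow> nat \<Rightarrow> nat"
  rbank :: "nat \<Rightarrow> nat \<Rightarrow> real"

fun ival :: "iexp \<Rightarrow> store \<Rightarrow> nat" where
  "ival (INum k) s = k"
| "ival (ICell b a) s = ibank s b (ival a s)"
| "ival (IAdd x y) s = ival x s + ival y s"
| "ival (ISub x y) s = ival x s - ival y s"

fun rval :: "rexp \<Rightarrow> store \<Rightarrow> real" where
  "rval (ROfNat x) s = real (ival x s)"
| "rval (RCell b a) s = rbank s b (ival a s)"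
| "rval (RAdd x y) s = rval x s + rval y s"
| "rval (RSub x y) s = rval x s - rval y s"
| "rval (RMul x y) s = rval x s * rval y s"
| "rval (RDiv x y) s = rval x s / rval y s"

fun bval :: "bexp \<Rightarrow> store \<Rightarrow> bool" where
  "bval (ILess x y) s \<longleftrightarrow> ival x s < ival y s"
| "bval (RLess x y) s \<longleftrightarrow> rval x s < rval y s"
| "bval (BNot x) s \<longleftrightarrow> \<not> bval x s"
| "bval (BAnd x y) s \<longleftrightarrow> bval x s \<and> bval y s"

fun icost :: "iexp \<Rightarrow> nat" where
  "icost (INum k) = 1"
| "icost (ICell b a) = 1 + icost a"
| "icost (IAdd x y) = 1 + icost x + icost y"
| "icost (ISub x y) = 1 + icost x + icost y"

fun rcost :: "rexp \<Rightarrow> nat" where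
  "rcost (ROfNat x) = 1 + icost x"
| "rcost (RCell b a) = 1 + icost a"
| "rcost (RAdd x y) = 1 + rcost x + rcost y"
| "rcost (RSub x y) = 1 + rcost x + rcost y"
| "rcost (RMul x y) = 1 + rcost x + rcost y"
| "rcost (RDiv x y) = 1 + rcost x + rcost y"

fun bcost :: "bexp \<Rightarrow> nat" where
  "bcost (ILess x y) = 1 + icost x + icost y"
| "bcost (RLess x y) = 1 + rcost x + rcost y"
| "bcost (BNot x) = 1 + bcost x"
| "bcost (BAnd x y) = 1 + bcost x + bcost y"

definition write_i :: "nat \<Rightarrow> nat \<Rightarrow> nat \<Rightarrow> store \<Rightarrow> store" where
  "write_i b a x s = s\<lparr>ibank := (ibank s)(b := (ibank s b)(a := x))\<rparr>"

definition write_r :: "nat \<Rightarrow> nat \<Rightarrow> real \<Rightarrow> store \<Rightarrow> store" where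
  "write_r b a x s = s\<lparr>rbank := (rbank s)(b := (rbank s b)(a := x))\<rparr>"

text \<open>
  \<open>exec p s t s'\<close>: the program \<open>p\<close>, started in \<open>s\<close>, halts after time \<open>t\<close> in \<open>s'\<close>.
\<close>

inductive exec :: "com \<Rightarrow> store \<Rightarrow> nat \<Rightarrow> store \<Rightarrow> bool" where
  Skip: "exec Skip s 1 s"
| ISet: "exec (ISet b a x) s (1 + icost a + icost x) (write_i b (ival a s) (ival x s) s)"
| RSet: "exec (RSet b a x) s (1 + icost a + rcost x) (write_r b (ival a s) (rval x s) s)"
| Seq: "\<lbrakk>exec p s t s'; exec q s' t' s''\<rbrakk> \<Longrightarrow> exec (Seq p q) s (t + t') s''"
| CondTrue: "\<lbrakk>bval x s; exec p s t s'\<rbrakk> \<Longrightarrow> exec (Cond x p q) s (1 + bcost x + t) s'"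
| CondFalse: "\<lbrakk>\<not> bval x s; exec q s t s'\<rbrakk> \<Longrightarrow> exec (Cond x p q) s (1 + bcost x + t) s'"
| WhileFalse: "\<not> bval x s \<Longrightarrow> exec (While x p) s (1 + bcost x) s"
| WhileTrue: "\<lbrakk>bval x s; exec p s t s'; exec (While x p) s' t' s''\<rbrakk>
    \<Longrightarrow> exec (While x p) s (1 + bcost x + t + t') s''"


section \<open>Dynamic algorithms\<close>

definition bank_of_list :: "nat list \<Rightarrow> nat \<Rightarrow> nat" where
  "bank_of_list xs i = (if i < length xs then xs ! i else 0)"

text \<open>
  Before the first update the memory holds only the fixed data of the instance: \<open>n, m, f\<close> in
  bank 0 of the natural numbers, \<open>\<epsilon>, \<mu>\<close> in bank 0 and the capacities in bank 1 of the reals.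
  All other cells are 0.
\<close>

definition init_store :: "nat \<Rightarrow> nat \<Rightarrow> nat \<Rightarrow> real \<Rightarrow> (nat \<Rightarrow> real) \<Rightarrow> real \<Rightarrow> store" where
  "init_store n m f \<mu> c \<epsilon> =
     \<lparr>ibank = (\<lambda>b i. if b = 0 then bank_of_list [n, m, f] i else 0),
      rbank = (\<lambda>b i. if b = 0 \<and> i = 0 then \<epsilon>
                     else if b = 0 \<and> i = 1 then \<mu>
                     else if b = 1 \<and> i < n then c i
                     else 0)\<rparr>"

fun encode_update :: "edge_update \<Rightarrow> nat list" where
  "encode_update (Insert e xs) = 1 # e # length xs # xs"
| "encode_update (Delete e) = [2, e]"

text \<open>
  Bank 1 of the natural numbers is the input buffer for the current update.  All other banks
  persist between updates.
\<close>

definition receive :: "edge_update \<Rightarrow> store \<Rightarrow> store" where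
  "receive u s = s\<lparr>ibank := (ibank s)(1 := bank_of_list (encode_update u))\<rparr>"

text \<open>
  \<open>serves p s us t s'\<close>: started in \<open>s\<close>, the algorithm \<open>p\<close> is run once for each update in \<open>us\<close>,
  seeing one update at a time, and reaches \<open>s'\<close> in total time \<open>t\<close>.
\<close>

inductive serves :: "com \<Rightarrow> store \<Rightarrow> edge_update list \<Rightarrow> nat \<Rightarrow> store \<Rightarrow> bool" where
  Nil: "serves p s [] 0 s"
| Cons: "\<lbrakk>exec p (receive u s) t s'; serves p s' us t' s''\<rbrakk> \<Longrightarrow> serves p s (u # us) (t + t') s''"

text \<open>The maintained levels are read off from bank 2 of the natural numbers.\<close>

definition level_of :: "store \<Rightarrow> nat \<Rightarrow> nat" where
  "level_of s v = ibank s 2 v"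

text \<open>
  By determinism the stores reached on the prefixes of an update sequence are exactly the
  stores passed through while serving the whole sequence.
\<close>

inductive_cases exec_SkipE: "exec Skip s t s'"
inductive_cases exec_ISetE: "exec (ISet b a x) s t s'"
inductive_cases exec_RSetE: "exec (RSet b a x) s t s'"
inductive_cases exec_SeqE: "exec (Seq p q) s t s'"
inductive_cases exec_CondE: "exec (Cond x p q) s t s'"
inductive_cases exec_WhileE: "exec (While x p) s t s'"

lemma exec_determ: "exec p s t s' \<Longrightarrow> exec p s u s'' \<Longrightarrow> u = t \<and> s'' = s'"
proof (induction arbitrary: u s'' rule: exec.induct)
  case (Skip s)
  then show ?case by (rule exec_SkipE) simp
next
  case (ISet b a x s)
  then show ?case by (rule exec_ISetE) simp
next
  case (RSet b a x s)
  then show ?case by (rule exec_RSetE) simp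
next
  case (Seq p s t s' q t' s2)
  from Seq.prems show ?case
  proof (rule exec_SeqE)
    fix t1 r t2
    assume *: "u = t1 + t2" "exec p s t1 r" "exec q r t2 s''"
    from Seq.IH(1)[OF *(2)] have r: "t1 = t" "r = s'" by simp_all
    from Seq.IH(2)[OF *(3)[unfolded r]] *(1) r show ?thesis by simp
  qed
next
  case (CondTrue x s p t s' q)
  from CondTrue.prems show ?case
  proof (rule exec_CondE)
    fix t1
    assume *: "u = Suc (bcost x + t1)" "exec p s t1 s''"
    from CondTrue.IH[OF *(2)] *(1) show ?thesis by simp
  qed (simp add: CondTrue.hyps)
next
  case (CondFalse x s q t s' p)
  from CondFalse.prems show ?case
  proof (rule exec_CondE)
    fix t1
    assume *: "u = Suc (bcost x + t1)" "exec q s t1 s''"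
    from CondFalse.IH[OF *(2)] *(1) show ?thesis by simp
  qed (simp add: CondFalse.hyps)
next
  case (WhileFalse x s p)
  from WhileFalse.prems show ?case
    by (rule exec_WhileE) (simp_all add: WhileFalse.hyps)
next
  case (WhileTrue x s p t s' t' s2)
  from WhileTrue.prems show ?case
  proof (rule exec_WhileE)
    fix t1 r t2
    assume *: "u = Suc (bcost x + t1 + t2)" "exec p s t1 r" "exec (While x p) r t2 s''"
    from WhileTrue.IH(1)[OF *(2)] have r: "t1 = t" "r = s'" by simp_all
    from WhileTrue.IH(2)[OF *(3)[unfolded r]] *(1) r show ?thesis by simp
  qed (simp add: WhileTrue.hyps)
qed

inductive_cases serves_NilE: "serves p s [] t s'"
inductive_cases serves_ConsE: "serves p s (u # us) t s'"

lemma serves_determ: "serves p s us t s' \<Longrightarrow> serves p s us u s'' \<Longrightarrow> u = t \<and> s'' = s'"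
proof (induction arbitrary: u s'' rule: serves.induct)
  case (Nil p s)
  then show ?case by (rule serves_NilE) simp
next
  case (Cons p v s t s' us t' s2)
  from Cons.prems show ?case
  proof (rule serves_ConsE)
    fix t1 r t2
    assume *: "u = t1 + t2" "exec p (receive v s) t1 r" "serves p r us t2 s''"
    from exec_determ[OF Cons.hyps(1) *(2)] have r: "t1 = t" "r = s'" by simp_all
    from Cons.IH[OF *(3)[unfolded r]] *(1) r show ?thesis by simp
  qed
qed

lemma serves_appendD:
  "serves p s (us @ vs) t s'' \<Longrightarrow>
     \<exists>t1 t2 s'. serves p s us t1 s' \<and> serves p s' vs t2 s'' \<and> t = t1 + t2"
proof (induction us arbitrary: s t)
  case Nil
  have "serves p s [] 0 s" by (rule serves.Nil)
  moreover have "serves p s vs t s''" using Nil by simp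
  ultimately show ?case by (intro exI[of _ 0] exI[of _ t] exI[of _ s]) simp
next
  case (Cons u us)
  from Cons.prems obtain t0 t' r where
    *: "exec p (receive u s) t0 r" "serves p r (us @ vs) t' s''" "t = t0 + t'"
    unfolding append_Cons by (rule serves_ConsE)
  from Cons.IH[OF *(2)] obtain t1 t2 s' where
    **: "serves p r us t1 s'" "serves p s' vs t2 s''" "t' = t1 + t2"
    by (elim exE conjE)
  from serves.Cons[OF *(1) **(1)] **(2) show ?case
    by (intro exI[of _ "t0 + t1"] exI[of _ t2] exI[of _ s']) (simp add: *(3) **(3))
qed

end

theory Submission
  imports Defs
begin

text \<open>
  A node \<open>v\<close> with \<open>W v > c v\<close> is raised to one level above the lowest level \<open>j\<close> of its edges; a
  node \<open>v\<close> at a positive level with \<open>W v < c* v\<close> is lowered by one level, or directly to level 0 if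
  none of its edges has the level of \<open>v\<close>.  In both cases only edges in a single bucket of \<open>v\<close> can change
  their level.  With \<open>\<psi> v = \<beta> ^ l v / (f \<mu> \<epsilon>) * max 0 (c v - \<beta> W v)\<close> for \<open>l v > 0\<close> and
  \<open>\<psi> v = 0\<close> otherwise, the potential \<open>2 (\<Sum>e. \<beta> (L - l e)) + 2 (\<Sum>v. \<psi> v) + \<epsilon> |{v. l v > 0}|\<close> drops by at least
  \<open>\<epsilon> max 1 k\<close> when a bucket of \<open>k\<close> edges is processed.  An insertion increases it by \<open>O(L)\<close>
  and a deletion by \<open>O(1 / \<epsilon>)\<close>, and processing one edge takes time \<open>O(f)\<close>.

  A raised node never exceeds the level \<open>L\<close>, since its weight is at most \<open>m \<mu> / \<beta> ^ j\<close>; so neither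
  \<open>L\<close> nor the minimal capacity has to be computed.  The lowest bucket is found by a pointer
  \<open>lo v\<close> that, apart from insertions, moves down by at most one level per level change of an edge at \<open>v\<close>.
\<close>

section \<open>Levels and their potential\<close>

text \<open>The machine has no product of natural numbers and no way from reals to natural numbers.
  Bucket addresses \<open>v + n * l\<close> and powers of \<open>\<beta>\<close> therefore come from
  tables that gain an entry when a new level is reached; \<open>M\<close> bounds the levels covered
  so far. An edge sits in one bucket for each endpoint, and singly linked lists offer no fast
  removal from the middle, which is why relinking leaves old records behind. The scale
  \<open>f \<mu> \<epsilon>\<close> of \<open>\<psi>\<close> fits the weight that an endpoint loses
  when an edge is raised by one level: the loss increases \<open>\<psi>\<close> by at most
  \<open>1 / f\<close>, so the other endpoints of the edge together cost less than the
  \<open>\<beta>\<close> that the edge releases. Work outside the level potential is prepaid in the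
  same manner: a record pays for its own removal, a stack entry for one visit to a node, and the
  room above the pointer \<open>lo v\<close> for its climb. A move adds \<open>O(f)\<close> per edge
  of the bucket to these reserves; this is charged to the level potential, scaled by
  \<open>f / \<epsilon>\<close>.\<close>

abbreviation inc :: "hypergraph \<Rightarrow> nat \<Rightarrow> nat set" where "inc \<equiv> incident_edges"

locale instance_params =
  fixes n m f :: nat and \<mu> :: real and c :: "nat \<Rightarrow> real" and \<epsilon> \<alpha> \<beta> :: real
  assumes n_pos: "n \<ge> 1" and m_pos: "m \<ge> 1" and f_pos: "f \<ge> 1" and mu_ge_1: "\<mu> \<ge> 1"
    and c_pos: "\<And>v. v < n \<Longrightarrow> c v > 0"
    and eps_pos: "0 < \<epsilon>" and eps_less_1: "\<epsilon> < 1"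
    and alpha_eq: "\<alpha> = 1 + 1 / real f + 3 * \<epsilon>" and beta_eq: "\<beta> = 1 + \<epsilon>"
begin

abbreviation L :: nat where "L \<equiv> max_level \<alpha> \<beta> n m \<mu> c"

abbreviation W :: "hypergraph \<Rightarrow> (nat \<Rightarrow> nat) \<Rightarrow> nat \<Rightarrow> real" where
  "W \<equiv> node_weight \<beta> \<mu>"

definition wf_graph :: "hypergraph \<Rightarrow> bool" where
  "wf_graph G \<longleftrightarrow> finite (dom G) \<and> card (dom G) \<le> m \<and>
     (\<forall>e S. G e = Some S \<longrightarrow> S \<noteq> {} \<and> S \<subseteq> {..<n} \<and> card S \<le> f)"

lemma beta_gt_1: "\<beta> > 1" and beta_pos: "\<beta> > 0" and mu_pos: "\<mu> > 0" and fr_pos: "real f > 0"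
  using beta_eq eps_pos mu_ge_1 f_pos by auto

section \<open>Incidence, and edge levels when one node changes its level\<close>

lemma endpoints_Some: "G e = Some S \<Longrightarrow> endpoints G e = S"
  by (auto simp: endpoints_def incident_edges_def)

lemma incident_iff: "G e = Some S \<Longrightarrow> e \<in> inc G v \<longleftrightarrow> v \<in> S"
  by (auto simp: incident_edges_def)

lemma incident_subset_dom: "inc G v \<subseteq> dom G"
  by (auto simp: incident_edges_def)

lemma wf_finite_incident: "wf_graph G \<Longrightarrow> finite (inc G v)"
  using finite_subset[OF incident_subset_dom] by (auto simp: wf_graph_def)

lemma wf_edgeD:
  assumes "wf_graph G" "G e = Some S"
  shows "finite S" "S \<noteq> {}" "S \<subseteq> {..<n}" "card S \<le> f"
  using assms finite_subset[of S "{..<n}"] by (auto simp: wf_graph_def)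

lemma edge_level_Some: "G e = Some S \<Longrightarrow> edge_level G l e = Max (l ` S)"
  by (simp add: edge_level_def endpoints_Some)

lemma level_le_edge_level:
  assumes "wf_graph G" "e \<in> inc G v"
  shows "l v \<le> edge_level G l e"
proof -
  obtain S where S: "G e = Some S" "v \<in> S" using assms(2) by (auto simp: incident_edges_def)
  then show ?thesis using wf_edgeD(1)[OF assms(1) S(1)] by (simp add: edge_level_Some)
qed

lemma edge_level_le:
  assumes "wf_graph G" "e \<in> dom G" "\<And>v. v < n \<Longrightarrow> l v \<le> M"
  shows "edge_level G l e \<le> M"
proof -
  obtain S where S: "G e = Some S" using assms(2) by auto
  show ?thesis using wf_edgeD[OF assms(1) S] assms(3) S by (auto simp: edge_level_Some)
qed

text \<open>The image of the endpoints changes in one element only, and the new element dominates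
  the old one. An edge with \<open>v\<close> as its only endpoint is treated apart because
  \<open>Max\<close> of the empty remainder is unspecified.\<close>

lemma edge_level_raise:
  assumes "wf_graph G" "e \<in> inc G v" "l v \<le> x"
  shows "edge_level G (l(v := x)) e = max x (edge_level G l e)"
proof -
  obtain S where S: "G e = Some S" "v \<in> S" using assms(2) by (auto simp: incident_edges_def)
  have fin: "finite S" using wf_edgeD(1)[OF assms(1) S(1)] .
  have img: "l(v := x) ` S = insert x (l ` (S - {v}))" using S(2) by auto
  have img2: "l ` S = insert (l v) (l ` (S - {v}))" using S(2) by auto
  show ?thesis
  proof (cases "S - {v} = {}")
    case True
    then have "l(v := x) ` S = {x}" "l ` S = {l v}" unfolding img img2 True by simp_all
    then show ?thesis using assms(3) by (simp add: edge_level_Some[of G e S, OF S(1)] del: fun_upd_apply)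
  next
    case False
    then have "Max (l(v := x) ` S) = max x (Max (l ` (S - {v})))"
      and "Max (l ` S) = max (l v) (Max (l ` (S - {v})))"
      unfolding img img2 using fin by (auto intro!: Max_insert)
    then show ?thesis using assms(3) S(1) by (simp add: edge_level_Some)
  qed
qed

lemma edge_level_other:
  assumes "e \<notin> inc G v"
  shows "edge_level G (l(v := x)) e = edge_level G l e"
proof -
  have "v \<notin> endpoints G e" using assms by (auto simp: endpoints_def)
  then have "l(v := x) ` endpoints G e = l ` endpoints G e" by auto
  then show ?thesis by (simp add: edge_level_def)
qed

text \<open>Lowering \<open>v\<close> to \<open>x\<close> is undone by raising it back to
  \<open>l v\<close>, so \<open>edge_level_raise\<close>, applied to the lowered assignment,
  expresses the old levels by the new ones.\<close>

lemma edge_level_lower: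
  assumes "wf_graph G" "e \<in> inc G v" "x \<le> l v"
  shows "edge_level G l e = max (l v) (edge_level G (l(v := x)) e)"
    and "x \<le> edge_level G (l(v := x)) e"
  using edge_level_raise[OF assms(1,2), of "l(v := x)" "l v"]
    level_le_edge_level[OF assms(1,2), of "l(v := x)"] assms(3) by auto

lemma edge_weight_pos: "edge_weight \<beta> \<mu> G l e > 0"
  using beta_pos mu_pos by (simp add: edge_weight_def)

text \<open>All edges at \<open>v\<close> have level at least \<open>j\<close>, so
  \<open>W v\<close> is at most \<open>m * \<mu> / \<beta> ^ j\<close>; exceeding \<open>c v\<close>
  therefore forces \<open>\<beta> ^ j\<close> strictly below the argument of the logarithm in
  \<open>max_level\<close>. The strictness leaves room for the level \<open>Suc j\<close>.\<close>

lemma level_bound: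
  assumes wf: "wf_graph G" and v: "v < n" and dirty: "W G l v > c v"
    and j: "\<And>e. e \<in> inc G v \<Longrightarrow> j \<le> edge_level G l e"
  shows "Suc j \<le> L"
proof -
  have cm: "c_min n c \<le> c v" using v by (auto simp: c_min_def)
  have cm_pos: "c_min n c > 0"
    using c_pos n_pos by (subst c_min_def, subst Min_gr_iff) (auto simp: lessThan_empty_iff)
  have "W G l v \<le> (\<Sum>e\<in>inc G v. \<mu> / \<beta> ^ j)"
    unfolding node_weight_def edge_weight_def
    using j beta_gt_1 mu_pos by (intro sum_mono divide_left_mono power_increasing) auto
  also have "\<dots> = real (card (inc G v)) * (\<mu> / \<beta> ^ j)" by simp
  also have "\<dots> \<le> real m * (\<mu> / \<beta> ^ j)"
  proof (rule mult_right_mono)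
    have "card (inc G v) \<le> card (dom G)"
      using wf by (intro card_mono incident_subset_dom) (auto simp: wf_graph_def)
    then show "real (card (inc G v)) \<le> real m" using wf by (auto simp: wf_graph_def)
  qed (use mu_pos beta_pos in auto)
  finally have "c_min n c < real m * \<mu> / \<beta> ^ j" using dirty cm by simp
  then have 1: "\<beta> ^ j < real m * \<mu> / c_min n c"
    using cm_pos beta_pos by (simp add: field_simps)
  have "\<alpha> \<ge> 1" using alpha_eq eps_pos by simp
  then have "real m * \<mu> / c_min n c * 1 \<le> real m * \<mu> / c_min n c * \<alpha>"
    using cm_pos mu_pos by (intro mult_left_mono) auto
  then have 2: "\<beta> ^ j < real m * \<mu> * \<alpha> / c_min n c" using 1 by simp
  have "real j = log \<beta> (\<beta> ^ j)" using beta_gt_1 by (simp add: log_nat_power)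
  also have "\<dots> < log \<beta> (real m * \<mu> * \<alpha> / c_min n c)"
    using 2 beta_gt_1 by (intro log_less) (auto intro: less_trans[of _ "\<beta> ^ j"])
  finally have "int j < \<lceil>log \<beta> (real m * \<mu> * \<alpha> / c_min n c)\<rceil>" by (simp add: less_ceiling_iff)
  then show ?thesis unfolding max_level_def by linarith
qed

section \<open>The potential of a level assignment\<close>

definition node_pot :: "hypergraph \<Rightarrow> (nat \<Rightarrow> nat) \<Rightarrow> nat \<Rightarrow> real" where
  "node_pot G l v =
     (if l v = 0 then 0 else \<beta> ^ l v / (real f * \<mu> * \<epsilon>) * max 0 (c v - \<beta> * W G l v))"

definition edge_pot :: "hypergraph \<Rightarrow> (nat \<Rightarrow> nat) \<Rightarrow> real" where
  "edge_pot G l = (\<Sum>e\<in>dom G. \<beta> * (real L - real (edge_level G l e)))"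

text \<open>Raising a bucket of \<open>k\<close> edges is only guaranteed to release
  \<open>\<epsilon> * k\<close> from the edge and node potentials. Doubling them leaves
  \<open>\<epsilon> * k\<close> even when \<open>v\<close> enters the set of nodes of positive
  level.\<close>

definition level_pot :: "hypergraph \<Rightarrow> (nat \<Rightarrow> nat) \<Rightarrow> real" where
  "level_pot G l = 2 * (edge_pot G l + (\<Sum>v<n. node_pot G l v)) + \<epsilon> * real (card {v. v < n \<and> 0 < l v})"

lemma node_pot_nonneg: "node_pot G l v \<ge> 0"
  unfolding node_pot_def using beta_pos mu_pos eps_pos fr_pos by auto

lemma edge_pot_nonneg:
  assumes "wf_graph G" "\<And>v. v < n \<Longrightarrow> l v \<le> L"
  shows "edge_pot G l \<ge> 0"
  unfolding edge_pot_def
  using edge_level_le[OF assms(1) _ assms(2)] beta_pos by (intro sum_nonneg) (auto intro!: mult_nonneg_nonneg)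

lemma level_pot_nonneg:
  assumes "wf_graph G" "\<And>v. v < n \<Longrightarrow> l v \<le> L"
  shows "level_pot G l \<ge> 0"
  unfolding level_pot_def
  using edge_pot_nonneg[OF assms] sum_nonneg[of "{..<n}" "node_pot G l"] node_pot_nonneg eps_pos by simp

text \<open>The map from \<open>x\<close> to \<open>max 0 (c u - \<beta> * x)\<close> is antitone
  and grows by at most \<open>\<beta>\<close> times a decrease of \<open>x\<close>; this
  \<open>\<beta>\<close> turns \<open>\<beta> ^ l u\<close> into \<open>\<beta> ^ Suc (l u)\<close>.
  Neither the graphs nor the other levels have to agree, so the bound serves level changes and
  deletions alike.\<close>

lemma node_pot_diff_le:
  assumes "l' u = l u"
  shows "node_pot G' l' u \<le> node_pot G l u + \<beta> ^ Suc (l u) / (real f * \<mu> * \<epsilon>) * max 0 (W G l u - W G' l' u)"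
proof (cases "l u = 0")
  case True
  then show ?thesis using assms beta_pos mu_pos eps_pos fr_pos by (simp add: node_pot_def)
next
  case False
  define A where "A = \<beta> ^ l u / (real f * \<mu> * \<epsilon>)"
  have A: "A \<ge> 0" unfolding A_def using beta_pos mu_pos eps_pos fr_pos by simp
  have "max 0 (c u - \<beta> * W G' l' u) \<le> max 0 (c u - \<beta> * W G l u) + \<beta> * max 0 (W G l u - W G' l' u)"
  proof (cases "W G' l' u \<le> W G l u")
    case True
    moreover have "\<beta> * W G' l' u \<le> \<beta> * W G l u" using True beta_pos by simp
    ultimately show ?thesis by (simp add: max_def algebra_simps)
  next
    case False
    then have "\<beta> * W G l u \<le> \<beta> * W G' l' u" using beta_pos by simp
    then show ?thesis using False by (simp add: max_def)
  qed
  from mult_left_mono[OF this A] show ?thesis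
    using False assms by (simp add: node_pot_def A_def algebra_simps)
qed

lemma node_pot_mono:
  assumes "l' u = l u" "W G l u \<le> W G' l' u"
  shows "node_pot G' l' u \<le> node_pot G l u"
  using node_pot_diff_le[of l' u l G' G] assms by (simp add: max_def split: if_splits)

section \<open>Potential drop when a node changes its level\<close>

lemma card_pos_levels_upd:
  fixes l :: "nat \<Rightarrow> nat"
  shows "card {u. u < n \<and> 0 < (l(v := x)) u} \<le> Suc (card {u. u < n \<and> 0 < l u})"
proof -
  have "card {u. u < n \<and> 0 < (l(v := x)) u} \<le> card (insert v {u. u < n \<and> 0 < l u})"
    by (rule card_mono) auto
  also have "\<dots> \<le> Suc (card {u. u < n \<and> 0 < l u})" by (simp add: card_insert_if)
  finally show ?thesis .
qed

lemma card_pos_levels_mono: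
  fixes l :: "nat \<Rightarrow> nat"
  shows "x \<le> l v \<Longrightarrow> card {u. u < n \<and> 0 < (l(v := x)) u} \<le> card {u. u < n \<and> 0 < l u}"
  by (rule card_mono) (auto simp: fun_upd_apply split: if_splits)

lemma card_pos_levels_zero:
  fixes l :: "nat \<Rightarrow> nat"
  assumes "v < n" "0 < l v"
  shows "Suc (card {u. u < n \<and> 0 < (l(v := 0)) u}) = card {u. u < n \<and> 0 < l u}"
proof -
  have "{u. u < n \<and> 0 < l u} = insert v {u. u < n \<and> 0 < (l(v := 0)) u}" using assms by auto
  moreover have "v \<notin> {u. u < n \<and> 0 < (l(v := 0)) u}" "finite {u. u < n \<and> 0 < (l(v := 0)) u}"
    by auto
  ultimately show ?thesis by (metis card_insert_disjoint)
qed

lemma weight_power_drop: "\<mu> / \<beta> ^ j - \<mu> / \<beta> ^ Suc j = \<mu> * \<epsilon> / \<beta> ^ Suc j"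
proof -
  have "\<mu> / \<beta> ^ j = \<mu> * \<beta> / \<beta> ^ Suc j" using beta_pos by simp
  then show ?thesis by (simp add: diff_divide_distrib[symmetric] beta_eq algebra_simps)
qed

text \<open>After the two sums are exchanged, each edge of \<open>F\<close> counts its endpoints
  other than \<open>v\<close>, of which there are at most \<open>f - 1\<close>.\<close>

lemma sum_endpoint_counts:
  assumes "wf_graph G" "F \<subseteq> inc G v" "v < n"
  shows "(\<Sum>u\<in>{..<n} - {v}. real (card (F \<inter> inc G u))) \<le> real (card F) * (real f - 1)"
proof -
  have finF: "finite F" using finite_subset[OF assms(2) wf_finite_incident[OF assms(1)]] .
  have "(\<Sum>u\<in>{..<n} - {v}. real (card (F \<inter> inc G u)))
      = (\<Sum>u\<in>{..<n} - {v}. \<Sum>e\<in>F. if e \<in> inc G u then 1 else 0)"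
    using finF by (intro sum.cong refl) (simp add: sum.If_cases Int_def)
  also have "\<dots> = (\<Sum>e\<in>F. \<Sum>u\<in>{..<n} - {v}. if e \<in> inc G u then 1 else 0)"
    by (rule sum.swap)
  also have "\<dots> \<le> (\<Sum>e\<in>F. real f - 1)"
  proof (rule sum_mono)
    fix e assume e: "e \<in> F"
    then obtain S where S: "G e = Some S" "v \<in> S" using assms(2) by (auto simp: incident_edges_def)
    have "(\<Sum>u\<in>{..<n} - {v}. if e \<in> inc G u then 1 else 0 :: real)
        = real (card (({..<n} - {v}) \<inter> S))"
      using incident_iff[of G e, OF S(1)] by (simp add: sum.If_cases Int_def)
    also have "({..<n} - {v}) \<inter> S = S - {v}" using wf_edgeD(3)[OF assms(1) S(1)] by auto
    also have "real (card (S - {v})) \<le> real f - 1"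
    proof -
      have "Suc (card (S - {v})) = card S" using wf_edgeD(1)[OF assms(1) S(1)] S(2) by (rule card.remove[symmetric])
      then show ?thesis using wf_edgeD(4)[OF assms(1) S(1)] by linarith
    qed
    finally show "(\<Sum>u\<in>{..<n} - {v}. if e \<in> inc G u then 1 else 0 :: real) \<le> real f - 1" .
  qed
  finally show ?thesis by simp
qed

text \<open>Each edge in \<open>F\<close> gives up \<open>\<beta> = 1 + \<epsilon>\<close> of edge
  potential. Its other endpoints lose weight \<open>\<mu> * \<epsilon> / \<beta> ^ Suc j\<close>
  each, which costs at most \<open>1 / f\<close> apiece and less than 1 per edge, and
  \<open>v\<close> itself ends with node potential 0.\<close>

lemma level_up:
  assumes wf: "wf_graph G" and v: "v < n" and dirty: "W G l v > c v"
    and j: "\<And>e. e \<in> inc G v \<Longrightarrow> j \<le> edge_level G l e"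
    and ex: "e0 \<in> inc G v" "edge_level G l e0 = j"
  defines "F \<equiv> {e \<in> inc G v. edge_level G l e = j}"
  shows "level_pot G (l(v := Suc j)) + \<epsilon> * real (card F) \<le> level_pot G l"
proof -
  let ?l = "l(v := Suc j)"
  have lv: "l v \<le> j" using level_le_edge_level[OF wf ex(1), of l] ex(2) by simp
  have finI: "finite (inc G u)" for u using wf_finite_incident[OF wf] .
  have finF: "finite F" using finI unfolding F_def by auto
  have el: "edge_level G ?l e = (if e \<in> F then Suc j else edge_level G l e)" for e
  proof (cases "e \<in> inc G v")
    case True
    then show ?thesis using edge_level_raise[OF wf True, of l "Suc j"] lv j[OF True] by (auto simp: F_def)
  next
    case False
    then show ?thesis using edge_level_other[OF False] by (simp add: F_def)
  qed
  have elF: "edge_level G l e = j" if "e \<in> F" for e using that by (simp add: F_def)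
  have ew: "edge_weight \<beta> \<mu> G ?l e = edge_weight \<beta> \<mu> G l e - (if e \<in> F then \<mu> * \<epsilon> / \<beta> ^ Suc j else 0)" for e
    using weight_power_drop[of j] by (simp add: edge_weight_def el elF del: power_Suc)
  have Wu: "W G ?l u = W G l u - real (card (F \<inter> inc G u)) * (\<mu> * \<epsilon> / \<beta> ^ Suc j)" for u
  proof -
    have "W G ?l u = W G l u - (\<Sum>e\<in>inc G u. if e \<in> F then \<mu> * \<epsilon> / \<beta> ^ Suc j else 0)"
      unfolding node_weight_def ew by (simp add: sum_subtractf)
    also have "(\<Sum>e\<in>inc G u. if e \<in> F then \<mu> * \<epsilon> / \<beta> ^ Suc j else 0)
        = real (card (F \<inter> inc G u)) * (\<mu> * \<epsilon> / \<beta> ^ Suc j)"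
      using finI[of u] by (simp add: sum.If_cases Int_commute Int_def conj_commute)
    finally show ?thesis .
  qed
  \<comment> \<open>Every edge weight falls by a factor of at most \<open>\<beta>\<close>, so
    \<open>\<beta> * W\<close> still exceeds \<open>c v\<close> after the raise. This is the purpose
    of the \<open>\<beta>\<close> in front of the weight in \<open>node_pot\<close>.\<close>
  have ewb: "edge_weight \<beta> \<mu> G l e / \<beta> \<le> edge_weight \<beta> \<mu> G ?l e" for e
    unfolding edge_weight_def el using beta_gt_1 mu_pos elF[of e]
    by (auto simp: field_simps)
  have "W G l v / \<beta> \<le> W G ?l v"
    unfolding node_weight_def sum_divide_distrib by (intro sum_mono ewb)
  then have "c v < \<beta> * W G ?l v" using dirty beta_pos by (simp add: field_simps)
  then have pv': "node_pot G ?l v = 0" by (simp add: node_pot_def)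
  have pu: "node_pot G ?l u \<le> node_pot G l u + real (card (F \<inter> inc G u)) / real f"
    if "u \<noteq> v" for u
  proof -
    have "node_pot G ?l u \<le> node_pot G l u + \<beta> ^ Suc (l u) / (real f * \<mu> * \<epsilon>) *
        max 0 (real (card (F \<inter> inc G u)) * (\<mu> * \<epsilon> / \<beta> ^ Suc j))"
      using node_pot_diff_le[of ?l u l G G] that Wu[of u] by simp
    also have "\<beta> ^ Suc (l u) / (real f * \<mu> * \<epsilon>) *
        max 0 (real (card (F \<inter> inc G u)) * (\<mu> * \<epsilon> / \<beta> ^ Suc j))
        = real (card (F \<inter> inc G u)) / real f * (\<beta> ^ l u / \<beta> ^ j)"
      using beta_pos mu_pos eps_pos fr_pos by (simp add: max_def field_simps)
    \<comment> \<open>If \<open>u\<close> lies on an edge of \<open>F\<close>, that edge has level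
      \<open>j\<close>, hence \<open>l u \<le> j\<close>; otherwise the product is 0.\<close>
    also have "\<dots> \<le> real (card (F \<inter> inc G u)) / real f"
    proof (cases "F \<inter> inc G u = {}")
      case False
      then obtain e where "e \<in> F" "e \<in> inc G u" by auto
      then have "l u \<le> j" using level_le_edge_level[OF wf, of e u l] elF[of e] by auto
      then have "\<beta> ^ l u / \<beta> ^ j \<le> 1" using beta_gt_1 by (simp add: power_increasing)
      then show ?thesis by (intro mult_left_le) auto
    qed simp
    finally show ?thesis by (simp del: fun_upd_apply)
  qed
  have "(\<Sum>u<n. node_pot G ?l u) = (\<Sum>u\<in>{..<n} - {v}. node_pot G ?l u)"
    using v pv' by (subst sum.remove[of _ v]) auto
  also have "\<dots> \<le> (\<Sum>u\<in>{..<n} - {v}. node_pot G l u + real (card (F \<inter> inc G u)) / real f)"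
    using pu by (intro sum_mono) auto
  also have "\<dots> = (\<Sum>u\<in>{..<n} - {v}. node_pot G l u)
      + (\<Sum>u\<in>{..<n} - {v}. real (card (F \<inter> inc G u))) / real f"
    by (simp add: sum.distrib sum_divide_distrib)
  also have "\<dots> \<le> (\<Sum>u<n. node_pot G l u) + real (card F) * (real f - 1) / real f"
    using sum_endpoint_counts[OF wf, of F v] v fr_pos node_pot_nonneg
    by (intro add_mono divide_right_mono sum_mono2) (auto simp: F_def)
  also have "real (card F) * (real f - 1) / real f \<le> real (card F)"
    using fr_pos by (simp add: field_simps)
  finally have nodes: "(\<Sum>u<n. node_pot G ?l u) \<le> (\<Sum>u<n. node_pot G l u) + real (card F)"
    by simp
  have "edge_pot G ?l = (\<Sum>e\<in>dom G. \<beta> * (real L - real (edge_level G l e)) - (if e \<in> F then \<beta> else 0))"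
    unfolding edge_pot_def by (intro sum.cong refl) (auto simp: el elF algebra_simps)
  also have "\<dots> = edge_pot G l - (\<Sum>e\<in>dom G. if e \<in> F then \<beta> else 0)"
    unfolding edge_pot_def by (rule sum_subtractf)
  also have "(\<Sum>e\<in>dom G. if e \<in> F then \<beta> else 0) = real (card F) * \<beta>"
  proof -
    have "dom G \<inter> {e. e \<in> F} = F" using incident_subset_dom[of G v] by (auto simp: F_def)
    then show ?thesis using wf by (simp add: sum.If_cases wf_graph_def)
  qed
  finally have edges: "edge_pot G ?l = edge_pot G l - real (card F) * \<beta>" .
  have "e0 \<in> F" using ex by (simp add: F_def)
  \<comment> \<open>The bucket contains \<open>e0\<close>, so a node newly raised from level 0,
    worth \<open>\<epsilon>\<close>, is covered by \<open>\<epsilon> * card F\<close>.\<close>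
  then have "card F \<noteq> 0" using finF by auto
  then have "\<epsilon> * 1 \<le> \<epsilon> * real (card F)" using eps_pos by (intro mult_left_mono) auto
  moreover have "\<epsilon> * real (card {u. u < n \<and> 0 < ?l u}) \<le> \<epsilon> * (1 + real (card {u. u < n \<and> 0 < l u}))"
    using card_pos_levels_upd[of l v "Suc j"] eps_pos by (intro mult_left_mono) auto
  ultimately show ?thesis
    unfolding level_pot_def using nodes edges by (simp add: beta_eq algebra_simps)
qed

lemma c_star_eq: "real f * \<alpha> * \<beta> * c_star \<alpha> \<beta> f c v = c v"
proof -
  have "\<alpha> > 0" using alpha_eq eps_pos fr_pos by (simp add: add_pos_pos)
  then show ?thesis using fr_pos beta_pos by (simp add: c_star_def)
qed

lemma c_star_le: assumes "v < n" shows "0 < c_star \<alpha> \<beta> f c v" "c_star \<alpha> \<beta> f c v \<le> c v"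
proof -
  have a: "\<alpha> > 1" using alpha_eq eps_pos fr_pos by (simp add: add_pos_pos)
  then show p: "0 < c_star \<alpha> \<beta> f c v"
    using c_pos[OF assms] fr_pos beta_pos by (simp add: c_star_def)
  have "1 * 1 \<le> real f * \<alpha>" using a f_pos by (intro mult_mono) auto
  then have "1 * 1 \<le> real f * \<alpha> * \<beta>" using a beta_gt_1 by (intro mult_mono) auto
  then have "1 * c_star \<alpha> \<beta> f c v \<le> real f * \<alpha> * \<beta> * c_star \<alpha> \<beta> f c v"
    using p by (intro mult_right_mono) auto
  then show "c_star \<alpha> \<beta> f c v \<le> c v" by (simp only: c_star_eq mult_1)
qed

text \<open>Lowering by one level divides the factor \<open>\<beta> ^ l v\<close> in the potential
  of \<open>v\<close> by \<open>\<beta>\<close>. This frees at least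
  \<open>(1 + 3 * \<epsilon>) * card F\<close>, because the edges of \<open>F\<close>, of weight
  \<open>\<mu> / \<beta> ^ l v\<close> each, fit into a weight below \<open>c_star\<close>. The
  edges regain at most \<open>(1 + \<epsilon>) * card F\<close> of potential, and no node loses
  weight.\<close>

lemma level_down:
  assumes wf: "wf_graph G" and v: "v < n" and dirty: "W G l v < c_star \<alpha> \<beta> f c v"
    and pos: "l v > 0"
  defines "F \<equiv> {e \<in> inc G v. edge_level G l e = l v}"
  shows "level_pot G (l(v := l v - 1)) + \<epsilon> * real (card F) \<le> level_pot G l"
proof -
  let ?l = "l(v := l v - 1)"
  let ?cs = "c_star \<alpha> \<beta> f c v"
  have finI: "finite (inc G u)" for u using wf_finite_incident[OF wf] .
  have finF: "finite F" using finI unfolding F_def by auto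
  have el: "edge_level G ?l e \<le> edge_level G l e"
      "edge_level G l e \<le> edge_level G ?l e + (if e \<in> F then 1 else 0)" for e
  proof -
    have "edge_level G ?l e \<le> edge_level G l e \<and>
        edge_level G l e \<le> edge_level G ?l e + (if e \<in> F then 1 else 0)"
    proof (cases "e \<in> inc G v")
      case True
      define x where "x = edge_level G ?l e"
      have 1: "edge_level G l e = max (l v) x" and 2: "l v - 1 \<le> x"
        unfolding x_def by (rule edge_level_lower[OF wf True diff_le_self])+
      have "e \<in> F \<longleftrightarrow> max (l v) x = l v" using True 1 by (simp add: F_def)
      then show ?thesis unfolding x_def[symmetric] 1 using 2 by (auto simp: max_def split: if_splits)
    next
      case False
      then show ?thesis using edge_level_other[OF False] by simp
    qed
    then show "edge_level G ?l e \<le> edge_level G l e"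
      "edge_level G l e \<le> edge_level G ?l e + (if e \<in> F then 1 else 0)" by blast+
  qed
  have Wmono: "W G l u \<le> W G ?l u" for u
    unfolding node_weight_def edge_weight_def
    using el beta_gt_1 mu_pos by (intro sum_mono divide_left_mono power_increasing) auto
  \<comment> \<open>The number of edges of level \<open>l v\<close> whose weights would add up to
    \<open>c_star\<close>.\<close>
  define X where "X = \<beta> ^ l v * ?cs / \<mu>"
  have kX: "real (card F) \<le> X"
  proof -
    have "real (card F) * (\<mu> / \<beta> ^ l v) = (\<Sum>e\<in>F. edge_weight \<beta> \<mu> G l e)"
      by (simp add: edge_weight_def F_def)
    also have "\<dots> \<le> W G l v"
      unfolding node_weight_def using finI edge_weight_pos
      by (intro sum_mono2) (auto simp: F_def intro: less_imp_le)
    finally have "real (card F) * (\<mu> / \<beta> ^ l v) \<le> ?cs" using dirty by simp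
    then show ?thesis using beta_pos mu_pos by (simp add: X_def field_simps)
  qed
  have pv: "node_pot G ?l v + (1 + 3 * \<epsilon>) * X \<le> node_pot G l v"
  proof -
    define A where "A = \<beta> ^ (l v - 1) / (real f * \<mu> * \<epsilon>)"
    define D where "D = c v - \<beta> * W G l v"
    have A: "A > 0" unfolding A_def using beta_pos mu_pos eps_pos fr_pos by simp
    have cv: "c v = real f * \<alpha> * \<beta> * ?cs" by (simp add: c_star_eq)
    have "\<beta> * W G l v \<le> \<beta> * ?cs" using dirty beta_pos by simp
    then have D: "D \<ge> (real f * \<alpha> - 1) * \<beta> * ?cs" unfolding D_def cv by (simp add: algebra_simps)
    \<comment> \<open>Here the choice of \<open>\<alpha>\<close> enters: its \<open>1 / f\<close>
      cancels the \<open>- 1\<close> that stems from the weight left at \<open>v\<close>, and the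
      remaining \<open>1 + 3 * \<epsilon>\<close> outweighs \<open>\<beta>\<close>.\<close>
    have fa: "real f * \<alpha> - 1 = real f * (1 + 3 * \<epsilon>)"
      using fr_pos by (simp add: alpha_eq field_simps)
    have D0: "D > 0" using D c_star_le[OF v] fa fr_pos beta_pos eps_pos
      by (auto intro!: less_le_trans[OF _ D] mult_pos_pos)
    have "\<beta> ^ l v = \<beta> * \<beta> ^ (l v - 1)" using pos by (cases "l v") auto
    then have bA: "\<beta> ^ l v / (real f * \<mu> * \<epsilon>) = \<beta> * A" by (simp add: A_def)
    have p1: "node_pot G l v = \<beta> * A * D" using pos D0 bA by (simp add: node_pot_def D_def)
    have p2: "node_pot G ?l v \<le> A * D"
    proof -
      have "max 0 (c v - \<beta> * W G ?l v) \<le> D"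
        using D0 Wmono[of v] beta_pos by (auto simp: D_def)
      then have "A * max 0 (c v - \<beta> * W G ?l v) \<le> A * D" using A by (intro mult_left_mono) auto
      moreover have "node_pot G ?l v \<le> A * max 0 (c v - \<beta> * W G ?l v)"
        using A unfolding node_pot_def A_def by (auto simp del: fun_upd_apply simp: fun_upd_same)
      ultimately show ?thesis by (rule order_trans[rotated])
    qed
    have "(1 + 3 * \<epsilon>) * X = \<epsilon> * A * ((real f * \<alpha> - 1) * \<beta> * ?cs)"
    proof -
      have "\<epsilon> * A * ((real f * \<alpha> - 1) * \<beta> * ?cs) = \<epsilon> * (\<beta> * A) * (real f * (1 + 3 * \<epsilon>)) * ?cs"
        unfolding fa by (simp add: mult_ac)
      also have "\<dots> = (1 + 3 * \<epsilon>) * X"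
        unfolding bA[symmetric] X_def using fr_pos mu_pos eps_pos by (simp add: field_simps)
      finally show ?thesis by simp
    qed
    also have "\<dots> \<le> \<epsilon> * A * D" using D A eps_pos by (intro mult_left_mono) auto
    finally show ?thesis using p1 p2 by (simp add: beta_eq algebra_simps)
  qed
  have "(\<Sum>u<n. node_pot G ?l u) = node_pot G ?l v + (\<Sum>u\<in>{..<n} - {v}. node_pot G ?l u)"
    using v by (subst sum.remove[of _ v]) auto
  also have "(\<Sum>u\<in>{..<n} - {v}. node_pot G ?l u) \<le> (\<Sum>u\<in>{..<n} - {v}. node_pot G l u)"
    using Wmono by (intro sum_mono node_pot_mono) auto
  also have "node_pot G ?l v + (\<Sum>u\<in>{..<n} - {v}. node_pot G l u) + (1 + 3 * \<epsilon>) * X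
      \<le> node_pot G l v + (\<Sum>u\<in>{..<n} - {v}. node_pot G l u)"
    using pv by simp
  also have "\<dots> = (\<Sum>u<n. node_pot G l u)"
    using v by (subst (2) sum.remove[of _ v]) auto
  finally have nodes: "(\<Sum>u<n. node_pot G ?l u) + (1 + 3 * \<epsilon>) * X \<le> (\<Sum>u<n. node_pot G l u)"
    by simp
  have "edge_pot G ?l \<le> (\<Sum>e\<in>dom G. \<beta> * (real L - real (edge_level G l e)) + (if e \<in> F then \<beta> else 0))"
    unfolding edge_pot_def
  proof (rule sum_mono)
    fix e
    have "real (edge_level G l e) \<le> real (edge_level G ?l e) + (if e \<in> F then 1 else 0)"
      using el(2)[of e] by (auto split: if_splits)
    from mult_left_mono[OF this less_imp_le[OF beta_pos]]
    show "\<beta> * (real L - real (edge_level G ?l e))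
        \<le> \<beta> * (real L - real (edge_level G l e)) + (if e \<in> F then \<beta> else 0)"
      by (auto simp: algebra_simps split: if_splits)
  qed
  also have "\<dots> = edge_pot G l + (\<Sum>e\<in>dom G. if e \<in> F then \<beta> else 0)"
    unfolding edge_pot_def by (rule sum.distrib)
  also have "(\<Sum>e\<in>dom G. if e \<in> F then \<beta> else 0) = real (card F) * \<beta>"
  proof -
    have "dom G \<inter> {e. e \<in> F} = F" using incident_subset_dom[of G v] by (auto simp: F_def)
    then show ?thesis using wf by (simp add: sum.If_cases wf_graph_def)
  qed
  finally have edges: "edge_pot G ?l \<le> edge_pot G l + real (card F) * \<beta>" .
  have k1: "(1 + 3 * \<epsilon>) * real (card F) \<le> (1 + 3 * \<epsilon>) * X"
    using kX eps_pos by (intro mult_left_mono) auto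
  have cards: "\<epsilon> * real (card {u. u < n \<and> 0 < ?l u}) \<le> \<epsilon> * real (card {u. u < n \<and> 0 < l u})"
    using card_pos_levels_mono[of "l v - 1" l v] eps_pos by (intro mult_left_mono) auto
  have "0 \<le> \<epsilon> * real (card F)" using eps_pos by simp
  then show ?thesis
    unfolding level_pot_def using nodes edges k1 cards by (simp add: beta_eq algebra_simps)
qed

text \<open>Every edge at \<open>v\<close> owes its level to another endpoint strictly above
  \<open>v\<close>, so the level of \<open>v\<close> does not influence it.\<close>

lemma level_drop_zero:
  assumes wf: "wf_graph G" and v: "v < n" and pos: "l v > 0"
    and none: "\<And>e. e \<in> inc G v \<Longrightarrow> edge_level G l e \<noteq> l v"
  shows "level_pot G (l(v := 0)) + \<epsilon> \<le> level_pot G l"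
    and "edge_level G (l(v := 0)) e = edge_level G l e"
proof -
  let ?l = "l(v := 0)"
  have el: "edge_level G ?l e = edge_level G l e" for e
    using edge_level_lower[OF wf, of e v 0 l] none[of e] edge_level_other[of e G v l 0]
    by (cases "e \<in> inc G v") (auto simp: max_def split: if_splits)
  then show "edge_level G ?l e = edge_level G l e" .
  have W: "W G ?l u = W G l u" for u by (simp add: node_weight_def edge_weight_def el)
  have np: "node_pot G ?l u \<le> node_pot G l u" for u
    using node_pot_mono[of ?l u l G G] W[of u] node_pot_nonneg[of G l v]
    by (cases "u = v") (auto simp: node_pot_def[of G ?l v])
  have nodes: "(\<Sum>u<n. node_pot G ?l u) \<le> (\<Sum>u<n. node_pot G l u)" by (intro sum_mono np)
  have "edge_pot G ?l = edge_pot G l" by (simp add: edge_pot_def el)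
  then show "level_pot G ?l + \<epsilon> \<le> level_pot G l"
    using nodes card_pos_levels_zero[of v l, OF v pos, symmetric]
    by (simp add: level_pot_def algebra_simps del: fun_upd_apply)
qed

section \<open>Potential change under insertion and deletion of an edge\<close>

lemma edge_level_cong: "G e = G' e \<Longrightarrow> edge_level G l e = edge_level G' l e"
  by (simp add: edge_level_def endpoints_def incident_edges_def)

lemma incident_insert:
  "inc (G(e := Some S)) u
     = (if u \<in> S then insert e (inc (G(e := None)) u) else inc (G(e := None)) u)"
  by (auto simp: incident_edges_def)

lemma not_incident_delete: "e \<notin> inc (G(e := None)) u"
  by (auto simp: incident_edges_def)

text \<open>Both sides overwrite \<open>e\<close>, so the same equation describes an insertion into
  a graph without \<open>e\<close> and, when \<open>G e = Some S\<close>, a deletion from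
  \<open>G\<close>.\<close>

lemma node_weight_insert:
  assumes "finite (dom G)"
  shows "W (G(e := Some S)) l u
     = W (G(e := None)) l u + (if u \<in> S then edge_weight \<beta> \<mu> (G(e := Some S)) l e else 0)"
proof -
  have fin: "finite (inc (G(e := None)) u)"
    by (rule finite_subset[OF incident_subset_dom]) (use assms in simp)
  have "edge_weight \<beta> \<mu> (G(e := Some S)) l e' = edge_weight \<beta> \<mu> (G(e := None)) l e'"
    if "e' \<in> inc (G(e := None)) u" for e'
    using that edge_level_cong[of "G(e := Some S)" e' "G(e := None)"]
    by (auto simp: edge_weight_def incident_edges_def split: if_splits)
  then show ?thesis
    using fin by (simp add: node_weight_def incident_insert not_incident_delete cong: sum.cong)
qed

lemma edge_pot_insert:
  assumes "finite (dom G)"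
  shows "edge_pot (G(e := Some S)) l
     = edge_pot (G(e := None)) l + \<beta> * (real L - real (edge_level (G(e := Some S)) l e))"
proof -
  have "dom (G(e := Some S)) = insert e (dom (G(e := None)))" by auto
  moreover have "(\<Sum>e'\<in>dom (G(e := None)). \<beta> * (real L - real (edge_level (G(e := Some S)) l e')))
      = edge_pot (G(e := None)) l"
    unfolding edge_pot_def
    by (intro sum.cong refl) (auto simp: edge_level_cong[of "G(e := Some S)" _ "G(e := None)"] split: if_splits)
  moreover have "finite (dom (G(e := None)))" "e \<notin> dom (G(e := None))" using assms by auto
  ultimately show ?thesis by (simp add: edge_pot_def[of "G(e := Some S)"] del: fun_upd_apply dom_fun_upd)
qed

text \<open>Weights only grow, so no node potential rises; the new edge adds at most
  \<open>\<beta> * L \<le> 2 * L\<close> to the edge potential, which counts twice.\<close>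

lemma level_pot_insert:
  assumes wf: "wf_graph (G(e := Some S))"
  shows "level_pot (G(e := Some S)) l \<le> level_pot (G(e := None)) l + 4 * real L"
proof -
  have fin: "finite (dom G)" using wf by (simp add: wf_graph_def)
  have "node_pot (G(e := Some S)) l u \<le> node_pot (G(e := None)) l u" for u
    using edge_weight_pos[of "G(e := Some S)" l e]
    by (intro node_pot_mono) (auto simp: node_weight_insert[OF fin])
  then have "(\<Sum>u<n. node_pot (G(e := Some S)) l u) \<le> (\<Sum>u<n. node_pot (G(e := None)) l u)"
    by (intro sum_mono)
  moreover have "\<beta> * (real L - real (edge_level (G(e := Some S)) l e)) \<le> 2 * real L"
  proof -
    have "\<beta> * (real L - real (edge_level (G(e := Some S)) l e)) \<le> \<beta> * real L"
      using beta_pos by (intro mult_left_mono) auto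
    also have "\<dots> \<le> 2 * real L" using beta_eq eps_less_1 by (intro mult_right_mono) auto
    finally show ?thesis .
  qed
  ultimately show ?thesis by (simp add: level_pot_def edge_pot_insert[OF fin])
qed

text \<open>Each of the at most \<open>f\<close> endpoints \<open>u\<close> loses the weight of an
  edge whose level is at least \<open>l u\<close>, which costs at most
  \<open>\<beta> / (f * \<epsilon>)\<close>. Together this is at most \<open>2 / \<epsilon>\<close>,
  and it counts twice.\<close>

lemma level_pot_delete:
  assumes wf: "wf_graph G" and e: "G e = Some S" and lev: "\<And>v. v < n \<Longrightarrow> l v \<le> L"
  shows "level_pot (G(e := None)) l \<le> level_pot G l + 4 / \<epsilon>"
proof -
  have fin: "finite (dom G)" using wf by (simp add: wf_graph_def)
  have G: "G(e := Some S) = G" using e by auto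
  have np: "node_pot (G(e := None)) l u \<le> node_pot G l u + (if u \<in> S then \<beta> / (real f * \<epsilon>) else 0)" for u
  proof -
    let ?w = "edge_weight \<beta> \<mu> G l e"
    have d: "W G l u - W (G(e := None)) l u = (if u \<in> S then ?w else 0)"
      using node_weight_insert[OF fin, of e S l u] unfolding G by simp
    have 1: "node_pot (G(e := None)) l u \<le> node_pot G l u
        + \<beta> ^ Suc (l u) / (real f * \<mu> * \<epsilon>) * max 0 (if u \<in> S then ?w else 0)"
      using node_pot_diff_le[of l u l "G(e := None)" G] by (simp only: d)
    show ?thesis
    proof (cases "u \<in> S")
      case True
      have "l u \<le> edge_level G l e"
        using level_le_edge_level[OF wf, of e u] True e by (simp add: incident_edges_def)
      then have "\<beta> ^ l u / \<beta> ^ edge_level G l e \<le> 1" using beta_gt_1 by (simp add: power_increasing)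
      then have "\<beta> / (real f * \<epsilon>) * (\<beta> ^ l u / \<beta> ^ edge_level G l e) \<le> \<beta> / (real f * \<epsilon>)"
        using beta_pos fr_pos eps_pos by (intro mult_left_le) auto
      moreover have "\<beta> ^ Suc (l u) / (real f * \<mu> * \<epsilon>) * ?w
          = \<beta> / (real f * \<epsilon>) * (\<beta> ^ l u / \<beta> ^ edge_level G l e)"
        using mu_pos fr_pos eps_pos beta_pos by (simp add: edge_weight_def field_simps)
      ultimately show ?thesis using 1 True edge_weight_pos[of G l e] by (simp add: max_def)
    qed (use 1 in simp)
  qed
  have "(\<Sum>u<n. node_pot (G(e := None)) l u) \<le> (\<Sum>u<n. node_pot G l u + (if u \<in> S then \<beta> / (real f * \<epsilon>) else 0))"
    by (intro sum_mono np)
  also have "\<dots> = (\<Sum>u<n. node_pot G l u) + real (card ({..<n} \<inter> S)) * (\<beta> / (real f * \<epsilon>))"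
    by (simp add: sum.distrib sum.If_cases Int_def)
  also have "{..<n} \<inter> S = S" using wf_edgeD(3)[OF wf e] by auto
  also have "real (card S) * (\<beta> / (real f * \<epsilon>)) \<le> real f * (\<beta> / (real f * \<epsilon>))"
    using wf_edgeD(4)[OF wf e] beta_pos eps_pos by (intro mult_right_mono) auto
  also have "real f * (\<beta> / (real f * \<epsilon>)) \<le> 2 / \<epsilon>"
    using fr_pos eps_pos eps_less_1 by (simp add: beta_eq field_simps)
  finally have nodes: "(\<Sum>u<n. node_pot (G(e := None)) l u) \<le> (\<Sum>u<n. node_pot G l u) + 2 / \<epsilon>"
    by (simp del: fun_upd_apply)
  have "edge_level G l e \<le> L" using e by (intro edge_level_le[OF wf _ lev]) auto
  then have "0 \<le> \<beta> * (real L - real (edge_level G l e))" using beta_pos by (intro mult_nonneg_nonneg) auto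
  then have "edge_pot (G(e := None)) l \<le> edge_pot G l"
    using edge_pot_insert[OF fin, of e S l] unfolding G by simp
  then show ?thesis using nodes by (simp add: level_pot_def)
qed

end

section \<open>Timed execution and memory layout\<close>

text \<open>Total correctness with time, in continuation form. By determinism the execution is
  unique, so the rules for straight-line code and conditionals are equivalences and the simplifier
  can execute such code symbolically.\<close>

definition run :: "com \<Rightarrow> store \<Rightarrow> (nat \<Rightarrow> store \<Rightarrow> bool) \<Rightarrow> bool" where
  "run p s Q \<longleftrightarrow> (\<exists>t s'. exec p s t s' \<and> Q t s')"

lemma run_mono: "run p s Q \<Longrightarrow> (\<And>t s'. Q t s' \<Longrightarrow> Q' t s') \<Longrightarrow> run p s Q'"
  by (auto simp: run_def)

lemma run_Skip: "run Skip s Q \<longleftrightarrow> Q 1 s"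
  unfolding run_def by (metis exec.Skip exec_SkipE)

lemma run_ISet: "run (ISet b a x) s Q \<longleftrightarrow> Q (1 + icost a + icost x) (write_i b (ival a s) (ival x s) s)"
  unfolding run_def by (metis exec.ISet exec_determ)

lemma run_RSet: "run (RSet b a x) s Q \<longleftrightarrow> Q (1 + icost a + rcost x) (write_r b (ival a s) (rval x s) s)"
  unfolding run_def by (metis exec.RSet exec_determ)

lemma run_Seq: "run (Seq p q) s Q \<longleftrightarrow> run p s (\<lambda>t s'. run q s' (\<lambda>t' s''. Q (t + t') s''))"
  unfolding run_def by (metis exec.Seq exec_SeqE)

lemma run_Cond:
  "run (Cond x p q) s Q \<longleftrightarrow>
     (if bval x s then run p s (\<lambda>t. Q (1 + bcost x + t)) else run q s (\<lambda>t. Q (1 + bcost x + t)))"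
proof (cases "bval x s")
  case True
  then show ?thesis
    unfolding run_def by (auto elim!: exec_CondE intro: exec.CondTrue) (metis exec.CondTrue plus_1_eq_Suc add_Suc)
next
  case False
  then show ?thesis
    unfolding run_def by (auto elim!: exec_CondE intro: exec.CondFalse) (metis exec.CondFalse plus_1_eq_Suc add_Suc)
qed

lemmas run_simps = run_Skip run_ISet run_RSet run_Seq run_Cond

lemma ibank_write_i [simp]: "ibank (write_i b a x s) = (ibank s)(b := (ibank s b)(a := x))"
  and rbank_write_i [simp]: "rbank (write_i b a x s) = rbank s"
  and ibank_write_r [simp]: "ibank (write_r b a y s) = ibank s"
  and rbank_write_r [simp]: "rbank (write_r b a y s) = (rbank s)(b := (rbank s b)(a := y))"
  by (simp_all add: write_i_def write_r_def)

text \<open>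
  The potential \<open>V\<close> bounds the remaining running time; as every iteration takes at least one
  step, it is also the termination measure.
\<close>

lemma run_While:
  fixes V :: "store \<Rightarrow> real"
  assumes "I s" and nonneg: "\<And>s. I s \<Longrightarrow> 0 \<le> V s"
    and step: "\<And>s. I s \<Longrightarrow> bval x s \<Longrightarrow> run p s (\<lambda>t s'. I s' \<and> V s' + real (t + 1 + bcost x) \<le> V s)"
  shows "run (While x p) s (\<lambda>t s'. I s' \<and> \<not> bval x s' \<and> real t + V s' \<le> V s + real (1 + bcost x))"
  using \<open>I s\<close>
proof (induction "nat \<lfloor>V s\<rfloor>" arbitrary: s rule: less_induct)
  case less
  show ?case
  proof (cases "bval x s")
    case True
    obtain t s' where *: "exec p s t s'" "I s'" "V s' + real (t + 1 + bcost x) \<le> V s"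
      using step[OF less.prems True] by (auto simp: run_def)
    have "nat \<lfloor>V s'\<rfloor> < nat \<lfloor>V s\<rfloor>" using *(3) nonneg[OF *(2)] by linarith
    from less.hyps[OF this *(2)] obtain t' s'' where
      **: "exec (While x p) s' t' s''" "I s''" "\<not> bval x s''" "real t' + V s'' \<le> V s' + real (1 + bcost x)"
      by (auto simp: run_def)
    from exec.WhileTrue[OF True *(1) **(1)] **(2-4) *(3) show ?thesis
      unfolding run_def by (intro exI[of _ "1 + bcost x + t + t'"] exI[of _ s'']) simp
  next
    case False
    from exec.WhileFalse[OF False] less.prems False show ?thesis
      unfolding run_def by (intro exI[of _ "1 + bcost x"] exI[of _ s]) simp
  qed
qed

lemma run_While_nat:
  fixes V :: "store \<Rightarrow> nat"
  assumes "I s"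
    and step: "\<And>s. I s \<Longrightarrow> bval x s \<Longrightarrow> run p s (\<lambda>t s'. I s' \<and> V s' + (t + 1 + bcost x) \<le> V s)"
  shows "run (While x p) s (\<lambda>t s'. I s' \<and> \<not> bval x s' \<and> t + V s' \<le> V s + (1 + bcost x))"
proof -
  have "run (While x p) s (\<lambda>t s'. I s' \<and> \<not> bval x s' \<and> real t + real (V s') \<le> real (V s) + real (1 + bcost x))"
  proof (rule run_While)
    fix s assume "I s" "bval x s"
    from step[OF this] show "run p s (\<lambda>t s'. I s' \<and> real (V s') + real (t + 1 + bcost x) \<le> real (V s))"
      by (rule run_mono) (simp add: of_nat_add[symmetric] del: of_nat_add of_nat_Suc)
  qed (use assms in auto)
  then show ?thesis
    by (rule run_mono) (simp add: of_nat_add[symmetric] del: of_nat_add of_nat_Suc)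
qed

definition frame :: "nat set \<Rightarrow> nat set \<Rightarrow> store \<Rightarrow> store \<Rightarrow> bool" where
  "frame A B s s' \<longleftrightarrow> (\<forall>b. b \<notin> A \<longrightarrow> ibank s' b = ibank s b) \<and> (\<forall>b. b \<notin> B \<longrightarrow> rbank s' b = rbank s b)"

abbreviation "link_frame \<equiv> frame {3, 4, 5, 6, 7, 10, 11, 16} {2}"
abbreviation "refresh_frame \<equiv> frame {3, 4, 5, 6, 7, 8, 9, 10, 11, 13, 16} {2, 4, 5}"

lemma frame_ibank: "frame A B s s' \<Longrightarrow> b \<notin> A \<Longrightarrow> ibank s' b = ibank s b"
  and frame_rbank: "frame A B s s' \<Longrightarrow> b \<notin> B \<Longrightarrow> rbank s' b = rbank s b"
  by (auto simp: frame_def)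

lemma frame_trans: "frame A B s s' \<Longrightarrow> frame A B s' s'' \<Longrightarrow> frame A B s s''"
  by (auto simp: frame_def)

lemma frame_weaken: "frame A B s s' \<Longrightarrow> A \<subseteq> A' \<Longrightarrow> B \<subseteq> B' \<Longrightarrow> frame A' B' s s'"
  by (auto simp: frame_def)

lemma frame_refl: "frame A B s s"
  by (auto simp: frame_def)

text \<open>
  The memory layout.  A record stands for an incidence between an edge and a node.  Records are
  allocated at increasing addresses and never freed.  Each edge \<open>e\<close> owns the block of records
  from \<open>est s e\<close> to \<open>eend s e\<close>, one for every endpoint.  The bucket of node \<open>v\<close> and level \<open>l\<close> is
  a linked list of records starting at \<open>head s (v + n * l)\<close>.  An edge is moved between buckets by
  giving it a new block; its old records remain in their buckets and are recognized as outdated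
  because they lie below \<open>est s e\<close>.
\<close>

abbreviation lev :: "store \<Rightarrow> nat \<Rightarrow> nat" where "lev s \<equiv> ibank s 2"
abbreviation alloc :: "store \<Rightarrow> nat" where "alloc s \<equiv> ibank s 3 0"
abbreviation sp :: "store \<Rightarrow> nat" where "sp s \<equiv> ibank s 3 (Suc 0)"
abbreviation node :: "store \<Rightarrow> nat \<Rightarrow> nat" where "node s \<equiv> ibank s 4"
abbreviation edg :: "store \<Rightarrow> nat \<Rightarrow> nat" where "edg s \<equiv> ibank s 5"
abbreviation nxt :: "store \<Rightarrow> nat \<Rightarrow> nat" where "nxt s \<equiv> ibank s 6"
abbreviation head :: "store \<Rightarrow> nat \<Rightarrow> nat" where "head s \<equiv> ibank s 7"
abbreviation est :: "store \<Rightarrow> nat \<Rightarrow> nat" where "est s \<equiv> ibank s 8"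
abbreviation eend :: "store \<Rightarrow> nat \<Rightarrow> nat" where "eend s \<equiv> ibank s 9"
abbreviation lo :: "store \<Rightarrow> nat \<Rightarrow> nat" where "lo s \<equiv> ibank s 10"
abbreviation stk :: "store \<Rightarrow> nat \<Rightarrow> nat" where "stk s \<equiv> ibank s 11"
abbreviation off :: "store \<Rightarrow> nat \<Rightarrow> nat" where "off s \<equiv> ibank s 12"
abbreviation elv :: "store \<Rightarrow> nat \<Rightarrow> nat" where "elv s \<equiv> ibank s 13"
abbreviation vr :: "store \<Rightarrow> nat" where "vr s \<equiv> ibank s 14 0"
abbreviation jr :: "store \<Rightarrow> nat" where "jr s \<equiv> ibank s 14 (Suc 0)"
abbreviation newr :: "store \<Rightarrow> nat" where "newr s \<equiv> ibank s 14 2"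
abbreviation hr :: "store \<Rightarrow> nat" where "hr s \<equiv> ibank s 14 3"
abbreviation er :: "store \<Rightarrow> nat" where "er s \<equiv> ibank s 15 0"
abbreviation qr :: "store \<Rightarrow> nat" where "qr s \<equiv> ibank s 16 0"
abbreviation mxr :: "store \<Rightarrow> nat" where "mxr s \<equiv> ibank s 16 (Suc 0)"
abbreviation wgt :: "store \<Rightarrow> nat \<Rightarrow> real" where "wgt s \<equiv> rbank s 2"
abbreviation tab :: "store \<Rightarrow> nat \<Rightarrow> real" where "tab s \<equiv> rbank s 3"
abbreviation ew :: "store \<Rightarrow> nat \<Rightarrow> real" where "ew s \<equiv> rbank s 4"
abbreviation dw :: "store \<Rightarrow> real" where "dw s \<equiv> rbank s 5 0"

abbreviation seq (infixr ";;" 60) where "p ;; q \<equiv> Seq p q"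

abbreviation "xAL \<equiv> ICell 3 (INum 0)"
abbreviation "xSP \<equiv> ICell 3 (INum (Suc 0))"
abbreviation "xV \<equiv> ICell 14 (INum 0)"
abbreviation "xJ \<equiv> ICell 14 (INum (Suc 0))"
abbreviation "xNEW \<equiv> ICell 14 (INum 2)"
abbreviation "xH \<equiv> ICell 14 (INum 3)"
abbreviation "xE \<equiv> ICell 15 (INum 0)"
abbreviation "xQ \<equiv> ICell 16 (INum 0)"
abbreviation "xMX \<equiv> ICell 16 (INum (Suc 0))"
abbreviation "xU \<equiv> ICell 16 (INum 2)"
abbreviation "xBKT \<equiv> IAdd xV (ICell 12 xJ)"

section \<open>Giving an edge a new block of records\<close>

definition max_loop :: com where
  "max_loop = While (ILess xQ (ICell 9 xE))
     (Cond (ILess xMX (ICell 2 (ICell 4 xQ))) (ISet 16 (INum (Suc 0)) (ICell 2 (ICell 4 xQ))) Skip ;;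
      ISet 16 (INum 0) (IAdd xQ (INum 1)))"

definition link_body :: com where
  "link_body =
     (ISet 16 (INum 2) (ICell 4 xQ) ;;
      ISet 3 (INum 0) (IAdd xAL (INum 1)) ;;
      ISet 4 xAL xU ;;
      ISet 5 xAL xE ;;
      ISet 6 xAL (ICell 7 (IAdd xU (ICell 12 xMX))) ;;
      ISet 7 (IAdd xU (ICell 12 xMX)) xAL ;;
      RSet 2 xU (RAdd (RCell 2 xU) (RCell 5 (INum 0))) ;;
      Cond (ILess xMX (ICell 10 xU)) (ISet 10 xU xMX) Skip ;;
      ISet 3 (INum (Suc 0)) (IAdd xSP (INum 1)) ;;
      ISet 11 xSP xU ;;
      ISet 16 (INum 0) (IAdd xQ (INum 1)))"

definition link_loop :: com where
  "link_loop = While (ILess xQ (ICell 9 xE)) link_body"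

text \<open>Cell 0 of the real bank 5 holds the change of the edge weight, which is added to every
  endpoint when its new record is linked. The old block supplies the endpoints of the new one, so
  its start is saved before \<open>est\<close> is changed and its end is overwritten last.\<close>

definition refresh :: com where
  "refresh =
     (ISet 16 (INum 0) (ICell 8 xE) ;;
      ISet 16 (INum (Suc 0)) (INum 0) ;;
      max_loop ;;
      RSet 5 (INum 0) (RSub (RCell 3 xMX) (RCell 4 xE)) ;;
      RSet 4 xE (RCell 3 xMX) ;;
      ISet 13 xE xMX ;;
      ISet 16 (INum 0) (ICell 8 xE) ;;
      ISet 8 xE (IAdd xAL (INum 1)) ;;
      link_loop ;;
      ISet 9 xE (IAdd xAL (INum 1)))"

text \<open>The records reached from \<open>r\<close>, with 0 as end mark. The \<open>min\<close>
  makes every step go down, so the recursion terminates for arbitrary \<open>nx\<close>; where the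
  links do decrease it has no effect, see \<open>chain_pos\<close>.\<close>

fun chain :: "(nat \<Rightarrow> nat) \<Rightarrow> nat \<Rightarrow> nat list" where
  "chain nx 0 = []"
| "chain nx (Suc r) = Suc r # chain nx (min (nx (Suc r)) r)"

lemma chain_pos: "0 < r \<Longrightarrow> nx r < r \<Longrightarrow> chain nx r = r # chain nx (nx r)"
  by (cases r) (auto simp: min_def less_Suc_eq_le)

lemma set_chain_bounds: "x \<in> set (chain nx r) \<Longrightarrow> 0 < x \<and> x \<le> r"
  by (induction nx r rule: chain.induct) force+

lemma chain_cong: "(\<And>x. x \<le> r \<Longrightarrow> nx x = nx' x) \<Longrightarrow> chain nx r = chain nx' r"
proof (induction nx r rule: chain.induct)
  case (2 nx r)
  then show ?case by (auto intro!: 2)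
qed simp

text \<open>Node and level are remainder and quotient of the bucket address modulo \<open>n\<close>;
  hence different buckets never share a head cell.\<close>

lemma mult_add_unique:
  fixes v v' l l' n :: nat
  assumes "v < n" "v' < n" "v + n * l = v' + n * l'"
  shows "v = v' \<and> l = l'"
proof -
  have "(v + n * l) mod n = (v' + n * l') mod n" "(v + n * l) div n = (v' + n * l') div n"
    using assms(3) by simp_all
  then show ?thesis using assms(1,2) by simp
qed

text \<open>The register \<open>mxr\<close> starts at 0, and \<open>insert 0\<close> mirrors this;
  it keeps \<open>Max\<close> defined before the first endpoint has been read.\<close>

lemma run_max_loop:
  assumes "mxr s = 0" "qr s \<le> eend s (er s)"
  shows "run max_loop s (\<lambda>t s'. frame {16} {} s s' \<and>
     mxr s' = Max (insert 0 (lev s ` node s ` {qr s..<eend s (er s)})) \<and>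
     t \<le> 40 * (eend s (er s) - qr s) + 40)"
proof -
  define a where "a = qr s"
  define b where "b = eend s (er s)"
  define I where "I s' \<longleftrightarrow> frame {16} {} s s' \<and> a \<le> qr s' \<and> qr s' \<le> b \<and>
      mxr s' = Max (insert 0 (lev s ` node s ` {a..<qr s'}))" for s'
  define V where "V s' = 40 * (b - qr s')" for s' :: store
  have I0: "I s" using assms by (simp add: I_def a_def b_def frame_refl)
  have "run max_loop s (\<lambda>t s'. I s' \<and> \<not> bval (ILess xQ (ICell 9 xE)) s' \<and>
      t + V s' \<le> V s + (1 + bcost (ILess xQ (ICell 9 xE))))"
    unfolding max_loop_def
  proof (rule run_While_nat, rule I0)
    fix s1 assume I: "I s1" and lt: "bval (ILess xQ (ICell 9 xE)) s1"
    have fr: "frame {16} {} s s1" and q: "a \<le> qr s1" "qr s1 \<le> b"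
      and mx: "mxr s1 = Max (insert 0 (lev s ` node s ` {a..<qr s1}))" using I by (auto simp: I_def)
    have lt': "qr s1 < b" using lt by (simp add: b_def frame_ibank[OF fr])
    have set: "{a..<Suc (qr s1)} = insert (qr s1) {a..<qr s1}" using q by auto
    have fr': "frame {16} {} s s2" if "frame {16} {} s1 s2" for s2 using frame_trans[OF fr that] .
    have M: "Max (insert 0 (lev s ` node s ` {a..<Suc (qr s1)})) = max (lev s (node s (qr s1))) (mxr s1)"
      unfolding set mx by (simp add: insert_commute[of 0])
    show "run (Cond (ILess xMX (ICell 2 (ICell 4 xQ))) (ISet 16 (INum (Suc 0)) (ICell 2 (ICell 4 xQ))) Skip ;;
      ISet 16 (INum 0) (IAdd xQ (INum 1))) s1
      (\<lambda>t s'. I s' \<and> V s' + (t + 1 + bcost (ILess xQ (ICell 9 xE))) \<le> V s1)"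
      using lt' q
      by (auto simp: run_simps I_def V_def M frame_ibank[OF fr] intro!: fr') (auto simp: frame_def)
  qed
  then show ?thesis
    by (rule run_mono) (auto simp: I_def V_def a_def b_def frame_ibank)
qed

section \<open>Buckets of edge records\<close>

lemma bij_betw_shift:
  fixes g :: "nat \<Rightarrow> 'a"
  assumes "bij_betw u {..<k} S" "\<And>i. i < k \<Longrightarrow> g (Suc (A + i)) = u i"
  shows "bij_betw g {Suc A..<Suc (A + k)} S"
proof -
  have "bij_betw (\<lambda>i. i - Suc A) {Suc A..<Suc (A + k)} {..<k}"
    by (rule bij_betw_byWitness[where f' = "\<lambda>i. Suc (A + i)"]) auto
  moreover have "(u \<circ> (\<lambda>i. i - Suc A)) a = g a" if "a \<in> {Suc A..<Suc (A + k)}" for a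
    using assms(2)[of "a - Suc A"] that by auto
  ultimately show ?thesis using bij_betw_trans[OF _ assms(1)] bij_betw_cong by metis
qed

text \<open>The state of the linking loop after \<open>k\<close> endpoints: \<open>u\<close>
  enumerates the endpoints and \<open>A\<close> is the allocation counter at the start. The links of
  the new records can be given by the heads of the initial store because different endpoints push
  onto different buckets.\<close>

definition linked_to :: "nat \<Rightarrow> nat \<Rightarrow> nat \<Rightarrow> nat \<Rightarrow> (nat \<Rightarrow> nat) \<Rightarrow> nat \<Rightarrow> store \<Rightarrow> store \<Rightarrow> bool" where
  "linked_to n e mx k u A s s' \<longleftrightarrow>
     link_frame s s' \<and>
     alloc s' = A + k \<and> sp s' = sp s + k \<and>
     (\<forall>r\<le>A. node s' r = node s r \<and> edg s' r = edg s r \<and> nxt s' r = nxt s r) \<and>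
     (\<forall>i<k. node s' (Suc (A + i)) = u i \<and> edg s' (Suc (A + i)) = e \<and>
        nxt s' (Suc (A + i)) = head s (u i + n * mx) \<and> head s' (u i + n * mx) = Suc (A + i)) \<and>
     (\<forall>a. (\<forall>i<k. a \<noteq> u i + n * mx) \<longrightarrow> head s' a = head s a) \<and>
     (\<forall>r>A + k. nxt s' r = nxt s r) \<and>
     (\<forall>v. wgt s' v = wgt s v + (if v \<in> u ` {..<k} then dw s else 0)) \<and>
     (\<forall>v. lo s' v = (if v \<in> u ` {..<k} then min (lo s v) mx else lo s v)) \<and>
     (\<forall>i\<le>sp s. stk s' i = stk s i) \<and> (\<forall>i<k. stk s' (Suc (sp s + i)) = u i)"

lemma linked_to_frame: "linked_to n e mx k u A s s' \<Longrightarrow> link_frame s s'"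
  and linked_to_counters: "linked_to n e mx k u A s s' \<Longrightarrow> alloc s' = A + k \<and> sp s' = sp s + k"
  and linked_to_head: "linked_to n e mx k u A s s' \<Longrightarrow> \<forall>i<k. a \<noteq> u i + n * mx \<Longrightarrow> head s' a = head s a"
  by (simp_all only: linked_to_def)

lemma linked_to_step:
  assumes L: "linked_to n e mx k u A s s1" and q: "qr s1 = a + k" and ak: "a + k \<le> A"
    and u: "node s (a + k) = u k" and new: "\<And>i. i < k \<Longrightarrow> u i \<noteq> u k"
    and e: "er s1 = e" and mx: "mxr s1 = mx" and off: "off s1 mx = n * mx"
  shows "run link_body s1 (\<lambda>t s'. linked_to n e mx (Suc k) u A s s' \<and> qr s' = a + Suc k \<and> mxr s' = mx \<and> t \<le> 150)"
proof -
  note L' = L[unfolded linked_to_def]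
  have fr: "link_frame s s1" by (rule linked_to_frame[OF L])
  have al: "alloc s1 = A + k" and sp: "sp s1 = sp s + k" using linked_to_counters[OF L] by simp_all
  have nu: "node s1 (a + k) = u k" using L' ak u by simp
  have hk: "head s1 (u k + n * mx) = head s (u k + n * mx)"
    using linked_to_head[OF L, of "u k + n * mx"] new by fastforce
  have uk: "u k \<notin> u ` {..<k}" using new by fastforce
  have wk: "wgt s1 (u k) = wgt s (u k)" and lk: "lo s1 (u k) = lo s (u k)" using L' uk by simp_all
  have dw: "dw s1 = dw s" using frame_rbank[OF fr] by simp
  have frt: "link_frame s s2" if "link_frame s1 s2" for s2
    using frame_trans[OF fr that] .
  have img: "u ` {..<Suc k} = insert (u k) (u ` {..<k})" by (auto simp: less_Suc_eq)
  have nk: "\<And>i. i < k \<Longrightarrow> u i + n * mx \<noteq> u k + n * mx" using new by simp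
  note S = al sp q nu e mx off hk wk lk dw
  define s2 where "s2 = write_i 16 0 (Suc (a + k)) (write_i 11 (Suc (sp s + k)) (u k)
     (write_i 3 (Suc 0) (Suc (sp s + k))
     ((if mx < lo s (u k) then write_i 10 (u k) mx else id)
     (write_r 2 (u k) (wgt s (u k) + dw s) (write_i 7 (u k + n * mx) (Suc (A + k))
     (write_i 6 (Suc (A + k)) (head s (u k + n * mx)) (write_i 5 (Suc (A + k)) e
     (write_i 4 (Suc (A + k)) (u k) (write_i 3 0 (Suc (A + k)) (write_i 16 2 (u k) s1))))))))))"
  have run: "run link_body s1 (\<lambda>t s'. s' = s2 \<and> t \<le> 150)"
    unfolding link_body_def s2_def by (simp add: run_simps S)
  have fr2: "link_frame s1 s2"
    by (auto simp: s2_def frame_def)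
  have b3: "ibank s2 3 = (ibank s1 3)(0 := Suc (A + k), Suc 0 := Suc (sp s + k))" by (auto simp: s2_def)
  have b4: "node s2 = (node s1)(Suc (A + k) := u k)" by (simp add: s2_def)
  have b5: "edg s2 = (edg s1)(Suc (A + k) := e)" by (simp add: s2_def)
  have b6: "nxt s2 = (nxt s1)(Suc (A + k) := head s (u k + n * mx))" by (simp add: s2_def)
  have b7: "head s2 = (head s1)(u k + n * mx := Suc (A + k))" by (simp add: s2_def)
  have b10: "lo s2 = (lo s1)(u k := min (lo s (u k)) mx)" by (auto simp: s2_def lk min_def fun_eq_iff)
  have b11: "stk s2 = (stk s1)(Suc (sp s + k) := u k)" by (simp add: s2_def)
  have b16: "qr s2 = a + Suc k" "mxr s2 = mx" by (auto simp: s2_def mx)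
  have w2: "wgt s2 = (wgt s1)(u k := wgt s (u k) + dw s)" by (simp add: s2_def)
  have "linked_to n e mx (Suc k) u A s s2"
    unfolding linked_to_def
  proof (intro conjI allI impI)
    show "link_frame s s2" by (rule frt[OF fr2])
    show "alloc s2 = A + Suc k" "sp s2 = sp s + Suc k" by (simp_all add: b3)
    show "node s2 r = node s r" "edg s2 r = edg s r" "nxt s2 r = nxt s r" if "r \<le> A" for r
      using L' that by (simp_all add: b4 b5 b6)
    show "node s2 (Suc (A + i)) = u i" "edg s2 (Suc (A + i)) = e"
      "nxt s2 (Suc (A + i)) = head s (u i + n * mx)" if "i < Suc k" for i
      using L' that by (auto simp: b4 b5 b6 less_Suc_eq)
    show "head s2 (u i + n * mx) = Suc (A + i)" if "i < Suc k" for i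
      using L' that new by (auto simp: b7 less_Suc_eq)
    show "head s2 a = head s a" if "\<forall>i<Suc k. a \<noteq> u i + n * mx" for a
      using L' that by (simp add: b7)
    show "nxt s2 r = nxt s r" if "A + Suc k < r" for r
      using L' that by (simp add: b6)
    show "wgt s2 v = wgt s v + (if v \<in> u ` {..<Suc k} then dw s else 0)" for v
      using L' uk by (auto simp: w2 img)
    show "lo s2 v = (if v \<in> u ` {..<Suc k} then min (lo s v) mx else lo s v)" for v
      using L' uk by (auto simp: b10 img)
    show "stk s2 i = stk s i" if "i \<le> sp s" for i using L' that by (simp add: b11)
    show "stk s2 (Suc (sp s + i)) = u i" if "i < Suc k" for i
      using L' that by (auto simp: b11 less_Suc_eq)
  qed
  then show ?thesis using b16 by (intro run_mono[OF run]) blast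
qed

lemma run_link_loop:
  assumes q: "qr s = a" "a \<le> eend s (er s)" "eend s (er s) \<le> Suc (alloc s)"
    and k: "eend s (er s) - a = k" and inj: "inj_on (node s) {a..<a + k}"
    and off: "off s (mxr s) = n * mxr s"
  shows "run link_loop s (\<lambda>t s'. linked_to n (er s) (mxr s) k (\<lambda>i. node s (a + i)) (alloc s) s s' \<and>
     mxr s' = mxr s \<and> t \<le> 200 * k + 50)"
proof -
  let ?u = "\<lambda>i. node s (a + i)" and ?e = "er s" and ?mx = "mxr s" and ?A = "alloc s"
  define I where "I s' \<longleftrightarrow> (\<exists>i\<le>k. linked_to n ?e ?mx i ?u ?A s s' \<and> qr s' = a + i \<and> mxr s' = ?mx)" for s'
  define V where "V s' = 200 * (a + k - qr s')" for s' :: store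
  have endq: "eend s ?e = a + k" using q k by simp
  have I0: "I s" unfolding I_def by (intro exI[of _ 0]) (auto simp: linked_to_def frame_refl q)
  have "run link_loop s (\<lambda>t s'. I s' \<and> \<not> bval (ILess xQ (ICell 9 xE)) s' \<and>
      t + V s' \<le> V s + (1 + bcost (ILess xQ (ICell 9 xE))))"
    unfolding link_loop_def
  proof (rule run_While_nat, rule I0)
    fix s1 assume "I s1" and lt: "bval (ILess xQ (ICell 9 xE)) s1"
    then obtain i where i: "i \<le> k" "linked_to n ?e ?mx i ?u ?A s s1" "qr s1 = a + i" "mxr s1 = ?mx"
      by (auto simp: I_def)
    have fr: "link_frame s s1" using i(2) by (simp add: linked_to_def)
    have eqs: "er s1 = ?e" "eend s1 = eend s" "off s1 = off s" using frame_ibank[OF fr] by simp_all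
    have ik: "i < k" using lt eqs endq i(3) by simp
    have "?u j \<noteq> ?u i" if "j < i" for j
      using inj ik that by (auto dest!: inj_onD)
    then have "run link_body s1 (\<lambda>t s'. linked_to n ?e ?mx (Suc i) ?u ?A s s' \<and> qr s' = a + Suc i \<and>
        mxr s' = ?mx \<and> t \<le> 150)"
      using ik q endq i eqs off by (intro linked_to_step) auto
    then show "run link_body s1 (\<lambda>t s'. I s' \<and> V s' + (t + 1 + bcost (ILess xQ (ICell 9 xE))) \<le> V s1)"
      by (rule run_mono) (use ik i in \<open>auto simp: I_def V_def intro!: exI[of _ "Suc i"]\<close>)
  qed
  then show ?thesis
  proof (rule run_mono, goal_cases)
    case *: (1 t s')
    then obtain i where i: "i \<le> k" "linked_to n ?e ?mx i ?u ?A s s'" "qr s' = a + i" "mxr s' = ?mx"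
      by (auto simp: I_def)
    have fr: "link_frame s s'" using i(2) by (simp add: linked_to_def)
    have "er s' = ?e" "eend s' = eend s" using frame_ibank[OF fr] by simp_all
    then have "i = k" using * endq i by auto
    then show ?case
      using * i q by (auto simp: V_def)
  qed
qed

section \<open>The invariant of the data structure\<close>

context instance_params begin

text \<open>The tables are correct only up to \<open>M\<close>, since the program does not know
  \<open>L\<close>; an entry for the next level costs one addition and one division.\<close>

definition tables :: "nat \<Rightarrow> store \<Rightarrow> bool" where
  "tables M s \<longleftrightarrow> ibank s 0 0 = n \<and> ibank s 0 2 = f \<and> rbank s 0 0 = \<epsilon> \<and> rbank s 0 (Suc 0) = \<mu> \<and>
     (\<forall>v<n. rbank s 1 v = c v) \<and> (\<forall>l\<le>M. off s l = n * l \<and> tab s l = \<mu> / \<beta> ^ l)"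

definition stack_set :: "store \<Rightarrow> nat set" where
  "stack_set s = stk s ` {0<..sp s}"

text \<open>Outdated records are counted as well: the number measures the work still to be done in
  discarding them. The addresses below \<open>n * Suc L\<close> are those of the buckets of levels
  up to \<open>L\<close>.\<close>

definition records :: "store \<Rightarrow> nat" where
  "records s = (\<Sum>a<n * Suc L. length (chain (nxt s) (head s a)))"

text \<open>
  \<open>H\<close> is the set of records that have been detached from the bucket under traversal.
\<close>

definition linked :: "nat set \<Rightarrow> nat \<Rightarrow> hypergraph \<Rightarrow> store \<Rightarrow> bool" where
  "linked H M G s \<longleftrightarrow>
     tables M s \<and> stack_set s \<subseteq> {..<n} \<and> (\<forall>e\<in>dom G. elv s e \<le> M) \<and>
     (\<forall>r>0. nxt s r < r) \<and> (\<forall>a. head s a \<le> alloc s) \<and>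
     (\<forall>e S. G e = Some S \<longrightarrow> 0 < est s e \<and> est s e \<le> eend s e \<and> eend s e \<le> Suc (alloc s) \<and>
        bij_betw (node s) {est s e..<eend s e} S) \<and>
     (\<forall>e\<in>dom G. \<forall>r\<in>{est s e..<eend s e}. edg s r = e \<and>
        (r \<in> H \<or> r \<in> set (chain (nxt s) (head s (node s r + n * elv s e))))) \<and>
     (\<forall>v<n. \<forall>l. \<forall>r\<in>set (chain (nxt s) (head s (v + n * l))). est s (edg s r) \<le> r \<longrightarrow>
        edg s r \<in> dom G \<and> r < eend s (edg s r) \<and> node s r = v \<and> elv s (edg s r) = l) \<and>
     (\<forall>e S v. G e = Some S \<longrightarrow> v \<in> S \<longrightarrow> lo s v \<le> elv s e)"

definition weighted :: "hypergraph \<Rightarrow> store \<Rightarrow> bool" where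
  "weighted G s \<longleftrightarrow> (\<forall>v<n. wgt s v = (\<Sum>e\<in>inc G v. ew s e)) \<and>
     (\<forall>e\<in>dom G. ew s e = \<mu> / \<beta> ^ elv s e)"

lemma linkedD:
  assumes "linked H M G s"
  shows "tables M s" "stack_set s \<subseteq> {..<n}" "e \<in> dom G \<Longrightarrow> elv s e \<le> M"
    "0 < r \<Longrightarrow> nxt s r < r" "head s a \<le> alloc s"
    "G e = Some S \<Longrightarrow> 0 < est s e" "G e = Some S \<Longrightarrow> est s e \<le> eend s e"
    "G e = Some S \<Longrightarrow> eend s e \<le> Suc (alloc s)"
    "G e = Some S \<Longrightarrow> bij_betw (node s) {est s e..<eend s e} S"
    "e \<in> dom G \<Longrightarrow> est s e \<le> r \<Longrightarrow> r < eend s e \<Longrightarrow> edg s r = e"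
    "e \<in> dom G \<Longrightarrow> est s e \<le> r \<Longrightarrow> r < eend s e \<Longrightarrow>
       r \<in> H \<or> r \<in> set (chain (nxt s) (head s (node s r + n * elv s e)))"
    "G e = Some S \<Longrightarrow> v \<in> S \<Longrightarrow> lo s v \<le> elv s e"
  using assms unfolding linked_def by auto

lemma linked_sound:
  assumes "linked H M G s" "v < n" "r \<in> set (chain (nxt s) (head s (v + n * l)))" "est s (edg s r) \<le> r"
  shows "edg s r \<in> dom G" "r < eend s (edg s r)" "node s r = v" "elv s (edg s r) = l"
  using assms unfolding linked_def by blast+

lemma linkedI:
  assumes "tables M s" "stack_set s \<subseteq> {..<n}"
    and "\<And>v l r. v < n \<Longrightarrow> r \<in> set (chain (nxt s) (head s (v + n * l))) \<Longrightarrow> est s (edg s r) \<le> r \<Longrightarrow>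
        edg s r \<in> dom G \<and> r < eend s (edg s r) \<and> node s r = v \<and> elv s (edg s r) = l"
    and "\<And>e r. e \<in> dom G \<Longrightarrow> est s e \<le> r \<Longrightarrow> r < eend s e \<Longrightarrow> edg s r = e"
    and "\<And>e r. e \<in> dom G \<Longrightarrow> est s e \<le> r \<Longrightarrow> r < eend s e \<Longrightarrow>
       r \<in> H \<or> r \<in> set (chain (nxt s) (head s (node s r + n * elv s e)))"
    and "\<And>e S. G e = Some S \<Longrightarrow> 0 < est s e" "\<And>e S. G e = Some S \<Longrightarrow> est s e \<le> eend s e"
    "\<And>e S. G e = Some S \<Longrightarrow> eend s e \<le> Suc (alloc s)"
    "\<And>e S. G e = Some S \<Longrightarrow> bij_betw (node s) {est s e..<eend s e} S"
    "\<And>e S v. G e = Some S \<Longrightarrow> v \<in> S \<Longrightarrow> lo s v \<le> elv s e"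
    and "\<And>e. e \<in> dom G \<Longrightarrow> elv s e \<le> M"
    and "\<And>r. 0 < r \<Longrightarrow> nxt s r < r" "\<And>a. head s a \<le> alloc s"
  shows "linked H M G s"
  unfolding linked_def
  by (intro conjI allI ballI impI) (use assms in \<open>(blast | simp)+\<close>)

text \<open>Every record in a bucket lies at or below \<open>alloc s\<close>, so moving
  \<open>est\<close> of \<open>e\<close> past that point outdates all records of \<open>e\<close> at
  once without touching a list. The edge may also be absent from \<open>G\<close>, as before an
  insertion.\<close>

lemma linked_unlink:
  assumes l: "linked H M G s"
    and same: "\<And>b. b \<in> {0, 5, 6, 7, 10, 12} \<Longrightarrow> ibank s' b = ibank s b"
      "\<And>b. b \<in> {0, 1, 3} \<Longrightarrow> rbank s' b = rbank s b"
    and al: "alloc s \<le> alloc s'" and nd: "\<And>r. r \<le> alloc s \<Longrightarrow> node s' r = node s r"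
    and ss: "stack_set s' \<subseteq> {..<n}"
    and est: "est s' = (est s)(e := Suc (alloc s))"
    and other: "\<And>e'. e' \<noteq> e \<Longrightarrow> elv s' e' = elv s e'" "\<And>e'. e' \<noteq> e \<Longrightarrow> eend s' e' = eend s e'"
  shows "linked H M (G(e := None)) s'"
proof -
  have S: "ibank s' 0 = ibank s 0" "edg s' = edg s" "nxt s' = nxt s" "head s' = head s" "lo s' = lo s"
    "off s' = off s" "rbank s' 0 = rbank s 0" "rbank s' 1 = rbank s 1" "rbank s' (Suc 0) = rbank s 1" "tab s' = tab s"
    using same by auto
  have tb: "tables M s'" using linkedD(1)[OF l] by (simp add: tables_def S)
  have r: "r \<le> alloc s" if "r \<in> set (chain (nxt s) (head s a))" for r a
    using set_chain_bounds[OF that] linkedD(5)[OF l, of a] by simp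
  show ?thesis
  proof (rule linkedI[OF tb ss])
    fix v l' r' assume *: "v < n" "r' \<in> set (chain (nxt s') (head s' (v + n * l')))" "est s' (edg s' r') \<le> r'"
    have **: "r' \<in> set (chain (nxt s) (head s (v + n * l')))" using *(2) by (simp add: S)
    then have ne: "edg s r' \<noteq> e" using r[OF **] *(3) by (auto simp: S est)
    then have "est s (edg s r') \<le> r'" using *(3) by (simp add: S est)
    from linked_sound[OF l *(1) ** this] ne
    show "edg s' r' \<in> dom (G(e := None)) \<and> r' < eend s' (edg s' r') \<and> node s' r' = v \<and> elv s' (edg s' r') = l'"
      using r[OF **] nd by (auto simp: S other)
  next
    fix e' r' assume *: "e' \<in> dom (G(e := None))" "est s' e' \<le> r'" "r' < eend s' e'"
    then have "e' \<noteq> e" "e' \<in> dom G" by (auto split: if_splits)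
    then show "edg s' r' = e'"
      "r' \<in> H \<or> r' \<in> set (chain (nxt s') (head s' (node s' r' + n * elv s' e')))"
      using linkedD(8)[OF l, of e'] linkedD(10,11)[OF l, of e' r'] *(2,3) nd[of r']
      by (fastforce simp: S est other)+
  next
    fix e' S' assume "(G(e := None)) e' = Some S'"
    then have "e' \<noteq> e" "G e' = Some S'" by (auto split: if_splits)
    note D = linkedD(6-9,12)[OF l this(2)] and ne = this(1)
    have "bij_betw (node s') {est s e'..<eend s e'} S'"
      using D(4) nd D(3) by (subst bij_betw_cong[of _ _ "node s"]) auto
    then show "0 < est s' e'" "est s' e' \<le> eend s' e'" "eend s' e' \<le> Suc (alloc s')"
      "bij_betw (node s') {est s' e'..<eend s' e'} S'" "\<And>v. v \<in> S' \<Longrightarrow> lo s' v \<le> elv s' e'"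
      using D ne al by (simp_all add: S est other)
  next
    fix e' assume "e' \<in> dom (G(e := None))"
    then have "e' \<noteq> e" "e' \<in> dom G" by (auto split: if_splits)
    then show "elv s' e' \<le> M" using linkedD(3)[OF l, of e'] by (simp add: other)
  next
    show "head s' a \<le> alloc s'" for a using linkedD(5)[OF l, of a] al by (simp add: S)
  qed (use linkedD(4)[OF l] in \<open>simp add: S\<close>)
qed

text \<open>The new records lie above all old ones, so each old list survives, either unchanged or
  as the tail of a list with one new record in front.\<close>

lemma linked_link:
  assumes l: "linked H M G s" and e: "e \<notin> dom G" and mx: "mx \<le> M" "elv s e = mx"
    and est: "est s e = Suc (alloc s)"
    and L: "linked_to n e mx k u (alloc s) s s1" and u: "bij_betw u {..<k} S" and S: "S \<subseteq> {..<n}"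
    and fr: "frame {9} {} s1 s'" and eend: "eend s' = (eend s1)(e := Suc (alloc s1))"
  shows "linked H M (G(e := Some S)) s'"
    and "records s' \<le> records s + card S"
    and "stack_set s' = stack_set s \<union> S"
proof -
  let ?A = "alloc s"
  note L' = L[unfolded linked_to_def]
  have fr1: "link_frame s s1" by (rule linked_to_frame[OF L])
  have F: "ibank s' 0 = ibank s 0" "est s' = est s" "off s' = off s" "elv s' = elv s"
    "rbank s' 0 = rbank s 0" "rbank s' 1 = rbank s 1" "rbank s' (Suc 0) = rbank s 1" "tab s' = tab s"
    using frame_ibank[OF fr] frame_ibank[OF fr1] frame_rbank[OF fr] frame_rbank[OF fr1] by simp_all
  have B: "ibank s' 3 = ibank s1 3" "node s' = node s1" "edg s' = edg s1" "nxt s' = nxt s1" "head s' = head s1"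
    "lo s' = lo s1" "stk s' = stk s1"
    using frame_ibank[OF fr] by simp_all
  have E: "eend s' = (eend s)(e := Suc (?A + k))"
    using eend L' frame_ibank[OF fr1, of 9] by simp
  have al: "alloc s' = ?A + k" and sp: "sp s' = sp s + k" using L' by (simp_all add: B)
  have old: "node s' r = node s r" "edg s' r = edg s r" "nxt s' r = nxt s r" if "r \<le> ?A" for r
    using L' that by (simp_all add: B)
  have new: "node s' (Suc (?A + i)) = u i" "edg s' (Suc (?A + i)) = e"
    "nxt s' (Suc (?A + i)) = head s (u i + n * mx)" "head s' (u i + n * mx) = Suc (?A + i)" if "i < k" for i
    using L' that by (simp_all add: B)
  have hd: "head s' a = head s a" if "\<And>i. i < k \<Longrightarrow> a \<noteq> u i + n * mx" for a
    using L' that by (simp add: B)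
  have lo': "lo s' v = (if v \<in> u ` {..<k} then min (lo s v) mx else lo s v)" for v
    using L' by (simp add: B)
  have uS: "u ` {..<k} = S" using u by (auto simp: bij_betw_def)
  have un: "u i < n" if "i < k" for i using that uS S by auto
  have hA: "head s a \<le> ?A" for a using linkedD(5)[OF l] .
  have ch: "chain (nxt s') (head s a) = chain (nxt s) (head s a)" for a
    using old(3) hA[of a] by (intro chain_cong) auto
  \<comment> \<open>The invariant constrains the links at all positive addresses, so the cells not
    yet allocated form a third case.\<close>
  have nx: "nxt s' r < r" if "0 < r" for r
  proof -
    consider "r \<le> ?A" | i where "i < k" "r = Suc (?A + i)" | "r > ?A + k"
    proof (cases "r \<le> ?A \<or> r > ?A + k")
      case False
      then have "r - Suc ?A < k" "r = Suc (?A + (r - Suc ?A))" by auto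
      then show ?thesis using that(2) by blast
    qed (use that in blast)
    then show ?thesis
    proof cases
      case 1 then show ?thesis using old(3) linkedD(4)[OF l that] by simp
    next
      case 2 then show ?thesis using new(3)[OF 2(1)] hA[of "u i + n * mx"] by (simp add: less_Suc_eq_le trans_le_add1)
    next
      case 3 then show ?thesis using L' linkedD(4)[OF l that] by (simp add: B)
    qed
  qed
  have chn: "chain (nxt s') (head s' (u i + n * mx)) = Suc (?A + i) # chain (nxt s) (head s (u i + n * mx))"
    if "i < k" for i
    using chain_pos[of "Suc (?A + i)" "nxt s'"] nx[of "Suc (?A + i)"] new[OF that] ch by simp
  have cho: "chain (nxt s') (head s' a) = chain (nxt s) (head s a)" if "\<And>i. i < k \<Longrightarrow> a \<noteq> u i + n * mx" for a
    using hd[OF that] ch by simp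
  have chs: "set (chain (nxt s) (head s a)) \<subseteq> set (chain (nxt s') (head s' a))" for a
  proof (cases "\<exists>i<k. a = u i + n * mx")
    case True then show ?thesis using chn by auto
  next
    case False then show ?thesis using cho[of a] by auto
  qed
  have tb: "tables M s'" using linkedD(1)[OF l] by (simp add: tables_def F)
  have "{0<..sp s'} = {0<..sp s} \<union> (\<lambda>i. Suc (sp s + i)) ` {..<k}"
  proof (intro equalityI subsetI)
    fix x assume "x \<in> {0<..sp s'}"
    then show "x \<in> {0<..sp s} \<union> (\<lambda>i. Suc (sp s + i)) ` {..<k}"
      using sp by (cases "x \<le> sp s") (auto intro!: image_eqI[of _ _ "x - Suc (sp s)"])
  qed (use sp in auto)
  moreover have "stk s' ` {0<..sp s} = stk s ` {0<..sp s}"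
    using L' by (intro image_cong) (auto simp: B)
  moreover have "stk s' ` (\<lambda>i. Suc (sp s + i)) ` {..<k} = u ` {..<k}"
    unfolding image_image using L' by (intro image_cong) (auto simp: B)
  ultimately show st: "stack_set s' = stack_set s \<union> S"
    unfolding stack_set_def uS by (simp only: image_Un uS)
  have ss: "stack_set s' \<subseteq> {..<n}" using st S linkedD(2)[OF l] by auto
  show "linked H M (G(e := Some S)) s'"
  proof (rule linkedI[OF tb ss])
    fix v l' r assume *: "v < n" "r \<in> set (chain (nxt s') (head s' (v + n * l')))" "est s' (edg s' r) \<le> r"
    show "edg s' r \<in> dom (G(e := Some S)) \<and> r < eend s' (edg s' r) \<and> node s' r = v \<and> elv s' (edg s' r) = l'"
    proof (cases "r \<in> set (chain (nxt s) (head s (v + n * l')))")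
      case True
      have rA: "r \<le> ?A" using set_chain_bounds[OF True] hA[of "v + n * l'"] by simp
      then have "est s (edg s r) \<le> r" using *(3) by (simp add: F old)
      from linked_sound[OF l *(1) True this] show ?thesis using e rA by (auto simp: old E F)
    next
      case False
      then obtain i where i: "i < k" "v + n * l' = u i + n * mx" using cho[of "v + n * l'"] *(2) by metis
      then have r: "r = Suc (?A + i)" using chn[OF i(1)] *(2) False by simp
      have "v = u i \<and> l' = mx" using mult_add_unique[OF *(1) un[OF i(1)] i(2)] .
      then show ?thesis using r i new by (simp add: E F mx)
    qed
  next
    fix e' r assume *: "e' \<in> dom (G(e := Some S))" "est s' e' \<le> r" "r < eend s' e'"
    show "edg s' r = e'" "r \<in> H \<or> r \<in> set (chain (nxt s') (head s' (node s' r + n * elv s' e')))"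
    proof -
      have "edg s' r = e' \<and> (r \<in> H \<or> r \<in> set (chain (nxt s') (head s' (node s' r + n * elv s' e'))))"
      proof (cases "e' = e")
        case True
        define i where "i = r - Suc ?A"
        have i: "i < k" "r = Suc (?A + i)" using * True by (auto simp: i_def E F est)
        then show ?thesis using new[OF i(1)] True chn[OF i(1)] by (simp add: F mx)
      next
        case False
        then have d: "e' \<in> dom G" and r: "est s e' \<le> r" "r < eend s e'" using * by (auto simp: F E)
        obtain S' where "G e' = Some S'" using d by auto
        then have "r \<le> ?A" using linkedD(8)[OF l] r(2) by fastforce
        then show ?thesis using linkedD(10,11)[OF l d r] chs[of "node s r + n * elv s e'"] by (auto simp: old F)
      qed
      then show "edg s' r = e'" "r \<in> H \<or> r \<in> set (chain (nxt s') (head s' (node s' r + n * elv s' e')))"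
        by blast+
    qed
  next
    fix e' S' assume g: "(G(e := Some S)) e' = Some S'"
    have "0 < est s' e' \<and> est s' e' \<le> eend s' e' \<and> eend s' e' \<le> Suc (alloc s') \<and>
      bij_betw (node s') {est s' e'..<eend s' e'} S' \<and> (\<forall>v\<in>S'. lo s' v \<le> elv s' e')"
    proof (cases "e' = e")
      case True
      then have SS: "S' = S" using g by simp
      have "bij_betw (node s') {Suc ?A..<Suc (?A + k)} S" by (rule bij_betw_shift[OF u]) (rule new(1))
      then show ?thesis using True SS est uS by (auto simp: F E al mx lo')
    next
      case False
      then have G: "G e' = Some S'" using g by simp
      note D = linkedD(6-9)[OF l G]
      have "bij_betw (node s') {est s e'..<eend s e'} S'"
        using D(4) old(1) D(3) by (subst bij_betw_cong[of _ _ "node s"]) auto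
      moreover have "lo s' v \<le> elv s e'" if "v \<in> S'" for v
        using linkedD(12)[OF l G that] lo'[of v] by auto
      ultimately show ?thesis using D False by (simp add: F E al)
    qed
    then show "0 < est s' e'" "est s' e' \<le> eend s' e'" "eend s' e' \<le> Suc (alloc s')"
      "bij_betw (node s') {est s' e'..<eend s' e'} S'" "\<And>v. v \<in> S' \<Longrightarrow> lo s' v \<le> elv s' e'"
      by blast+
  next
    fix e' assume "e' \<in> dom (G(e := Some S))"
    then show "elv s' e' \<le> M" using linkedD(3)[OF l, of e'] mx by (auto simp: F split: if_splits)
  next
    fix a show "head s' a \<le> alloc s'"
    proof (cases "\<exists>i<k. a = u i + n * mx")
      case True then show ?thesis using new(4) al by auto
    next
      case False then show ?thesis using hd[of a] hA[of a] al by auto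
    qed
  qed (rule nx)
  let ?T = "(\<lambda>i. u i + n * mx) ` {..<k}"
  have "length (chain (nxt s') (head s' a)) = length (chain (nxt s) (head s a)) + (if a \<in> ?T then 1 else 0)" for a
  proof (cases "a \<in> ?T")
    case True
    then show ?thesis using chn by auto
  next
    case False
    then have "chain (nxt s') (head s' a) = chain (nxt s) (head s a)" by (intro cho) auto
    with False show ?thesis by simp
  qed
  then have "records s' = records s + (\<Sum>a<n * Suc L. if a \<in> ?T then 1 else 0)"
    by (simp add: records_def sum.distrib)
  also have "(\<Sum>a<n * Suc L. if a \<in> ?T then 1 else 0) = card ({..<n * Suc L} \<inter> ?T)"
    by (subst sum.inter_restrict[symmetric]) (simp_all only: finite_lessThan card_eq_sum)
  also have "\<dots> \<le> card ?T" by (intro card_mono) auto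
  also have "\<dots> \<le> card {..<k}" by (rule card_image_le) simp
  also have "card {..<k} = card S" using bij_betw_same_card[OF u] .
  finally show "records s' \<le> records s + card S" by simp
qed

end

lemma runI: "exec p s t s' \<Longrightarrow> Q t s' \<Longrightarrow> run p s Q"
  by (auto simp: run_def)

context instance_params begin

definition refreshed :: "nat \<Rightarrow> nat set \<Rightarrow> store \<Rightarrow> store \<Rightarrow> bool" where
  "refreshed e S s s' \<longleftrightarrow>
     refresh_frame s s' \<and>
     (\<forall>r\<le>alloc s. edg s' r = edg s r \<and> nxt s' r = nxt s r) \<and> alloc s \<le> alloc s' \<and>
     est s' = (est s)(e := Suc (alloc s)) \<and> elv s' = (elv s)(e := Max (lev s ` S)) \<and>
     records s' \<le> records s + card S \<and> sp s' = sp s + card S \<and> stack_set s' = stack_set s \<union> S \<and>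
     (\<forall>u. u \<notin> S \<longrightarrow> wgt s' u = wgt s u) \<and>
     (\<forall>u. lo s' u = (if u \<in> S then min (lo s u) (Max (lev s ` S)) else lo s u))"

text \<open>The edge \<open>e\<close> need not belong to \<open>G\<close>: an insertion supplies a
  provisional block and \<open>ew s e = 0\<close>, a level change the present block and weight. In
  both cases \<open>wgt\<close> already contains the recorded weight of \<open>e\<close>, so adding
  the difference to the new weight is correct.\<close>

lemma run_refresh:
  assumes l: "linked H M G s" and e: "er s = e" and fin: "finite (dom G)"
    and S: "S \<noteq> {}" "S \<subseteq> {..<n}"
    and blk: "est s e \<le> eend s e" "eend s e \<le> Suc (alloc s)" "bij_betw (node s) {est s e..<eend s e} S"
    and w: "\<And>v. v < n \<Longrightarrow> wgt s v = (\<Sum>e'\<in>inc (G(e := None)) v. ew s e') + (if v \<in> S then ew s e else 0)"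
    and w': "\<And>e'. e' \<in> dom G \<Longrightarrow> e' \<noteq> e \<Longrightarrow> ew s e' = \<mu> / \<beta> ^ elv s e'"
    and lev: "\<And>v. v \<in> S \<Longrightarrow> lev s v \<le> M"
  shows "run refresh s (\<lambda>t s'. linked H M (G(e := Some S)) s' \<and> weighted (G(e := Some S)) s' \<and>
     refreshed e S s s' \<and> t \<le> 400 * card S + 400)"
proof -
  define mx where "mx = Max (lev s ` S)"
  define k where "k = card S"
  have finS: "finite S" using S(2) finite_subset by blast
  have mx: "mx \<le> M" unfolding mx_def using finS S(1) lev by auto
  have kE: "eend s e - est s e = k" using bij_betw_same_card[OF blk(3)] by (simp add: k_def)
  have imS: "node s ` {est s e..<eend s e} = S" using blk(3) by (simp add: bij_betw_def)
  define s1 where "s1 = write_i 16 (Suc 0) 0 (write_i 16 0 (est s e) s)"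
  have F1: "frame {16} {} s s1" by (auto simp: s1_def frame_def)
  have s1: "mxr s1 = 0" "qr s1 = est s e" "er s1 = e" "eend s1 = eend s" "lev s1 = lev s" "node s1 = node s"
    using e by (simp_all add: s1_def)
  obtain t2 s2 where x2: "exec max_loop s1 t2 s2" and F2: "frame {16} {} s1 s2"
    and "mxr s2 = Max (insert 0 (lev s ` S))" and t2: "t2 \<le> 40 * k + 40"
    using run_max_loop[of s1] blk(1) by (auto simp: run_def s1 kE imS)
  then have m2: "mxr s2 = mx" using S(1) finS by (simp add: mx_def)
  note fr = frame_trans[OF F1 F2]
  note b2 = frame_ibank[OF fr] frame_rbank[OF fr]
  have tb: "off s mx = n * mx" "tab s mx = \<mu> / \<beta> ^ mx"
    using linkedD(1)[OF l] mx by (auto simp: tables_def)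
  define s3 where "s3 = write_i 8 e (Suc (alloc s)) (write_i 16 0 (est s e) (write_i 13 e mx
      (write_r 4 e (\<mu> / \<beta> ^ mx) (write_r 5 0 (\<mu> / \<beta> ^ mx - ew s e) s2))))"
  have s3: "qr s3 = est s e" "mxr s3 = mx" "er s3 = e" "eend s3 = eend s" "ibank s3 3 = ibank s 3" "node s3 = node s"
    "off s3 = off s" "est s3 = (est s)(e := Suc (alloc s))" "elv s3 = (elv s)(e := mx)"
    "ew s3 = (ew s)(e := \<mu> / \<beta> ^ mx)" "wgt s3 = wgt s" "dw s3 = \<mu> / \<beta> ^ mx - ew s e"
    "edg s3 = edg s" "nxt s3 = nxt s" "head s3 = head s" "lo s3 = lo s" "stk s3 = stk s" "lev s3 = lev s"
    using b2 m2 e by (simp_all add: s3_def)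
  have ak: "est s e + k = eend s e" using kE blk(1) by simp
  have inj: "inj_on (node s) {est s e..<est s e + k}" using blk(3) by (simp add: ak bij_betw_def)
  let ?u = "\<lambda>i. node s (est s e + i)"
  obtain t4 s4 where x4: "exec link_loop s3 t4 s4" and L: "linked_to n e mx k ?u (alloc s) s3 s4"
    and t4: "t4 \<le> 200 * k + 50"
    using run_link_loop[of s3 "est s e" k n] blk kE inj tb by (auto simp: run_def s3)
  have F4: "link_frame s3 s4" by (rule linked_to_frame[OF L])
  define s5 where "s5 = write_i 9 e (Suc (alloc s4)) s4"
  have e4: "er s4 = e" using frame_ibank[OF F4, of 15] s3 by simp
  have x: "run refresh s (\<lambda>t s'. s' = s5 \<and> t \<le> 400 * k + 400)"
    unfolding refresh_def
    apply (simp add: run_simps e s1_def[symmetric])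
    apply (rule runI[OF x2])
    apply (simp add: run_simps b2 e m2 tb s3_def[symmetric])
    apply (rule runI[OF x4])
    using t2 t4 by (simp add: run_simps e4 s5_def)
  \<comment> \<open>Whether or not \<open>e\<close> was present, it is first removed by outdating
    its records and then linked afresh.\<close>
  have l3: "linked H M (G(e := None)) s3"
    by (rule linked_unlink[OF l]) (use linkedD(2)[OF l] in \<open>auto simp: s3_def b2 stack_set_def\<close>)
  have u: "bij_betw ?u {..<k} S"
  proof -
    have "{est s e..<eend s e} = (\<lambda>i. est s e + i) ` {..<k}"
      unfolding ak[symmetric] by (simp add: atLeast0LessThan[symmetric] image_add_atLeastLessThan add.commute)
    then have "bij_betw (\<lambda>i. est s e + i) {..<k} {est s e..<eend s e}" by (simp add: bij_betw_def)
    from bij_betw_trans[OF this blk(3)] show ?thesis by (simp add: comp_def)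
  qed
  have F5: "frame {9} {} s4 s5" by (auto simp: s5_def frame_def)
  have a3: "alloc s3 = alloc s" "sp s3 = sp s" by (simp_all add: s3)
  have "linked H M ((G(e := None))(e := Some S)) s5" "records s5 \<le> records s3 + card S"
      "stack_set s5 = stack_set s3 \<union> S"
    using linked_link[OF l3, of e mx k ?u s4 S s5] mx L u S F5 by (simp_all add: s3 s5_def)
  moreover have "records s3 = records s" "stack_set s3 = stack_set s"
    by (simp_all add: records_def stack_set_def s3)
  ultimately have C: "linked H M (G(e := Some S)) s5" "records s5 \<le> records s + card S"
      "stack_set s5 = stack_set s \<union> S"
    by simp_all
  have uS: "?u ` {..<k} = S" using u by (simp add: bij_betw_def)
  note L' = L[unfolded linked_to_def uS]
  have w5: "wgt s5 v = wgt s v + (if v \<in> S then \<mu> / \<beta> ^ mx - ew s e else 0)" for v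
    using L' by (simp add: s3 s5_def)
  have lo5: "lo s5 v = (if v \<in> S then min (lo s v) mx else lo s v)" for v
    using L' by (simp add: s3 s5_def)
  have o5: "edg s5 r = edg s r" "nxt s5 r = nxt s r" if "r \<le> alloc s" for r
    using L' that by (simp_all add: s3 s5_def)
  have al5: "alloc s5 = alloc s + k" "sp s5 = sp s + k"
    using linked_to_counters[OF L] by (simp_all add: s3 s5_def)
  have e5: "ew s5 = (ew s)(e := \<mu> / \<beta> ^ mx)" "elv s5 = (elv s)(e := mx)" "est s5 = (est s)(e := Suc (alloc s))"
    using frame_rbank[OF F4, of 4] frame_ibank[OF F4, of 13] frame_ibank[OF F4, of 8] by (simp_all add: s5_def s3)
  have "frame {16} {} s s2" by (rule fr)
  moreover have "frame {8, 13, 16} {4, 5} s2 s3" by (auto simp: s3_def frame_def)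
  ultimately have "refresh_frame s s3"
    by (auto simp: frame_def)
  moreover have "refresh_frame s3 s4"
    by (rule frame_weaken[OF F4]) auto
  moreover have "refresh_frame s4 s5"
    by (rule frame_weaken[OF F5]) auto
  ultimately have F: "refresh_frame s s5"
    by (blast intro: frame_trans)
  have W: "weighted (G(e := Some S)) s5"
    unfolding weighted_def
  proof (intro conjI allI impI ballI)
    fix v assume v: "v < n"
    have finI: "finite (inc (G(e := None)) v)"
      by (rule finite_subset[OF incident_subset_dom]) (use fin in simp)
    have "(\<Sum>e'\<in>inc (G(e := None)) v. ew s5 e') = (\<Sum>e'\<in>inc (G(e := None)) v. ew s e')"
      using not_incident_delete[of e G v] by (intro sum.cong refl) (auto simp: e5)
    then show "wgt s5 v = (\<Sum>e'\<in>inc (G(e := Some S)) v. ew s5 e')"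
      using finI not_incident_delete[of e G v] w[OF v] by (auto simp: w5 e5 incident_insert)
  next
    fix e' assume "e' \<in> dom (G(e := Some S))"
    then show "ew s5 e' = \<mu> / \<beta> ^ elv s5 e'" using w'[of e'] by (auto simp: e5 split: if_splits)
  qed
  have "refreshed e S s s5"
    unfolding refreshed_def mx_def[symmetric]
    using F o5 al5 e5 C lo5 w5 by (simp add: k_def)
  then show ?thesis using C(1) W by (intro run_mono[OF x]) (auto simp: k_def)
qed

end

text \<open>Clearing the front of the list is enough: afterwards the bucket is empty or headed by an
  up-to-date record, so its head tells whether \<open>v\<close> has an edge of this level.\<close>

definition clean :: com where
  "clean = While (BAnd (ILess (INum 0) (ICell 7 xBKT)) (ILess (ICell 7 xBKT) (ICell 8 (ICell 5 (ICell 7 xBKT)))))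
     (ISet 7 xBKT (ICell 6 (ICell 7 xBKT)))"

definition scan :: com where
  "scan = (clean ;;
     While (BNot (ILess (INum 0) (ICell 7 xBKT))) (ISet 14 (INum (Suc 0)) (IAdd xJ (INum 1)) ;; clean))"

definition traverse :: com where
  "traverse = While (ILess (INum 0) xH)
     (ISet 15 (INum 0) (ICell 5 xH) ;;
      Cond (ILess xH (ICell 8 xE)) Skip refresh ;;
      ISet 14 (INum 3) (ICell 6 xH))"

text \<open>The list is detached before it is traversed because an edge that keeps its level while
  \<open>v\<close> is lowered is linked into the same bucket again.\<close>

definition move :: com where
  "move = (ISet 2 xV xNEW ;; ISet 14 (INum 3) (ICell 7 xBKT) ;; ISet 7 xBKT (INum 0) ;; traverse)"

section \<open>Cost and effect of cleaning and scanning buckets\<close>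

context instance_params begin

text \<open>Serves every step that changes only node levels, bucket heads, the pointers
  \<open>lo\<close>, tables and registers. A list may lose records provided that they are outdated
  or pass into the detached set \<open>H'\<close>.\<close>

lemma linked_transfer:
  assumes l: "linked H M G s" and M: "M \<le> M'" "tables M' s'"
    and same: "\<And>b. b \<in> {3, 4, 5, 6, 8, 9, 11, 13} \<Longrightarrow> ibank s' b = ibank s b"
    and lo: "\<And>e S v. G e = Some S \<Longrightarrow> v \<in> S \<Longrightarrow> lo s' v \<le> elv s e"
    and hd: "\<And>a. head s' a \<le> alloc s"
      "\<And>a. set (chain (nxt s) (head s' a)) \<subseteq> set (chain (nxt s) (head s a))"
      "\<And>a r. r \<in> set (chain (nxt s) (head s a)) \<Longrightarrow>
         r \<in> set (chain (nxt s) (head s' a)) \<or> r \<in> H' \<or> r < est s (edg s r)"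
    and H: "\<And>r. r \<in> H \<Longrightarrow> r \<in> H' \<or> r < est s (edg s r)"
  shows "linked H' M' G s'"
proof -
  have S: "ibank s' 3 = ibank s 3" "node s' = node s" "edg s' = edg s"
    "nxt s' = nxt s" "est s' = est s" "eend s' = eend s" "stk s' = stk s" "elv s' = elv s"
    using same by auto
  have ss: "stack_set s' \<subseteq> {..<n}" using linkedD(2)[OF l] by (simp add: stack_set_def S)
  show ?thesis
  proof (rule linkedI[OF M(2) ss])
    fix v l' r assume *: "v < n" "r \<in> set (chain (nxt s') (head s' (v + n * l')))" "est s' (edg s' r) \<le> r"
    then have "r \<in> set (chain (nxt s) (head s (v + n * l')))" using hd(2) by (auto simp: S)
    from linked_sound[OF l *(1) this] *(3)
    show "edg s' r \<in> dom G \<and> r < eend s' (edg s' r) \<and> node s' r = v \<and> elv s' (edg s' r) = l'"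
      by (simp add: S)
  next
    fix e r assume *: "e \<in> dom G" "est s' e \<le> r" "r < eend s' e"
    then have **: "est s e \<le> r" "r < eend s e" by (simp_all add: S)
    show e: "edg s' r = e" using linkedD(10)[OF l *(1) **] by (simp add: S)
    have "\<not> r < est s (edg s r)" using e ** by (simp add: S)
    then show "r \<in> H' \<or> r \<in> set (chain (nxt s') (head s' (node s' r + n * elv s' e)))"
      using linkedD(11)[OF l *(1) **] H[of r] hd(3)[of r "node s r + n * elv s e"] by (auto simp: S)
  next
    fix e assume "e \<in> dom G"
    then show "elv s' e \<le> M'" using linkedD(3)[OF l, of e] M(1) by (simp add: S)
  qed (use linkedD(4-9)[OF l] lo hd(1) in \<open>simp_all add: S\<close>)
qed

lemma tables_cong:
  assumes "tables M s" "ibank s' 0 = ibank s 0" "off s' = off s" "rbank s' 0 = rbank s 0" "rbank s' 1 = rbank s 1" "tab s' = tab s"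
  shows "tables M s'"
  using assms by (simp add: tables_def)

lemma bucket_address: "v < n \<Longrightarrow> j \<le> L \<Longrightarrow> v + n * j < n * Suc L"
proof -
  assume "v < n" "j \<le> L"
  then have "v + n * j < n + n * j" "n * j \<le> n * L" by simp_all
  then show ?thesis unfolding mult_Suc_right by linarith
qed

lemma records_head_upd:
  assumes "a < n * Suc L" "nxt s' = nxt s" "head s' = (head s)(a := x)"
  shows "records s' + length (chain (nxt s) (head s a)) = records s + length (chain (nxt s) x)"
proof -
  have "records s = length (chain (nxt s) (head s a)) + (\<Sum>b\<in>{..<n * Suc L} - {a}. length (chain (nxt s) (head s b)))"
    unfolding records_def using assms(1) by (subst sum.remove[of _ a]) auto
  moreover have "records s' = length (chain (nxt s) x) + (\<Sum>b\<in>{..<n * Suc L} - {a}. length (chain (nxt s) (head s b)))"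
    unfolding records_def assms(2,3) using assms(1) by (subst sum.remove[of _ a]) (auto intro!: sum.cong)
  ultimately show ?thesis by simp
qed

text \<open>Each iteration removes one record from its bucket for good, so \<open>records\<close>
  pays for the loop.\<close>

lemma run_clean:
  assumes l: "linked H M G s" and v: "vr s < n" and j: "jr s \<le> M" and M: "M \<le> L"
  shows "run clean s (\<lambda>t s'. frame {7} {} s s' \<and> linked H M G s' \<and>
     (0 < head s' (vr s + n * jr s) \<longrightarrow>
        est s (edg s (head s' (vr s + n * jr s))) \<le> head s' (vr s + n * jr s)) \<and>
     t + 100 * records s' \<le> 100 * records s + 100)"
proof -
  let ?a = "vr s + n * jr s"
  let ?b = "BAnd (ILess (INum 0) (ICell 7 xBKT)) (ILess (ICell 7 xBKT) (ICell 8 (ICell 5 (ICell 7 xBKT))))"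
  define I where "I s' \<longleftrightarrow> frame {7} {} s s' \<and> linked H M G s'" for s'
  define V where "V s' = 100 * records s'" for s'
  have off: "off s (jr s) = n * jr s" using linkedD(1)[OF l] j by (auto simp: tables_def)
  have "run clean s (\<lambda>t s'. I s' \<and> \<not> bval ?b s' \<and> t + V s' \<le> V s + (1 + bcost ?b))"
    unfolding clean_def
  proof (rule run_While_nat)
    show "I s" using l by (simp add: I_def frame_refl)
    fix s1 assume I: "I s1" and b: "bval ?b s1"
    have fr: "frame {7} {} s s1" and l1: "linked H M G s1" using I by (auto simp: I_def)
    note F = frame_ibank[OF fr] frame_rbank[OF fr]
    define h where "h = head s1 ?a"
    have h: "0 < h" "h < est s1 (edg s1 h)" using b by (simp_all add: F off h_def)
    define s2 where "s2 = write_i 7 ?a (nxt s1 h) s1"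
    have s2_eq: "s2 = write_i 7 ?a (nxt s h) s1" by (simp add: s2_def F)
    have nx: "nxt s1 h < h" using linkedD(4)[OF l1 h(1)] .
    have ch: "chain (nxt s1) (head s1 ?a) = h # chain (nxt s1) (nxt s1 h)"
      using chain_pos[of h "nxt s1", OF h(1) nx] by (simp add: h_def)
    have l2: "linked H M G s2"
    proof (rule linked_transfer[OF l1 order_refl])
      show "tables M s2" by (rule tables_cong[OF linkedD(1)[OF l1]]) (simp_all add: s2_def)
      show "head s2 a \<le> alloc s1" for a
        using linkedD(5)[OF l1, of a] linkedD(5)[OF l1, of ?a] nx by (auto simp: s2_def h_def)
      show "set (chain (nxt s1) (head s2 a)) \<subseteq> set (chain (nxt s1) (head s1 a))" for a
        using ch by (auto simp: s2_def)
      show "r \<in> set (chain (nxt s1) (head s2 a)) \<or> r \<in> H \<or> r < est s1 (edg s1 r)"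
        if "r \<in> set (chain (nxt s1) (head s1 a))" for a r
        using that ch h(2) by (auto simp: s2_def)
      show "lo s2 v \<le> elv s1 e" if "G e = Some S" "v \<in> S" for e S v
        using linkedD(12)[OF l1 that] by (simp add: s2_def)
    qed (auto simp: s2_def)
    have fr2: "frame {7} {} s s2" by (rule frame_trans[OF fr]) (simp add: frame_def s2_def)
    have "records s2 + length (chain (nxt s1) (head s1 ?a)) = records s1 + length (chain (nxt s1) (nxt s1 h))"
      using v j M by (intro records_head_upd bucket_address) (auto simp: s2_def)
    then have rec: "Suc (records s2) = records s1" by (simp add: ch)
    show "run (ISet 7 xBKT (ICell 6 (ICell 7 xBKT))) s1 (\<lambda>t s'. I s' \<and> V s' + (t + 1 + bcost ?b) \<le> V s1)"
      using fr2 l2 rec by (simp add: run_simps F off h_def[symmetric] s2_eq[symmetric] I_def V_def)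
  qed
  then show ?thesis
  proof (rule run_mono, goal_cases)
    case *: (1 t s')
    then have fr: "frame {7} {} s s'" by (simp add: I_def)
    note F = frame_ibank[OF fr] frame_rbank[OF fr]
    show ?case
      using * by (auto simp: I_def V_def F off)
  qed
qed

lemma linked_record_of:
  assumes l: "linked H M G s" and e: "e \<in> inc G v"
  obtains r where "est s e \<le> r" "r < eend s e" "node s r = v" "edg s r = e"
    "r \<in> H \<or> r \<in> set (chain (nxt s) (head s (v + n * elv s e)))"
proof -
  obtain S where S: "G e = Some S" "v \<in> S" using e by (auto simp: incident_edges_def)
  then obtain r where "r \<in> {est s e..<eend s e}" "node s r = v"
    using linkedD(9)[OF l S(1)] by (auto simp: bij_betw_def)
  moreover have "e \<in> dom G" using S by auto
  ultimately show ?thesis using that[of r] linkedD(10,11)[OF l, of e r] by auto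
qed

lemma linked_incident:
  assumes l: "linked H M G s" and r: "edg s r \<in> dom G" "est s (edg s r) \<le> r" "r < eend s (edg s r)"
  shows "edg s r \<in> inc G (node s r)"
proof -
  obtain S where S: "G (edg s r) = Some S" using r by auto
  then show ?thesis using linkedD(9)[OF l S] r by (auto simp: bij_betw_def incident_edges_def)
qed

text \<open>An empty bucket shows that no edge at \<open>v\<close> has level \<open>jr\<close>,
  because nothing is detached and every edge has a record in its bucket; so the lower bound may grow
  by one. It cannot pass the level of an edge at \<open>v\<close>, and that level is at most
  \<open>M\<close>. An up-to-date head at the end provides an edge of exactly the level
  reached.\<close>

lemma run_scan:
  assumes l: "linked {} M G s" and v: "vr s = v" "v < n" and M: "M \<le> L"
    and j: "\<And>e. e \<in> inc G v \<Longrightarrow> jr s \<le> elv s e" and ne: "inc G v \<noteq> {}"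
  shows "run scan s (\<lambda>t s'. frame {7, 14} {} s s' \<and> vr s' = v \<and> linked {} M G s' \<and> jr s \<le> jr s' \<and>
     (\<forall>e\<in>inc G v. jr s' \<le> elv s e) \<and> (\<exists>e\<in>inc G v. elv s e = jr s') \<and>
     t + 100 * records s' \<le> 100 * records s + 200 * (jr s' - jr s) + 300)"
proof -
  let ?b = "BNot (ILess (INum 0) (ICell 7 xBKT))"
  define I where "I s' \<longleftrightarrow> frame {7, 14} {} s s' \<and> vr s' = v \<and> linked {} M G s' \<and> jr s \<le> jr s' \<and>
     (\<forall>e\<in>inc G v. jr s' \<le> elv s e) \<and>
     (0 < head s' (v + n * jr s') \<longrightarrow> est s (edg s (head s' (v + n * jr s'))) \<le> head s' (v + n * jr s'))" for s'
  define V where "V s' = 100 * records s' + 200 * (M - jr s')" for s'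
  obtain e0 where e0: "e0 \<in> inc G v" using ne by auto
  have e0M: "elv s e0 \<le> M" using linkedD(3)[OF l] e0 incident_subset_dom by blast
  have step: "run clean s1 (\<lambda>t s'. I s' \<and> jr s' = jr s1 \<and> t + 100 * records s' \<le> 100 * records s1 + 100)"
    if "frame {7, 14} {} s s1" "vr s1 = v" "linked {} M G s1" "jr s \<le> jr s1"
      "\<forall>e\<in>inc G v. jr s1 \<le> elv s e" for s1
  proof -
    note F = frame_ibank[OF that(1)] frame_rbank[OF that(1)]
    have jM: "jr s1 \<le> M" using that(5) e0 e0M by fastforce
    have v1: "vr s1 < n" using that(2) v(2) by simp
    show ?thesis
    proof (rule run_mono[OF run_clean[OF that(3) v1 jM M]], goal_cases)
      case *: (1 t s')
      then have fr: "frame {7} {} s1 s'" by blast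
      have "frame {7, 14} {} s s'" by (rule frame_trans[OF that(1) frame_weaken[OF fr]]) auto
      moreover have "ibank s' 14 = ibank s1 14" using frame_ibank[OF fr] by simp
      ultimately show ?case
        using * that by (simp add: I_def F)
    qed
  qed
  obtain t1 s1 where x1: "exec clean s t1 s1" and I1: "I s1" and j1: "jr s1 = jr s"
      and t1: "t1 + 100 * records s1 \<le> 100 * records s + 100"
    using step[of s] l v j by (auto simp: run_def frame_refl)
  have "run (While ?b (ISet 14 (INum (Suc 0)) (IAdd xJ (INum 1)) ;; clean)) s1
      (\<lambda>t s'. I s' \<and> \<not> bval ?b s' \<and> t + V s' \<le> V s1 + (1 + bcost ?b))"
  proof (rule run_While_nat, rule I1)
    fix s2 assume I: "I s2" and b: "bval ?b s2"
    have fr: "frame {7, 14} {} s s2" and v2: "vr s2 = v" and l2: "linked {} M G s2"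
      and j2: "jr s \<le> jr s2" "\<And>e. e \<in> inc G v \<Longrightarrow> jr s2 \<le> elv s e" using I by (auto simp: I_def)
    note F = frame_ibank[OF fr] frame_rbank[OF fr]
    have jM: "jr s2 \<le> M" using j2(2)[OF e0] e0M by simp
    have off: "off s2 (jr s2) = n * jr s2" using linkedD(1)[OF l2] jM by (auto simp: tables_def)
    have h0: "head s2 (v + n * jr s2) = 0" using b by (simp add: v2 off)
    have lt: "jr s2 < elv s e" if "e \<in> inc G v" for e
    proof -
      obtain r where "r \<in> set (chain (nxt s2) (head s2 (v + n * elv s2 e)))"
        using linked_record_of[OF l2 \<open>e \<in> _\<close>] by blast
      then have "elv s2 e \<noteq> jr s2" using h0 by auto
      then show ?thesis using j2(2)[OF that] by (simp add: F)
    qed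
    define s3 where "s3 = write_i 14 (Suc 0) (Suc (jr s2)) s2"
    have fr3: "frame {7, 14} {} s s3" using fr by (auto simp: frame_def s3_def)
    have l3: "linked {} M G s3"
    proof (rule linked_transfer[OF l2 order_refl])
      show "tables M s3" by (rule tables_cong[OF linkedD(1)[OF l2]]) (simp_all add: s3_def)
    qed (use linkedD(5,12)[OF l2] in \<open>auto simp: s3_def\<close>)
    have r3: "records s3 = records s2" by (simp add: records_def s3_def)
    have j3: "jr s3 = Suc (jr s2)" by (simp add: s3_def)
    have lt0: "jr s2 < M" using lt[OF e0] e0M by simp
    have "run clean s3 (\<lambda>t s'. I s' \<and> jr s' = jr s3 \<and> t + 100 * records s' \<le> 100 * records s3 + 100)"
      using step[OF fr3 _ l3] lt j2 v2 by (auto simp: s3_def Suc_le_eq)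
    then show "run (ISet 14 (INum (Suc 0)) (IAdd xJ (INum 1)) ;; clean) s2
        (\<lambda>t s'. I s' \<and> V s' + (t + 1 + bcost ?b) \<le> V s2)"
      apply (simp add: run_simps s3_def[symmetric] del: bcost.simps)
      apply (erule run_mono)
      using lt0 by (auto simp: V_def r3 j3)
  qed
  then show ?thesis
    unfolding scan_def run_Seq
  proof (intro runI[OF x1], elim run_mono, goal_cases)
    case *: (1 t s')
    then have fr: "frame {7, 14} {} s s'" and v': "vr s' = v" and l': "linked {} M G s'"
      and j': "jr s \<le> jr s'" "\<And>e. e \<in> inc G v \<Longrightarrow> jr s' \<le> elv s e" by (auto simp: I_def)
    note F = frame_ibank[OF fr] frame_rbank[OF fr]
    have jM: "jr s' \<le> M" using j'(2)[OF e0] e0M by simp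
    have off: "off s' (jr s') = n * jr s'" using linkedD(1)[OF l'] jM by (auto simp: tables_def)
    define h where "h = head s' (v + n * jr s')"
    have "off s (jr s') = n * jr s'" using off by (simp add: F)
    then have h: "0 < h" "est s' (edg s' h) \<le> h" using * by (auto simp: I_def F h_def)
    then have hc: "h \<in> set (chain (nxt s') (head s' (v + n * jr s')))"
      by (cases h) (auto simp: h_def[symmetric])
    note snd = linked_sound[OF l' v(2) hc h(2)]
    have "edg s' h \<in> inc G v" using linked_incident[OF l' snd(1) h(2) snd(2)] snd(3) by simp
    moreover have "elv s (edg s' h) = jr s'" using snd(4) by (simp add: F)
    ultimately show ?case
      using fr v' l' j' * t1 j1 jM by (auto simp: V_def)
  qed
qed

end

section \<open>Moving a node\<close>

context instance_params begin

text \<open>The total distance that the pointers \<open>lo\<close> may still climb, which pays for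
  the scans. Nodes without edges contribute 0 so that the initial value is 0; they are never
  scanned, since a raise requires positive weight.\<close>

definition gap :: "hypergraph \<Rightarrow> store \<Rightarrow> nat" where
  "gap G s = (\<Sum>v<n. if inc G v = {} then 0 else L - lo s v)"

lemma gap_le:
  assumes "S \<subseteq> {..<n}"
    and "\<And>v. v < n \<Longrightarrow> (if inc G' v = {} then 0 else L - lo s' v)
      \<le> (if inc G v = {} then 0 else L - lo s v) + (if v \<in> S then B else 0)"
  shows "gap G' s' \<le> gap G s + card S * B"
proof -
  have "gap G' s' \<le> (\<Sum>v<n. (if inc G v = {} then 0 else L - lo s v) + (if v \<in> S then B else 0))"
    unfolding gap_def by (rule sum_mono) (use assms(2) in simp)
  also have "\<dots> = gap G s + card ({..<n} \<inter> S) * B"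
    by (simp add: gap_def sum.distrib sum.If_cases Int_def)
  also have "{..<n} \<inter> S = S" using assms(1) by auto
  finally show ?thesis .
qed

text \<open>The edges of the detached list that still await a new block; outdated records in the
  list stand for none.\<close>

definition pending :: "hypergraph \<Rightarrow> store \<Rightarrow> nat set" where
  "pending G s = {e \<in> dom G. \<exists>r\<in>set (chain (nxt s) (hr s)). edg s r = e \<and> est s e \<le> r}"

text \<open>The loop invariant of \<open>traverse\<close>: the level of \<open>v\<close> has changed
  already, but the pending edges are still recorded with their old level \<open>j\<close>. The last
  clause keeps a pointer \<open>lo\<close> from falling by more than one when such an edge is
  refreshed.\<close>

definition traversing :: "nat \<Rightarrow> hypergraph \<Rightarrow> nat \<Rightarrow> nat \<Rightarrow> store \<Rightarrow> bool" where
  "traversing M G v j s \<longleftrightarrow>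
     linked (set (chain (nxt s) (hr s))) M G s \<and> weighted G s \<and> hr s \<le> alloc s \<and>
     (\<forall>r\<in>set (chain (nxt s) (hr s)). est s (edg s r) \<le> r \<longrightarrow>
        edg s r \<in> inc G v \<and> elv s (edg s r) = j) \<and>
     (\<forall>e\<in>dom G - pending G s. elv s e = edge_level G (lev s) e) \<and>
     (\<forall>e\<in>pending G s. j \<le> Suc (edge_level G (lev s) e))"

text \<open>Every pending edge holds a reserve of \<open>f\<close> for each of
  \<open>records\<close>, \<open>sp\<close> and \<open>gap\<close>, since its refresh adds at most 1
  per endpoint to each. The clause on weights ensures that a node off the stack stays calm.\<close>

definition account :: "hypergraph \<Rightarrow> nat \<Rightarrow> store \<Rightarrow> store \<Rightarrow> bool" where
  "account G v s s' \<longleftrightarrow> lev s' = lev s \<and> pending G s' \<subseteq> pending G s \<and>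
     records s' + f * card (pending G s') \<le> records s + f * card (pending G s) \<and>
     sp s' + f * card (pending G s') \<le> sp s + f * card (pending G s) \<and>
     gap G s' + f * card (pending G s') \<le> gap G s + f * card (pending G s) \<and>
     stack_set s \<subseteq> stack_set s' \<and> (\<forall>u. u \<notin> stack_set s' \<longrightarrow> wgt s' u = wgt s u) \<and>
     (pending G s' = pending G s \<or> v \<in> stack_set s')"

lemma account_trans:
  assumes "account G v s s'" "account G v s' s''"
  shows "account G v s s''"
proof -
  note A = assms[unfolded account_def]
  have "stack_set s' \<subseteq> stack_set s''" using A(2) by (elim conjE)
  then have "wgt s'' u = wgt s u" if "u \<notin> stack_set s''" for u
    using A that by (elim conjE) (simp add: subset_iff, metis)
  moreover have "pending G s'' = pending G s \<or> v \<in> stack_set s''"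
    using A \<open>stack_set s' \<subseteq> stack_set s''\<close> by (elim conjE) (metis subsetD)
  ultimately show ?thesis
    unfolding account_def using A by (elim conjE) (intro conjI allI impI; (linarith | (erule (1) order_trans) | simp))
qed

lemma weighted_split:
  assumes wf: "wf_graph G" and e: "G e = Some S" and w: "weighted G s" and v: "v < n"
  shows "wgt s v = (\<Sum>e'\<in>inc (G(e := None)) v. ew s e') + (if v \<in> S then ew s e else 0)"
proof -
  have G: "G(e := Some S) = G" using e by auto
  have fin: "finite (inc (G(e := None)) v)"
    by (rule finite_subset[OF incident_subset_dom]) (use wf in \<open>simp add: wf_graph_def\<close>)
  have "wgt s v = (\<Sum>e'\<in>inc (G(e := Some S)) v. ew s e')"
    using w v by (simp add: weighted_def G)
  then show ?thesis using fin not_incident_delete[of e G v] by (auto simp: incident_insert)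
qed

text \<open>An outdated record represents no pending edge, so dropping it shortens the list and
  changes nothing else of relevance.\<close>

lemma traverse_skip:
  assumes T: "traversing M G v j s" and h: "0 < hr s" and skip: "hr s < est s (edg s (hr s))"
  defines "s' \<equiv> write_i 14 3 (nxt s (hr s)) (write_i 15 0 (edg s (hr s)) s)"
  shows "traversing M G v j s'" "account G v s s'"
    "length (chain (nxt s) (hr s)) = Suc (length (chain (nxt s') (hr s')))" "pending G s' = pending G s"
proof -
  have l: "linked (set (chain (nxt s) (hr s))) M G s" using T by (simp add: traversing_def)
  have nx: "nxt s (hr s) < hr s" using linkedD(4)[OF l h] .
  have ch: "chain (nxt s) (hr s) = hr s # chain (nxt s) (nxt s (hr s))" using chain_pos[of "hr s" "nxt s", OF h nx] .
  have B: "ibank s' b = ibank s b" if "b \<notin> {14, 15}" for b using that by (auto simp: s'_def)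
  have hr: "hr s' = nxt s (hr s)" by (simp add: s'_def)
  have R: "rbank s' = rbank s" by (simp add: s'_def)
  show len: "length (chain (nxt s) (hr s)) = Suc (length (chain (nxt s') (hr s')))"
    by (simp add: ch hr B)
  show pend: "pending G s' = pending G s"
    unfolding pending_def using skip by (auto simp: ch hr B)
  have l': "linked (set (chain (nxt s') (hr s'))) M G s'"
  proof (rule linked_transfer[OF l order_refl])
    show "tables M s'" by (rule tables_cong[OF linkedD(1)[OF l]]) (simp_all add: B R)
    show "r \<in> set (chain (nxt s') (hr s')) \<or> r < est s (edg s r)" if "r \<in> set (chain (nxt s) (hr s))" for r
      using that skip by (auto simp: ch hr B)
  qed (use linkedD(5,12)[OF l] in \<open>auto simp: B\<close>)
  show "traversing M G v j s'"
    unfolding traversing_def pend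
    using T l' nx by (auto simp: traversing_def weighted_def B R ch hr)
  show "account G v s s'"
    unfolding account_def pend by (simp add: B R records_def gap_def stack_set_def cong: if_cong)
qed

text \<open>The new block lies above \<open>alloc s\<close>, hence above the whole detached list.
  The rest of that list is therefore intact, and any further records of the edge in it are now
  outdated, so exactly this edge ceases to be pending.\<close>

lemma traverse_refresh:
  assumes wf: "wf_graph G" and T: "traversing M G v j s" and h: "0 < hr s"
    and valid: "est s (edg s (hr s)) \<le> hr s" and lev: "\<And>u. u < n \<Longrightarrow> lev s u \<le> M"
  shows "run refresh (write_i 15 0 (edg s (hr s)) s) (\<lambda>t s'. t \<le> 800 * f \<and>
     (let s'' = write_i 14 3 (nxt s' (hr s')) s' in traversing M G v j s'' \<and> account G v s s'' \<and>
        length (chain (nxt s) (hr s)) = Suc (length (chain (nxt s'') (hr s''))) \<and>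
        card (pending G s) = Suc (card (pending G s''))))"
proof -
  let ?H = "set (chain (nxt s) (hr s))"
  define e where "e = edg s (hr s)"
  define s1 where "s1 = write_i 15 0 e s"
  have l: "linked ?H M G s" and w: "weighted G s" and hA: "hr s \<le> alloc s"
    and snd: "\<And>r. r \<in> ?H \<Longrightarrow> est s (edg s r) \<le> r \<Longrightarrow> edg s r \<in> inc G v \<and> elv s (edg s r) = j"
    and sync: "\<And>e. e \<in> dom G \<Longrightarrow> e \<notin> pending G s \<Longrightarrow> elv s e = edge_level G (lev s) e"
    and near: "\<And>e. e \<in> pending G s \<Longrightarrow> j \<le> Suc (edge_level G (lev s) e)"
    using T by (auto simp: traversing_def)
  have nx: "nxt s (hr s) < hr s" using linkedD(4)[OF l h] .
  have ch: "chain (nxt s) (hr s) = hr s # chain (nxt s) (nxt s (hr s))" using chain_pos[of "hr s" "nxt s", OF h nx] .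
  have hH: "hr s \<in> ?H" by (simp add: ch)
  have ev: "e \<in> inc G v" and ej: "elv s e = j" using snd[OF hH] valid by (simp_all add: e_def)
  then obtain S where S: "G e = Some S" "v \<in> S" by (auto simp: incident_edges_def)
  have G: "G(e := Some S) = G" using S by auto
  note Sw = wf_edgeD[OF wf S(1)]
  have l1: "linked ?H M G s1"
  proof (rule linked_transfer[OF l order_refl])
    show "tables M s1" by (rule tables_cong[OF linkedD(1)[OF l]]) (simp_all add: s1_def)
  qed (use linkedD(5,12)[OF l] in \<open>auto simp: s1_def\<close>)
  have B1: "ibank s1 b = ibank s b" if "b \<noteq> 15" for b using that by (simp add: s1_def)
  have R1: "rbank s1 = rbank s" by (simp add: s1_def)
  have ep: "e \<in> pending G s" unfolding pending_def using S hH valid by (auto simp: e_def)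
  have run: "run refresh s1 (\<lambda>t s'. linked ?H M (G(e := Some S)) s' \<and> weighted (G(e := Some S)) s' \<and>
     refreshed e S s1 s' \<and> t \<le> 400 * card S + 400)"
  proof (rule run_refresh[OF l1])
    show "er s1 = e" by (simp add: s1_def)
    show "finite (dom G)" using wf by (simp add: wf_graph_def)
    show "est s1 e \<le> eend s1 e" "eend s1 e \<le> Suc (alloc s1)" "bij_betw (node s1) {est s1 e..<eend s1 e} S"
      using linkedD(7,8,9)[OF l S(1)] by (simp_all add: B1)
    show "wgt s1 v = sum (ew s1) (inc (G(e := None)) v) + (if v \<in> S then ew s1 e else 0)" if "v < n" for v
      using weighted_split[OF wf S(1) w that] by (simp add: R1)
    show "ew s1 e' = \<mu> / \<beta> ^ elv s1 e'" if "e' \<in> dom G" for e'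
      using w that by (simp add: weighted_def R1 B1)
    show "lev s1 u \<le> M" if "u \<in> S" for u using lev[of u] that Sw by (auto simp: B1)
  qed (use Sw in auto)
  show ?thesis
    unfolding e_def[symmetric] s1_def[symmetric]
  proof (rule run_mono[OF run], goal_cases)
    case (1 t s')
    then have l': "linked ?H M G s'" and w': "weighted G s'" and r': "refreshed e S s1 s'"
      and t: "t \<le> 400 * card S + 400" by (simp_all only: G)
    note r'' = r'[unfolded refreshed_def]
    have fr: "refresh_frame s1 s'" using r'' by (rule conjunct1)
    have old: "edg s' r = edg s r" "nxt s' r = nxt s r" if "r \<le> alloc s" for r
      using r'' that by (simp_all add: B1)
    have est': "est s' = (est s)(e := Suc (alloc s))" and elv': "elv s' = (elv s)(e := Max (lev s ` S))"
      and al': "alloc s \<le> alloc s'" and rec': "records s' \<le> records s1 + card S"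
      and sp': "sp s' = sp s + card S" and st': "stack_set s' = stack_set s1 \<union> S"
      and wg': "\<And>u. u \<notin> S \<Longrightarrow> wgt s' u = wgt s u"
      and lo': "\<And>u. lo s' u = (if u \<in> S then min (lo s u) (Max (lev s ` S)) else lo s u)"
      using r'' by (simp_all add: B1 R1)
    have rs1: "records s1 = records s" "stack_set s1 = stack_set s" by (simp_all add: records_def stack_set_def B1)
    have F: "lev s' = lev s" "ibank s' 14 = ibank s 14"
      using frame_ibank[OF fr] by (simp_all add: B1)
    define s2 where "s2 = write_i 14 3 (nxt s' (hr s')) s'"
    have B2: "ibank s2 b = ibank s' b" if "b \<noteq> 14" for b using that by (simp add: s2_def)
    have R2: "rbank s2 = rbank s'" by (simp add: s2_def)
    have h2: "hr s2 = nxt s (hr s)" using old(2)[OF hA] by (simp add: s2_def F)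
    have ch2: "chain (nxt s2) (hr s2) = chain (nxt s) (nxt s (hr s))"
      unfolding h2 B2[of 6, simplified] using nx hA old(2) by (intro chain_cong) auto
    have ch2': "chain (nxt s') (hr s2) = chain (nxt s) (nxt s (hr s))"
      using ch2 by (simp add: B2)
    have lvl: "Max (lev s ` S) = edge_level G (lev s) e" by (simp add: edge_level_Some[of G e S, OF S(1)])
    have HA: "r \<le> alloc s" if "r \<in> ?H" for r using set_chain_bounds[OF that] hA by simp
    have pend: "pending G s2 = pending G s - {e}"
    proof (intro equalityI subsetI)
      fix e' assume "e' \<in> pending G s2"
      then obtain r where r: "r \<in> set (chain (nxt s) (nxt s (hr s)))" "edg s' r = e'" "est s' e' \<le> r" "e' \<in> dom G"
        by (auto simp: pending_def ch2' B2)
      then have rH: "r \<in> ?H" by (simp add: ch)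
      have "e' \<noteq> e" using r(3) HA[OF rH] by (auto simp: est')
      then show "e' \<in> pending G s - {e}" using r rH old(1)[OF HA[OF rH]] by (auto simp: pending_def est')
    next
      fix e' assume e': "e' \<in> pending G s - {e}"
      then obtain r where r: "r \<in> ?H" "edg s r = e'" "est s e' \<le> r" "e' \<in> dom G" by (auto simp: pending_def)
      then have "r \<in> set (chain (nxt s) (nxt s (hr s)))" using e' by (auto simp: ch e_def)
      then show "e' \<in> pending G s2" using r e' old(1)[OF HA[OF r(1)]] by (auto simp: pending_def ch2' B2 est')
    qed
    have finp: "finite (pending G s)"
      using wf finite_subset[of "pending G s" "dom G"] by (auto simp: wf_graph_def pending_def)
    have card: "card (pending G s) = Suc (card (pending G s2))"
      unfolding pend using card.remove[OF finp ep] .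
    have l2: "linked (set (chain (nxt s2) (hr s2))) M G s2"
    proof (rule linked_transfer[OF l' order_refl])
      show "tables M s2" by (rule tables_cong[OF linkedD(1)[OF l']]) (simp_all add: B2 R2)
      show "r \<in> set (chain (nxt s2) (hr s2)) \<or> r < est s' (edg s' r)" if "r \<in> ?H" for r
        using that old(1)[OF hA] hA by (auto simp: ch ch2 est' e_def)
    qed (use linkedD(5,12)[OF l'] in \<open>auto simp: B2\<close>)
    have T2: "traversing M G v j s2"
      unfolding traversing_def pend
    proof (intro conjI ballI impI)
      show "weighted G s2" using w' by (simp add: weighted_def B2 R2)
      show "hr s2 \<le> alloc s2" using h2 nx hA al' by (simp add: B2)
      fix r assume r: "r \<in> set (chain (nxt s2) (hr s2))" "est s2 (edg s2 r) \<le> r"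
      then have rH: "r \<in> ?H" by (simp add: ch ch2)
      have eq: "edg s2 r = edg s r" using old(1)[OF HA[OF rH]] by (simp add: B2)
      have ne: "edg s r \<noteq> e" using r(2) HA[OF rH] unfolding eq by (auto simp: est' B2)
      then have "est s (edg s r) \<le> r" using r(2) unfolding eq by (simp add: est' B2)
      from snd[OF rH this] show "edg s2 r \<in> inc G v" "elv s2 (edg s2 r) = j"
        unfolding eq using ne by (simp_all add: elv' B2)
    next
      fix e' assume e': "e' \<in> dom G - (pending G s - {e})"
      then show "elv s2 e' = edge_level G (lev s2) e'"
        using sync[of e'] by (cases "e' = e") (simp_all add: B2 F elv' lvl)
    next
      fix e' assume "e' \<in> pending G s - {e}"
      then show "j \<le> Suc (edge_level G (lev s2) e')" using near[of e'] by (simp add: B2 F)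
    qed (rule l2)
    \<comment> \<open>Before, \<open>lo s u\<close> was at most the old level \<open>j\<close>, and
      the new level is at least \<open>j - 1\<close>; so the pointer of an endpoint falls by at most
      one.\<close>
    have gp: "gap G s2 \<le> gap G s + card S * 1"
    proof (rule gap_le[OF Sw(3)])
      fix u assume "u < n"
      have "lo s u \<le> Suc (Max (lev s ` S))" if "u \<in> S"
        using linkedD(12)[OF l S(1) that] near[OF ep] ej lvl by simp
      then show "(if inc G u = {} then 0 else L - lo s2 u)
        \<le> (if inc G u = {} then 0 else L - lo s u) + (if u \<in> S then 1 else 0)"
        by (auto simp: B2 lo' min_def)
    qed
    have r2: "records s2 = records s'" "stack_set s2 = stack_set s'" by (simp_all add: records_def stack_set_def B2)
    have A2: "account G v s s2"
      unfolding account_def card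
    proof (intro conjI allI impI)
      show "records s2 + f * card (pending G s2) \<le> records s + f * Suc (card (pending G s2))"
        using rec' Sw(4) by (simp add: r2 rs1)
      show "sp s2 + f * card (pending G s2) \<le> sp s + f * Suc (card (pending G s2))"
        using sp' Sw(4) by (simp add: B2)
      show "gap G s2 + f * card (pending G s2) \<le> gap G s + f * Suc (card (pending G s2))"
        using gp Sw(4) by simp
      show "wgt s2 u = wgt s u" if "u \<notin> stack_set s2" for u
        using wg'[of u] that st' by (simp add: R2 r2)
    qed (use S st' in \<open>auto simp: B2 F pend r2 rs1\<close>)
    have "1 \<le> card S" using Sw by (simp add: Suc_le_eq card_gt_0_iff)
    then have "t \<le> 800 * f" using t Sw(4) by linarith
    then show ?case
      unfolding s2_def[symmetric] Let_def using T2 A2 card by (simp add: ch ch2)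
  qed
qed

lemma run_traverse:
  assumes wf: "wf_graph G" and T: "traversing M G v j s" and lev: "\<And>u. u < n \<Longrightarrow> lev s u \<le> M"
  shows "run traverse s (\<lambda>t s'. traversing M G v j s' \<and> hr s' = 0 \<and> account G v s s' \<and>
    t \<le> 100 * length (chain (nxt s) (hr s)) + 900 * f * card (pending G s) + 10)"
proof -
  define I where "I s' \<longleftrightarrow> traversing M G v j s' \<and> account G v s s'" for s'
  define V where "V s' = 100 * length (chain (nxt s') (hr s')) + 900 * f * card (pending G s')" for s'
  have "run traverse s (\<lambda>t s'. I s' \<and> \<not> bval (ILess (INum 0) xH) s' \<and> t + V s' \<le> V s + (1 + bcost (ILess (INum 0) xH)))"
    unfolding traverse_def
  proof (rule run_While_nat, goal_cases)
    case 1
    show ?case using T by (simp add: I_def account_def)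
  next
    case (2 s1)
    then have h: "0 < hr s1" and T1: "traversing M G v j s1" and A1: "account G v s s1"
      by (simp_all add: I_def)
    have lev1: "\<And>u. u < n \<Longrightarrow> lev s1 u \<le> M" using A1 lev by (simp add: account_def)
    show ?case
    proof (cases "hr s1 < est s1 (edg s1 (hr s1))")
      case True
      note sk = traverse_skip[OF T1 h True]
      show ?thesis using True sk account_trans[OF A1 sk(2)] by (simp add: run_simps I_def V_def)
    next
      case False
      then have "est s1 (edg s1 (hr s1)) \<le> hr s1" by simp
      from traverse_refresh[OF wf T1 h this lev1] obtain t s2 where
        x: "exec refresh (write_i 15 0 (edg s1 (hr s1)) s1) t s2" and t: "t \<le> 800 * f" and
        T2: "traversing M G v j (write_i 14 3 (nxt s2 (hr s2)) s2)" and
        A2: "account G v s1 (write_i 14 3 (nxt s2 (hr s2)) s2)" and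
        len: "length (chain (nxt s1) (hr s1)) = Suc (length (chain (nxt s2) (nxt s2 (hr s2))))" and
        card: "card (pending G s1) = Suc (card (pending G (write_i 14 3 (nxt s2 (hr s2)) s2)))"
        unfolding run_def Let_def by auto
      have I2: "I (write_i 14 3 (nxt s2 (hr s2)) s2)" using T2 account_trans[OF A1 A2] by (simp add: I_def)
      have V2: "V (write_i 14 3 (nxt s2 (hr s2)) s2) + t + 100 \<le> V s1"
        using t f_pos by (simp add: V_def len card)
      have nb: "\<not> bval (ILess xH (ICell 8 xE)) (write_i 15 0 (edg s1 (hr s1)) s1)" using False by simp
      show ?thesis
        unfolding run_Seq run_ISet run_Cond ival.simps if_not_P[OF nb]
        by (rule runI[OF x]) (use I2 V2 in simp)
    qed
  qed
  then show ?thesis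
    by (rule run_mono) (auto simp: I_def V_def)
qed

end

section \<open>Restoring the invariant\<close>

abbreviation "rOne \<equiv> ROfNat (INum 1)"
abbreviation "rF \<equiv> ROfNat (ICell 0 (INum 2))"
abbreviation "rEps \<equiv> RCell 0 (INum 0)"
abbreviation "rBeta \<equiv> RAdd rOne rEps"
abbreviation "rAlpha \<equiv> RAdd (RAdd rOne (RDiv rOne rF)) (RMul (ROfNat (INum 3)) rEps)"

text \<open>The entries for level \<open>j + 1\<close> are computed from those for \<open>j\<close>;
  if they exist already, the same values are written again. Storing \<open>j\<close> in the pointer
  of \<open>v\<close> is sound because the scan has found no edge of a lower level.\<close>

definition raise :: com where
  "raise =
     (ISet 14 (INum (Suc 0)) (ICell 10 xV) ;;
      scan ;;
      ISet 10 xV xJ ;;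
      ISet 14 (INum 2) (IAdd xJ (INum 1)) ;;
      ISet 12 xNEW (IAdd (ICell 12 xJ) (ICell 0 (INum 0))) ;;
      RSet 3 xNEW (RDiv (RCell 3 xJ) rBeta) ;;
      move)"

definition sink :: com where
  "sink =
     (ISet 14 (INum (Suc 0)) (ICell 2 xV) ;;
      clean ;;
      Cond (ILess (INum 0) (ICell 7 xBKT)) (ISet 14 (INum 2) (ISub xJ (INum 1))) (ISet 14 (INum 2) (INum 0)) ;;
      move)"

definition process :: com where
  "process = Cond (RLess (RCell 1 xV) (RCell 2 xV)) raise
     (Cond (BAnd (ILess (INum 0) (ICell 2 xV))
         (RLess (RCell 2 xV) (RDiv (RCell 1 xV) (RMul (RMul rF rAlpha) rBeta))))
       sink Skip)"

definition main_loop :: com where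
  "main_loop = While (ILess (INum 0) xSP)
     (ISet 14 (INum 0) (ICell 11 xSP) ;; ISet 3 (INum (Suc 0)) (ISub xSP (INum 1)) ;; process)"

context instance_params begin

definition settled :: "nat \<Rightarrow> hypergraph \<Rightarrow> store \<Rightarrow> bool" where
  "settled M G s \<longleftrightarrow> linked {} M G s \<and> weighted G s \<and> (\<forall>u<n. lev s u \<le> M) \<and>
     (\<forall>e\<in>dom G. elv s e = edge_level G (lev s) e)"

lemma settled_weight:
  assumes "settled M G s" "v < n"
  shows "wgt s v = W G (lev s) v"
proof -
  have "ew s e = edge_weight \<beta> \<mu> G (lev s) e" if "e \<in> inc G v" for e
  proof -
    have "e \<in> dom G" using that incident_subset_dom by blast
    then show ?thesis using assms(1) by (simp add: settled_def weighted_def edge_weight_def)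
  qed
  then show ?thesis using assms by (auto simp: settled_def weighted_def node_weight_def)
qed

definition moved ::
  "nat \<Rightarrow> hypergraph \<Rightarrow> nat \<Rightarrow> nat \<Rightarrow> nat set \<Rightarrow> store \<Rightarrow> nat \<Rightarrow> store \<Rightarrow> bool" where
  "moved M G v x F s t s' \<longleftrightarrow> settled M G s' \<and> lev s' = (lev s)(v := x) \<and>
     t + 100 * records s' \<le> 100 * records s + 1000 * (f * card F) + 100 \<and>
     sp s' \<le> sp s + f * card F \<and> gap G s' \<le> gap G s + f * card F \<and>
     stack_set s \<subseteq> stack_set s' \<and> (\<forall>u. u \<notin> stack_set s' \<longrightarrow> wgt s' u = wgt s u) \<and>
     (F \<noteq> {} \<longrightarrow> v \<in> stack_set s')"

text \<open>Traversing one bucket brings all recorded levels up to date because, by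
  \<open>keep\<close>, the edges at \<open>v\<close> outside it retain their levels. The hypothesis
  \<open>near\<close> limits the fall of the others to one level, as the pointers \<open>lo\<close>
  require.\<close>

lemma run_move:
  assumes wf: "wf_graph G" and st: "settled M G s" and v: "vr s = v" "v < n"
    and j: "jr s = j" "j \<le> M" and x: "newr s = x" "x \<le> M" and M: "M \<le> L"
    and keep: "\<And>e. e \<in> inc G v \<Longrightarrow> edge_level G (lev s) e \<noteq> j \<Longrightarrow>
      edge_level G ((lev s)(v := x)) e = edge_level G (lev s) e"
    and near: "\<And>e. e \<in> inc G v \<Longrightarrow> edge_level G (lev s) e = j \<Longrightarrow>
      j \<le> Suc (edge_level G ((lev s)(v := x)) e)"
  defines "F \<equiv> {e \<in> inc G v. edge_level G (lev s) e = j}"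
  shows "run move s (moved M G v x F s)"
proof -
  let ?a = "v + n * j"
  have l: "linked {} M G s" and w: "weighted G s" and lev: "\<And>u. u < n \<Longrightarrow> lev s u \<le> M"
    and sync: "\<And>e. e \<in> dom G \<Longrightarrow> elv s e = edge_level G (lev s) e"
    using st by (auto simp: settled_def)
  have off: "off s j = n * j" using linkedD(1)[OF l] j by (auto simp: tables_def)
  define s1 where "s1 = write_i 7 ?a 0 (write_i 14 3 (head s ?a) (write_i 2 v x s))"
  have B: "ibank s1 b = ibank s b" if "b \<notin> {2, 7, 14}" for b using that by (auto simp: s1_def)
  have R: "rbank s1 = rbank s" by (simp add: s1_def)
  have lev1: "lev s1 = (lev s)(v := x)" and h1: "hr s1 = head s ?a" and hd1: "head s1 = (head s)(?a := 0)"
    by (simp_all add: s1_def)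
  let ?H = "set (chain (nxt s) (head s ?a))"
  have l1: "linked ?H M G s1"
  proof (rule linked_transfer[OF l order_refl])
    show "tables M s1" by (rule tables_cong[OF linkedD(1)[OF l]]) (simp_all add: B R)
  qed (use linkedD(5,12)[OF l] in \<open>auto simp: B hd1\<close>)
  have dom: "e \<in> dom G" if "e \<in> inc G v" for e using that incident_subset_dom by blast
  \<comment> \<open>Up-to-date records in the bucket belong to edges of level \<open>j\<close> at
    \<open>v\<close>, and every such edge has a record there.\<close>
  have pend: "pending G s1 = F"
  proof (intro equalityI subsetI)
    fix e assume "e \<in> pending G s1"
    then obtain r where r: "r \<in> ?H" "edg s r = e" "est s e \<le> r" by (auto simp: pending_def B h1)
    note S = linked_sound[OF l v(2) r(1), unfolded r(2), OF r(3)]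
    have "e \<in> inc G v" using linked_incident[OF l, of r] r S by simp
    then show "e \<in> F" using S(4) sync[OF S(1)] by (simp add: F_def)
  next
    fix e assume e: "e \<in> F"
    then have ei: "e \<in> inc G v" and ej: "elv s e = j" using sync dom by (auto simp: F_def)
    obtain r where "est s e \<le> r" "edg s r = e" "r \<in> set (chain (nxt s) (head s (v + n * elv s e)))"
      using linked_record_of[OF l ei] by blast
    then show "e \<in> pending G s1" using dom[OF ei] by (auto simp: pending_def B h1 ej)
  qed
  have T: "traversing M G v j s1"
    unfolding traversing_def pend
  proof (intro conjI ballI impI)
    show "linked (set (chain (nxt s1) (hr s1))) M G s1" using l1 by (simp add: B h1)
    show "weighted G s1" using w by (simp add: weighted_def B R)
    show "hr s1 \<le> alloc s1" using linkedD(5)[OF l] by (simp add: B h1)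
    fix r assume "r \<in> set (chain (nxt s1) (hr s1))" "est s1 (edg s1 r) \<le> r"
    then have r: "r \<in> ?H" "est s (edg s r) \<le> r" by (simp_all add: B h1)
    note S = linked_sound[OF l v(2) r]
    show "edg s1 r \<in> inc G v" "elv s1 (edg s1 r) = j"
      using linked_incident[OF l S(1) r(2) S(2)] S by (simp_all add: B)
  next
    fix e assume e: "e \<in> dom G - F"
    show "elv s1 e = edge_level G (lev s1) e"
      using e sync[of e] keep[of e] edge_level_other[of e G v "lev s" x]
      by (cases "e \<in> inc G v") (auto simp: F_def B lev1)
  next
    fix e assume "e \<in> F"
    then show "j \<le> Suc (edge_level G (lev s1) e)" using near[of e] by (simp add: F_def lev1)
  qed
  have rec: "records s1 + length (chain (nxt s) (head s ?a)) = records s"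
    using records_head_upd[of ?a s1 s 0] bucket_address[OF v(2), of j] j M by (simp add: B hd1)
  have lev1': "lev s1 u \<le> M" if "u < n" for u using lev[OF that] x by (simp add: lev1)
  have same: "stack_set s1 = stack_set s" "gap G s1 = gap G s"
    by (simp_all add: stack_set_def gap_def B cong: if_cong)
  from run_traverse[OF wf T lev1'] obtain t s2 where
    x2: "exec traverse s1 t s2" and T2: "traversing M G v j s2" and h2: "hr s2 = 0" and A: "account G v s1 s2"
    and t: "t \<le> 100 * length (chain (nxt s1) (hr s1)) + 900 * f * card (pending G s1) + 10"
    unfolding run_def by blast
  have p2: "pending G s2 = {}" by (simp add: pending_def h2)
  note A' = A[unfolded account_def p2 pend]
  have lev2: "lev s2 = (lev s)(v := x)" using A' lev1 by simp
  have "settled M G s2"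
    unfolding settled_def using T2 lev1' by (auto simp: traversing_def h2 p2 lev2 lev1)
  moreover have "sp s2 \<le> sp s + f * card F" "gap G s2 \<le> gap G s + f * card F"
    "records s2 \<le> records s1 + f * card F" using A' by (simp_all add: B same)
  moreover have "stack_set s \<subseteq> stack_set s2" using A' by (simp add: same)
  moreover have "wgt s2 u = wgt s u" if "u \<notin> stack_set s2" for u using A' that by (simp add: R)
  moreover have "v \<in> stack_set s2" if "F \<noteq> {}" using A' that by auto
  moreover have "t + 90 + 100 * records s2 \<le> 100 * records s + 1000 * (f * card F) + 100"
    using t rec \<open>records s2 \<le> _\<close> by (simp add: B h1 pend)
  ultimately show ?thesis
    unfolding move_def moved_def
    apply (simp add: run_simps v j x off s1_def[symmetric])
    apply (rule runI[OF x2])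
    using lev2 by simp
qed

definition calm :: "store \<Rightarrow> nat \<Rightarrow> bool" where
  "calm s u \<longleftrightarrow> wgt s u \<le> c u \<and> (0 < lev s u \<longrightarrow> c_star \<alpha> \<beta> f c u \<le> wgt s u)"

text \<open>The set \<open>X\<close> is for the node just popped, which may violate its bounds
  without being on the stack.\<close>

definition state_ok :: "nat set \<Rightarrow> hypergraph \<Rightarrow> store \<Rightarrow> bool" where
  "state_ok X G s \<longleftrightarrow> (\<exists>M\<le>L. settled M G s) \<and> (\<forall>u<n. u \<notin> stack_set s \<longrightarrow> u \<notin> X \<longrightarrow> calm s u)"

text \<open>Each summand prepays one kind of work: the level potential the refreshing of the edges
  of a bucket, a record its removal, a stack entry one call of \<open>process\<close>, a unit of
  \<open>gap\<close> one step of a scan. Moving a bucket \<open>F\<close> adds up to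
  \<open>f * card F\<close> to each of the last three, which costs 100, 2000 and 200 per unit; the
  factor 5000 covers this and the running time of the move.\<close>

definition pot :: "hypergraph \<Rightarrow> store \<Rightarrow> real" where
  "pot G s = 5000 * real f * (level_pot G (lev s) / \<epsilon>) + 100 * real (records s) + 2000 * real (sp s)
     + 200 * real (gap G s)"

lemma pot_nonneg:
  assumes "wf_graph G" "state_ok X G s"
  shows "0 \<le> pot G s"
proof -
  have "lev s u \<le> L" if "u < n" for u
    using assms(2) that by (force simp: state_ok_def settled_def)
  then have "0 \<le> level_pot G (lev s)" using level_pot_nonneg[OF assms(1)] by blast
  then show ?thesis using eps_pos by (simp add: pot_def)
qed

lemma settled_transfer:
  assumes st: "settled M G s" and "M \<le> M'" "tables M' s'"
    and same: "\<And>b. b \<in> {2, 3, 4, 5, 6, 7, 8, 9, 11, 13} \<Longrightarrow> ibank s' b = ibank s b"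
      "\<And>b. b \<in> {2, 4} \<Longrightarrow> rbank s' b = rbank s b"
    and lo: "\<And>e v. e \<in> inc G v \<Longrightarrow> lo s' v \<le> elv s e"
  shows "settled M' G s'"
proof -
  have l: "linked {} M G s" using st by (simp add: settled_def)
  have "linked {} M' G s'"
    by (rule linked_transfer[OF l assms(2,3)])
      (use same linkedD(5)[OF l] lo in \<open>auto simp: incident_edges_def\<close>)
  then show ?thesis
    using st same assms(2) by (auto simp: settled_def weighted_def intro: order_trans)
qed

lemma settled_lo: "settled M G s \<Longrightarrow> e \<in> inc G v \<Longrightarrow> lo s v \<le> elv s e"
  using linkedD(12)[of "{}" M G s e] by (auto simp: settled_def incident_edges_def)

lemma settled_frame:
  assumes st: "settled M G s" and fr: "frame {1, 14, 15, 16} {5} s s'"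
  shows "settled M G s'"
proof (rule settled_transfer[OF st order_refl])
  note F = frame_ibank[OF fr] frame_rbank[OF fr]
  have "tables M s" using st by (simp add: settled_def linked_def)
  then show "tables M s'" by (rule tables_cong) (use F in simp_all)
  show "lo s' v \<le> elv s e" if "e \<in> inc G v" for e v
    using settled_lo[OF st that] F by simp
qed (use frame_ibank[OF fr] frame_rbank[OF fr] in auto)

lemma pot_drop:
  assumes "level_pot G l' + \<epsilon> * real k \<le> level_pot G l"
  shows "5000 * real f * (level_pot G l' / \<epsilon>) + 5000 * real (f * k) \<le> 5000 * real f * (level_pot G l / \<epsilon>)"
proof -
  have "level_pot G l' / \<epsilon> + real k \<le> level_pot G l / \<epsilon>"
    using divide_right_mono[OF assms, of \<epsilon>] eps_pos by (simp add: add_divide_distrib)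
  from mult_left_mono[OF this, of "5000 * real f"] show ?thesis by (simp add: algebra_simps)
qed

text \<open>What the scan spends on climbing from \<open>lo s v\<close> to \<open>j\<close> is
  returned by \<open>gap\<close>, since the pointer is then set to \<open>j\<close>. Moving the
  bucket is paid for by the drop in \<open>level_up\<close>.\<close>

lemma run_raise:
  assumes wf: "wf_graph G" and ok: "state_ok {v} G s" and v: "vr s = v" "v < n" and dirty: "c v < wgt s v"
  shows "run raise s (\<lambda>t s'. state_ok {} G s' \<and> real t + pot G s' \<le> pot G s + 1400)"
proof -
  obtain M where M: "M \<le> L" and st: "settled M G s" using ok by (auto simp: state_ok_def)
  have l: "linked {} M G s" and sync: "\<And>e. e \<in> dom G \<Longrightarrow> elv s e = edge_level G (lev s) e"
    using st by (auto simp: settled_def)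
  have dW: "c v < W G (lev s) v" using dirty settled_weight[OF st v(2)] by simp
  have ne: "inc G v \<noteq> {}" using dW c_pos[OF v(2)] by (auto simp: node_weight_def)
  have dom: "e \<in> dom G" if "e \<in> inc G v" for e using that incident_subset_dom by blast
  define s1 where "s1 = write_i 14 (Suc 0) (lo s v) s"
  have fr1: "frame {14} {} s s1" by (auto simp: s1_def frame_def)
  have st1: "settled M G s1" by (rule settled_frame[OF st frame_weaken[OF fr1]]) auto
  have l1: "linked {} M G s1" using st1 by (simp add: settled_def)
  have B1: "ibank s1 b = ibank s b" if "b \<noteq> 14" for b using that by (simp add: s1_def)
  have R1: "rbank s1 = rbank s" by (simp add: s1_def)
  have v1: "vr s1 = v" and j1: "jr s1 = lo s v" using v by (simp_all add: s1_def)
  have "jr s1 \<le> elv s1 e" if "e \<in> inc G v" for e using settled_lo[OF st that] by (simp add: j1 B1)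
  from run_scan[OF l1 v1 v(2) M this ne] obtain t2 s2 where x2: "exec scan s1 t2 s2" and fr2: "frame {7, 14} {} s1 s2" and v2: "vr s2 = v"
    and l2: "linked {} M G s2" and lo2: "lo s v \<le> jr s2" and min: "\<And>e. e \<in> inc G v \<Longrightarrow> jr s2 \<le> elv s e"
    and ex: "\<exists>e\<in>inc G v. elv s e = jr s2"
    and t2: "t2 + 100 * records s2 \<le> 100 * records s + 200 * (jr s2 - lo s v) + 300"
    unfolding run_def by (auto simp: j1 B1 records_def)
  define j where "j = jr s2"
  have B2: "ibank s2 b = ibank s b" if "b \<notin> {7, 14}" for b using frame_ibank[OF fr2 that] B1 that by simp
  have R2: "rbank s2 = rbank s" using frame_rbank[OF fr2] R1 by auto
  obtain e0 where e0: "e0 \<in> inc G v" "edge_level G (lev s) e0 = j" using ex sync dom by (auto simp: j_def)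
  have minl: "j \<le> edge_level G (lev s) e" if "e \<in> inc G v" for e
    using min[OF that] sync[OF dom[OF that]] by (simp add: j_def)
  have jL: "Suc j \<le> L" by (rule level_bound[OF wf v(2) dW minl])
  have jM: "j \<le> M" using linkedD(3)[OF l dom[OF e0(1)]] sync[OF dom[OF e0(1)]] e0(2) by simp
  \<comment> \<open>The level \<open>j + 1\<close> may be new; it is at most \<open>L\<close> by
    \<open>level_bound\<close>, so the larger range of levels is still admissible.\<close>
  define M' where "M' = max M (Suc j)"
  have M': "M \<le> M'" "Suc j \<le> M'" "j \<le> M'" "M' \<le> L" using M jL by (auto simp: M'_def)
  have tb: "tables M s2" using linkedD(1)[OF l2] .
  have tbj: "off s2 j = n * j" "tab s2 j = \<mu> / \<beta> ^ j" "rbank s2 0 0 = \<epsilon>" "ibank s2 0 0 = n"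
    using tb jM by (auto simp: tables_def)
  define s3 where "s3 = write_r 3 (Suc j) (\<mu> / (\<beta> ^ j * (1 + \<epsilon>))) (write_i 12 (Suc j) (n * j + n)
      (write_i 14 2 (Suc j) (write_i 10 v j s2)))"
  have B3: "ibank s3 b = ibank s2 b" if "b \<notin> {10, 12, 14}" for b using that by (auto simp: s3_def)
  have R3: "rbank s3 b = rbank s b" if "b \<noteq> 3" for b using that R2 by (simp add: s3_def)
  have lo3: "lo s3 = (lo s)(v := j)" using B2 by (simp add: s3_def)
  have st2: "settled M G s2"
    unfolding settled_def using l2 st B2 R2 by (auto simp: settled_def weighted_def)
  have st3: "settled M' G s3"
  proof (rule settled_transfer[OF st2 M'(1)])
    have "off s3 k = n * k \<and> tab s3 k = \<mu> / \<beta> ^ k" if "k \<le> M'" for k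
    proof (cases "k = Suc j")
      case True
      then show ?thesis by (simp add: s3_def beta_eq mult.commute)
    next
      case False
      then have "k \<le> M" using that jM by (auto simp: M'_def)
      then show ?thesis using tb False by (simp add: s3_def tables_def)
    qed
    then show "tables M' s3" using tb B3 R3 R2 by (simp add: tables_def)
    show "lo s3 u \<le> elv s2 e" if "e \<in> inc G u" for e u
      using settled_lo[OF st that] min[of e] that by (auto simp: lo3 B2 j_def)
  qed (use B3 R3 R2 in auto)
  have lev3: "lev s3 = lev s" using B3 B2 by simp
  have rec3: "records s3 = records s2" using B3 by (simp add: records_def)
  have gap3: "gap G s3 + (j - lo s v) = gap G s"
  proof -
    have "gap G s = (L - lo s v) + (\<Sum>u\<in>{..<n} - {v}. if inc G u = {} then 0 else L - lo s u)"
      unfolding gap_def using v ne by (subst sum.remove[of _ v]) auto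
    moreover have "gap G s3 = (L - j) + (\<Sum>u\<in>{..<n} - {v}. if inc G u = {} then 0 else L - lo s u)"
      unfolding gap_def using v ne by (subst sum.remove[of _ v]) (auto simp: lo3 intro!: sum.cong if_cong)
    ultimately show ?thesis using lo2 jL by (simp add: j_def)
  qed
  have stk3: "stack_set s3 = stack_set s" "sp s3 = sp s" using B3 B2 by (simp_all add: stack_set_def)
  define F where "F = {e \<in> inc G v. edge_level G (lev s) e = j}"
  have lvle: "lev s v \<le> Suc j" using level_le_edge_level[OF wf e0(1), of "lev s"] e0(2) by simp
  have raise: "edge_level G ((lev s)(v := Suc j)) e = max (Suc j) (edge_level G (lev s) e)"
    if "e \<in> inc G v" for e
    by (rule edge_level_raise[of G e v "lev s" "Suc j", OF wf that lvle])
  have "run move s3 (moved M' G v (Suc j) {e \<in> inc G v. edge_level G (lev s3) e = j} s3)"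
  proof (rule run_move[OF wf st3 _ v(2) _ M'(3) _ M'(2) M'(4)])
    show "vr s3 = v" "jr s3 = j" "newr s3 = Suc j" using v2 by (simp_all add: s3_def j_def)
    show "edge_level G ((lev s3)(v := Suc j)) e = edge_level G (lev s3) e"
      if "e \<in> inc G v" "edge_level G (lev s3) e \<noteq> j" for e
      using raise[OF that(1)] minl[OF that(1)] that(2) by (simp add: lev3)
    show "j \<le> Suc (edge_level G ((lev s3)(v := Suc j)) e)" if "e \<in> inc G v" for e
      using raise[OF that] by (simp add: lev3)
  qed
  then obtain t4 s4 where x4: "exec move s3 t4 s4" and st4: "settled M' G s4" and lev4: "lev s4 = (lev s)(v := Suc j)"
    and t4: "t4 + 100 * records s4 \<le> 100 * records s2 + 1000 * (f * card F) + 100"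
    and sp4: "sp s4 \<le> sp s + f * card F" and gap4: "gap G s4 \<le> gap G s3 + f * card F"
    and stk4: "stack_set s \<subseteq> stack_set s4" and w4: "\<And>u. u \<notin> stack_set s4 \<Longrightarrow> wgt s4 u = wgt s u"
    and vF: "F \<noteq> {} \<Longrightarrow> v \<in> stack_set s4"
    unfolding run_def moved_def lev3 rec3 stk3 F_def[symmetric] using R3 by auto
  have e0F: "e0 \<in> F" using e0 by (simp add: F_def)
  have finF: "finite F" using wf_finite_incident[OF wf, of v] by (simp add: F_def)
  \<comment> \<open>The bucket was not empty, so \<open>v\<close> has been pushed again and need not
    be calm.\<close>
  have "calm s4 u" if u: "u < n" "u \<notin> stack_set s4" for u
  proof -
    have "u \<noteq> v" using vF e0F u by auto
    moreover have "u \<notin> stack_set s" using stk4 u by auto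
    ultimately have "calm s u" using ok u by (simp add: state_ok_def)
    then show ?thesis using w4[OF u(2)] \<open>u \<noteq> v\<close> by (simp add: calm_def lev4)
  qed
  then have ok4: "state_ok {} G s4" using st4 M'(4) by (auto simp: state_ok_def)
  have "card F \<noteq> 0" using e0F finF by auto
  then have "1 \<le> f * card F" using f_pos by simp
  then have k1: "1 \<le> real (f * card F)" by (metis of_nat_1 of_nat_le_iff)
  have P: "5000 * real f * (level_pot G (lev s4) / \<epsilon>) + 5000 * real (f * card F) \<le> 5000 * real f * (level_pot G (lev s) / \<epsilon>)"
    unfolding lev4 F_def by (rule pot_drop) (rule level_up[OF wf v(2) dW minl e0])
  have "real t2 + 100 * real (records s2) \<le> 100 * real (records s) + 200 * real (j - lo s v) + 300"
    using t2 unfolding j_def[symmetric] by linarith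
  moreover have "real t4 + 100 * real (records s4) \<le> 100 * real (records s2) + 1000 * real (f * card F) + 100"
    using t4 by linarith
  moreover have "real (sp s4) \<le> real (sp s) + real (f * card F)" using sp4 by linarith
  moreover have "real (gap G s4) + real (j - lo s v) \<le> real (gap G s) + real (f * card F)"
    using gap4 gap3 by linarith
  ultimately have "real (t2 + t4) + pot G s4 \<le> pot G s + 400"
    unfolding pot_def using P k1 by linarith
  then show ?thesis
    unfolding raise_def
    apply (simp add: run_simps v s1_def[symmetric])
    apply (rule runI[OF x2])
    apply (simp add: run_simps v2 j_def[symmetric] tbj s3_def[symmetric])
    apply (rule runI[OF x4])
    using ok4 by simp
qed

text \<open>The scanning pointer is not involved: the bucket to process is the one at the level of
  \<open>v\<close> itself, and one cleaning decides whether it contains an edge.\<close>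

lemma run_sink:
  assumes wf: "wf_graph G" and ok: "state_ok {v} G s" and v: "vr s = v" "v < n"
    and dirty: "wgt s v < c_star \<alpha> \<beta> f c v" "0 < lev s v"
  shows "run sink s (\<lambda>t s'. state_ok {} G s' \<and> real t + pot G s' \<le> pot G s + 1400)"
proof -
  obtain M where M: "M \<le> L" and st: "settled M G s" using ok by (auto simp: state_ok_def)
  have l: "linked {} M G s" and sync: "\<And>e. e \<in> dom G \<Longrightarrow> elv s e = edge_level G (lev s) e"
    using st by (auto simp: settled_def)
  have dW: "W G (lev s) v < c_star \<alpha> \<beta> f c v" using dirty settled_weight[OF st v(2)] by simp
  have dom: "e \<in> dom G" if "e \<in> inc G v" for e using that incident_subset_dom by blast
  define j where "j = lev s v"
  have jM: "j \<le> M" using st v by (auto simp: settled_def j_def)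
  define s1 where "s1 = write_i 14 (Suc 0) j s"
  have fr1: "frame {14} {} s s1" by (auto simp: s1_def frame_def)
  have st1: "settled M G s1" by (rule settled_frame[OF st frame_weaken[OF fr1]]) auto
  have l1: "linked {} M G s1" using st1 by (simp add: settled_def)
  have B1: "ibank s1 b = ibank s b" if "b \<noteq> 14" for b using that by (simp add: s1_def)
  have R1: "rbank s1 = rbank s" by (simp add: s1_def)
  have v1: "vr s1 = v" and j1: "jr s1 = j" using v by (simp_all add: s1_def)
  have v1n: "vr s1 < n" and j1M: "jr s1 \<le> M" using v1 v j1 jM by simp_all
  from run_clean[OF l1 v1n j1M M] obtain t2 s2 where x2: "exec clean s1 t2 s2" and fr2: "frame {7} {} s1 s2"
    and l2: "linked {} M G s2"
    and top: "0 < head s2 (v + n * j) \<Longrightarrow> est s (edg s (head s2 (v + n * j))) \<le> head s2 (v + n * j)"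
    and t2: "t2 + 100 * records s2 \<le> 100 * records s + 100"
    unfolding run_def v1 j1 by (auto simp: B1 records_def)
  have B2: "ibank s2 b = ibank s b" if "b \<notin> {7, 14}" for b using frame_ibank[OF fr2, of b] B1 that by simp
  have R2: "rbank s2 = rbank s" using frame_rbank[OF fr2] R1 by auto
  have v2: "vr s2 = v" "jr s2 = j" using frame_ibank[OF fr2, of 14] v1 j1 by simp_all
  have off2: "off s2 j = n * j" using linkedD(1)[OF l2] jM by (auto simp: tables_def)
  define F where "F = {e \<in> inc G v. edge_level G (lev s) e = j}"
  have finF: "finite F" using wf_finite_incident[OF wf, of v] by (simp add: F_def)
  \<comment> \<open>After cleaning, the head is 0 or an up-to-date record of an edge of level
    \<open>j\<close> at \<open>v\<close>. This justifies the test that chooses between the two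
    target levels.\<close>
  have empty: "0 < head s2 (v + n * j) \<longleftrightarrow> F \<noteq> {}"
  proof
    let ?h = "head s2 (v + n * j)"
    assume h: "0 < ?h"
    then have hc: "?h \<in> set (chain (nxt s2) ?h)" by (cases ?h) auto
    have val: "est s2 (edg s2 ?h) \<le> ?h" using top[OF h] by (simp add: B2)
    note S = linked_sound[OF l2 v(2) hc val]
    have "edg s2 ?h \<in> inc G v" using linked_incident[OF l2 S(1) val S(2)] S(3) by simp
    then have "edg s2 ?h \<in> F" using S(4) sync[OF S(1)] by (simp add: F_def B2)
    then show "F \<noteq> {}" by auto
  next
    assume "F \<noteq> {}"
    then obtain e where e: "e \<in> inc G v" "elv s2 e = j" using sync dom by (auto simp: F_def B2)
    obtain r where "r \<in> set (chain (nxt s2) (head s2 (v + n * elv s2 e)))"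
      using linked_record_of[OF l2 e(1)] by blast
    then show "0 < head s2 (v + n * j)" using e(2) by (cases "head s2 (v + n * j)") auto
  qed
  define x where "x = (if F = {} then 0 else j - 1)"
  define s3 where "s3 = write_i 14 2 x s2"
  have fr3: "frame {14} {} s2 s3" by (auto simp: s3_def frame_def)
  have st2: "settled M G s2"
    unfolding settled_def using l2 st B2 R2 by (auto simp: settled_def weighted_def)
  have st3: "settled M G s3" by (rule settled_frame[OF st2 frame_weaken[OF fr3]]) auto
  have B3: "ibank s3 b = ibank s2 b" if "b \<noteq> 14" for b using that by (simp add: s3_def)
  have R3: "rbank s3 = rbank s" using R2 by (simp add: s3_def)
  have lev3: "lev s3 = lev s" using B3 B2 by simp
  have rec3: "records s3 = records s2" using B3 by (simp add: records_def)
  have gap3: "gap G s3 = gap G s" using B3 B2 by (simp add: gap_def cong: if_cong)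
  have stk3: "stack_set s3 = stack_set s" "sp s3 = sp s" using B3 B2 by (simp_all add: stack_set_def)
  have xj: "x \<le> lev s v" "x \<le> M" using jM by (auto simp: x_def j_def)
  have low: "edge_level G (lev s) e = max j (edge_level G ((lev s)(v := x)) e)"
      "x \<le> edge_level G ((lev s)(v := x)) e" if "e \<in> inc G v" for e
    using edge_level_lower[OF wf that, of x "lev s"] xj(1) by (simp_all add: j_def)
  have "run move s3 (moved M G v x {e \<in> inc G v. edge_level G (lev s3) e = j} s3)"
  proof (rule run_move[OF wf st3 _ v(2) _ jM _ xj(2) M])
    show "vr s3 = v" "jr s3 = j" "newr s3 = x" using v2 by (simp_all add: s3_def)
    show "edge_level G ((lev s3)(v := x)) e = edge_level G (lev s3) e"
      if "e \<in> inc G v" "edge_level G (lev s3) e \<noteq> j" for e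
      using low(1)[OF that(1)] that(2) unfolding lev3 by (simp add: max_def split: if_splits)
    show "j \<le> Suc (edge_level G ((lev s3)(v := x)) e)"
      if "e \<in> inc G v" "edge_level G (lev s3) e = j" for e
    proof -
      have "e \<in> F" using that by (simp add: F_def lev3)
      then have "x = j - 1" by (auto simp: x_def)
      then show ?thesis using low(2)[OF that(1)] unfolding lev3 by linarith
    qed
  qed
  then obtain t4 s4 where x4: "exec move s3 t4 s4" and st4: "settled M G s4" and lev4: "lev s4 = (lev s)(v := x)"
    and t4: "t4 + 100 * records s4 \<le> 100 * records s2 + 1000 * (f * card F) + 100"
    and sp4: "sp s4 \<le> sp s + f * card F" and gap4: "gap G s4 \<le> gap G s + f * card F"
    and stk4: "stack_set s \<subseteq> stack_set s4" and w4: "\<And>u. u \<notin> stack_set s4 \<Longrightarrow> wgt s4 u = wgt s u"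
    and vF: "F \<noteq> {} \<Longrightarrow> v \<in> stack_set s4"
    unfolding run_def moved_def lev3 rec3 stk3 gap3 R3 F_def[symmetric] by auto
  \<comment> \<open>If \<open>v\<close> is not on the stack, its bucket was empty and
    \<open>v\<close> is now at level 0, where only the upper bound is required; that follows from
    \<open>c_star_le\<close>.\<close>
  have "calm s4 u" if u: "u < n" "u \<notin> stack_set s4" for u
  proof (cases "u = v")
    case True
    then have "x = 0" using vF u by (auto simp: x_def)
    moreover have "wgt s v \<le> c v" using dirty(1) c_star_le(2)[OF v(2)] by simp
    ultimately show ?thesis using w4[OF u(2)] True by (simp add: calm_def lev4)
  next
    case False
    moreover have "u \<notin> stack_set s" using stk4 u by auto
    ultimately have "calm s u" using ok u by (simp add: state_ok_def)
    then show ?thesis using w4[OF u(2)] False by (simp add: calm_def lev4)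
  qed
  then have ok4: "state_ok {} G s4" using st4 M by (auto simp: state_ok_def)
  have "level_pot G ((lev s)(v := x)) + \<epsilon> * real (card F) \<le> level_pot G (lev s)"
  proof (cases "F = {}")
    case True
    then have "level_pot G ((lev s)(v := 0)) + \<epsilon> \<le> level_pot G (lev s)"
      using dirty by (intro level_drop_zero(1)[OF wf v(2)]) (auto simp: F_def j_def)
    then show ?thesis using True eps_pos by (simp add: x_def)
  next
    case False
    then have "x = lev s v - 1" by (simp add: x_def j_def)
    then show ?thesis using level_down[OF wf v(2) dW dirty(2)] by (simp only: F_def j_def)
  qed
  then have P: "5000 * real f * (level_pot G (lev s4) / \<epsilon>) + 5000 * real (f * card F) \<le> 5000 * real f * (level_pot G (lev s) / \<epsilon>)"
    unfolding lev4 by (rule pot_drop)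
  have "real t2 + 100 * real (records s2) \<le> 100 * real (records s) + 100"
    using t2 by linarith
  moreover have "real t4 + 100 * real (records s4) \<le> 100 * real (records s2) + 1000 * real (f * card F) + 100"
    using t4 by linarith
  moreover have "real (sp s4) \<le> real (sp s) + real (f * card F)" using sp4 by linarith
  moreover have "real (gap G s4) \<le> real (gap G s) + real (f * card F)"
    using gap4 by linarith
  moreover have "0 \<le> real (f * card F)" by simp
  ultimately have T: "real (t2 + t4) + pot G s4 \<le> pot G s + 400"
    unfolding pot_def using P by linarith
  have sel: "run (Cond (ILess (INum 0) (ICell 7 xBKT)) (ISet 14 (INum 2) (ISub xJ (INum 1))) (ISet 14 (INum 2) (INum 0))) s2
      (\<lambda>t s'. s' = s3 \<and> t \<le> 50)"
    using empty by (simp add: run_simps v2 off2 s3_def x_def)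
  then obtain t3 where x3: "exec (Cond (ILess (INum 0) (ICell 7 xBKT)) (ISet 14 (INum 2) (ISub xJ (INum 1)))
      (ISet 14 (INum 2) (INum 0))) s2 t3 s3" and t3: "t3 \<le> 50"
    by (auto simp: run_def)
  show ?thesis
    unfolding sink_def run_Seq
    apply (simp only: run_ISet ival.simps v j_def[symmetric] s1_def[symmetric])
    apply (rule runI[OF x2])
    apply (rule runI[OF x3])
    apply (rule runI[OF x4])
    using ok4 T t3 by simp
qed

lemma run_process:
  assumes wf: "wf_graph G" and ok: "state_ok {v} G s" and v: "vr s = v" "v < n"
  shows "run process s (\<lambda>t s'. state_ok {} G s' \<and> real t + pot G s' \<le> pot G s + 1600)"
proof -
  obtain M where "settled M G s" using ok by (auto simp: state_ok_def)
  then have tb: "tables M s" by (simp add: settled_def linked_def)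
  then have p: "rbank s 1 v = c v" "rbank s (Suc 0) v = c v" "ibank s 0 2 = f" "rbank s 0 0 = \<epsilon>"
    using v by (simp_all add: tables_def)
  have cs: "c v / (real f * (1 + 1 / real f + 3 * \<epsilon>) * (1 + \<epsilon>)) = c_star \<alpha> \<beta> f c v"
    by (simp add: c_star_def alpha_eq beta_eq)
  show ?thesis
  proof (cases "c v < wgt s v")
    case True
    show ?thesis
      unfolding process_def using True run_raise[OF wf ok v True]
      by (auto simp: run_Cond v p elim!: run_mono)
  next
    case F1: False
    show ?thesis
    proof (cases "0 < lev s v \<and> wgt s v < c_star \<alpha> \<beta> f c v")
      case True
      then show ?thesis
        unfolding process_def using F1 run_sink[OF wf ok v]
        by (auto simp: run_Cond v p cs elim!: run_mono)
    next
      case False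
      have "calm s v" using F1 False by (auto simp: calm_def)
      then have "state_ok {} G s" using ok by (auto simp: state_ok_def)
      then show ?thesis
        unfolding process_def using F1 False by (auto simp: run_Cond run_Skip v p cs)
    qed
  qed
qed

text \<open>Popping a node frees 2000, \<open>process\<close> needs at most 1600 beyond what it
  takes from the potential, and the difference covers the pop and the loop test. Termination follows
  because \<open>pot\<close> is nonnegative.\<close>

lemma run_main_loop:
  assumes wf: "wf_graph G" and ok: "state_ok {} G s"
  shows "run main_loop s (\<lambda>t s'. state_ok {} G s' \<and> sp s' = 0 \<and> real t + pot G s' \<le> pot G s + 10)"
proof -
  have "run main_loop s (\<lambda>t s'. state_ok {} G s' \<and> \<not> bval (ILess (INum 0) xSP) s' \<and>
      real t + pot G s' \<le> pot G s + real (1 + bcost (ILess (INum 0) xSP)))"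
    unfolding main_loop_def
  proof (rule run_While)
    show "state_ok {} G s" by (rule ok)
    show "0 \<le> pot G s" if "state_ok {} G s" for s by (rule pot_nonneg[OF wf that])
    fix s assume ok: "state_ok {} G s" and "bval (ILess (INum 0) xSP) s"
    then have sp: "0 < sp s" by simp
    define v where "v = stk s (sp s)"
    define s1 where "s1 = write_i 3 (Suc 0) (sp s - Suc 0) (write_i 14 0 v s)"
    obtain M where M: "M \<le> L" and st: "settled M G s" using ok by (auto simp: state_ok_def)
    have l: "linked {} M G s" using st by (simp add: settled_def)
    have "{0<..sp s} = insert (sp s) {0<..sp s - Suc 0}" using sp by auto
    then have ss: "stack_set s = insert v (stack_set s1)" by (simp add: stack_set_def s1_def v_def)
    have vn: "v < n" using linkedD(2)[OF l] ss by auto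
    have B: "ibank s1 b = ibank s b" if "b \<notin> {3, 14}" for b using that by (auto simp: s1_def)
    have R: "rbank s1 = rbank s" and al: "alloc s1 = alloc s" by (simp_all add: s1_def)
    have l1: "linked {} M G s1"
      using l linkedD(2)[OF l] ss unfolding linked_def tables_def by (simp add: B R al)
    have "settled M G s1" unfolding settled_def using l1 st B R by (simp add: settled_def weighted_def)
    moreover have "calm s1 u" if "u < n" "u \<notin> stack_set s1" "u \<noteq> v" for u
      using ok that ss B R by (simp add: state_ok_def calm_def)
    ultimately have ok1: "state_ok {v} G s1" using M by (auto simp: state_ok_def)
    have "pot G s1 + 2000 = pot G s"
      using sp by (simp add: pot_def records_def gap_def s1_def of_nat_diff cong: if_cong)
    moreover have "run process s1 (\<lambda>t s'. state_ok {} G s' \<and> real t + pot G s' \<le> pot G s1 + 1600)"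
      by (rule run_process[OF wf ok1 _ vn]) (simp add: s1_def)
    ultimately show "run (ISet 14 (INum 0) (ICell 11 xSP) ;; ISet 3 (INum (Suc 0)) (ISub xSP (INum 1)) ;; process) s
        (\<lambda>t s'. state_ok {} G s' \<and> pot G s' + real (t + 1 + bcost (ILess (INum 0) xSP)) \<le> pot G s)"
      unfolding run_Seq by (auto simp: run_ISet v_def[symmetric] s1_def[symmetric] elim!: run_mono)
  qed
  then show ?thesis by (rule run_mono) auto
qed

end

section \<open>Edge updates and the total running time\<close>

definition load_loop :: com where
  "load_loop = While (ILess xQ (IAdd (INum 3) (ICell 1 (INum 2))))
     (ISet 3 (INum 0) (IAdd xAL (INum 1)) ;; ISet 4 xAL (ICell 1 xQ) ;; ISet 16 (INum 0) (IAdd xQ (INum 1)))"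

text \<open>The endpoints are copied into a provisional block that lies in no bucket, with weight 0.
  To \<open>refresh\<close> this looks like an edge to be relinked, and the block is replaced by a
  proper one.\<close>

definition insert_edge :: com where
  "insert_edge =
     (ISet 15 (INum 0) (ICell 1 (INum 1)) ;;
      ISet 8 xE (IAdd xAL (INum 1)) ;;
      ISet 16 (INum 0) (INum 3) ;;
      load_loop ;;
      ISet 9 xE (IAdd xAL (INum 1)) ;;
      RSet 4 xE (ROfNat (INum 0)) ;;
      refresh)"

definition unload_loop :: com where
  "unload_loop = While (ILess xQ (ICell 9 xE))
     (RSet 2 (ICell 4 xQ) (RSub (RCell 2 (ICell 4 xQ)) (RCell 4 xE)) ;;
      ISet 3 (INum (Suc 0)) (IAdd xSP (INum 1)) ;;
      ISet 11 xSP (ICell 4 xQ) ;;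
      ISet 16 (INum 0) (IAdd xQ (INum 1)))"

text \<open>The records stay in their buckets: an \<open>est\<close> beyond all of them marks them
  as outdated. The endpoints are pushed because their weight may have fallen below
  \<open>c_star\<close>.\<close>

definition delete_edge :: com where
  "delete_edge =
     (ISet 15 (INum 0) (ICell 1 (INum 1)) ;;
      ISet 16 (INum 0) (ICell 8 xE) ;;
      unload_loop ;;
      ISet 8 xE (IAdd xAL (INum 1)))"

definition algorithm :: com where
  "algorithm =
     (RSet 3 (INum 0) (RCell 0 (INum (Suc 0))) ;;
      Cond (ILess (ICell 1 (INum 0)) (INum 2)) insert_edge delete_edge ;;
      main_loop)"

lemma run_load_loop:
  assumes q: "qr s = 3" and k: "ibank s 1 2 = k"
  shows "run load_loop s (\<lambda>t s'. frame {3, 4, 16} {} s s' \<and> alloc s' = alloc s + k \<and> sp s' = sp s \<and>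
     (\<forall>r\<le>alloc s. node s' r = node s r) \<and> (\<forall>i<k. node s' (Suc (alloc s + i)) = ibank s 1 (3 + i)) \<and>
     t \<le> 60 * k + 30)"
proof -
  let ?b = "ILess xQ (IAdd (INum 3) (ICell 1 (INum 2)))"
  define I where "I s' \<longleftrightarrow> (\<exists>i\<le>k. frame {3, 4, 16} {} s s' \<and> alloc s' = alloc s + i \<and> sp s' = sp s \<and> qr s' = 3 + i \<and>
     (\<forall>r\<le>alloc s. node s' r = node s r) \<and> (\<forall>j<i. node s' (Suc (alloc s + j)) = ibank s 1 (3 + j)))" for s'
  define V where "V s' = 60 * (3 + k - qr s')" for s' :: store
  have "run load_loop s (\<lambda>t s'. I s' \<and> \<not> bval ?b s' \<and> t + V s' \<le> V s + (1 + bcost ?b))"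
    unfolding load_loop_def
  proof (rule run_While_nat, goal_cases)
    case 1
    show ?case using q by (auto simp: I_def frame_refl intro!: exI[of _ 0])
  next
    case (2 s1)
    then have b: "bval ?b s1" by blast
    from 2 obtain i where i: "i \<le> k" "frame {3, 4, 16} {} s s1" "alloc s1 = alloc s + i" "sp s1 = sp s" "qr s1 = 3 + i"
      "\<And>r. r \<le> alloc s \<Longrightarrow> node s1 r = node s r" "\<And>j. j < i \<Longrightarrow> node s1 (Suc (alloc s + j)) = ibank s 1 (3 + j)"
      by (auto simp: I_def)
    have b1: "ibank s1 1 = ibank s 1" "ibank s1 (Suc 0) = ibank s 1" using frame_ibank[OF i(2)] by simp_all
    have ik: "i < k" using b i(5) k b1 by simp
    define s2 where "s2 = write_i 16 0 (Suc (3 + i)) (write_i 4 (Suc (alloc s + i)) (ibank s 1 (3 + i))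
        (write_i 3 0 (Suc (alloc s + i)) s1))"
    have fr: "frame {3, 4, 16} {} s s2"
      by (rule frame_trans[OF i(2)]) (auto simp: frame_def s2_def)
    have "I s2"
      unfolding I_def
      by (rule exI[of _ "Suc i"]) (use ik fr i in \<open>auto simp: s2_def less_Suc_eq\<close>)
    moreover have "V s2 + 60 \<le> V s1" using ik i(5) by (simp add: V_def s2_def)
    ultimately show ?case
      by (simp add: run_simps i(3,5) b1 s2_def)
  qed
  then show ?thesis
  proof (rule run_mono, goal_cases)
    case *: (1 t s')
    then obtain i where i: "i \<le> k" "frame {3, 4, 16} {} s s'" "alloc s' = alloc s + i" "sp s' = sp s" "qr s' = 3 + i"
      "\<forall>r\<le>alloc s. node s' r = node s r" "\<forall>j<i. node s' (Suc (alloc s + j)) = ibank s 1 (3 + j)"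
      by (auto simp: I_def)
    have "ibank s' 1 = ibank s 1" "ibank s' (Suc 0) = ibank s 1" using frame_ibank[OF i(2)] by simp_all
    then have "i = k" using * i(1,5) k by simp
    then show ?case
      using i * q by (simp add: V_def)
  qed
qed

lemma serves_snoc:
  "serves p s us t s' \<Longrightarrow> exec p (receive u s') t' s'' \<Longrightarrow> serves p s (us @ [u]) (t + t') s''"
proof (induction rule: serves.induct)
  case (Nil p s)
  from serves.Cons[OF Nil serves.Nil] show ?case by simp
next
  case (Cons p v s t1 s1 us t2 s2)
  from serves.Cons[OF Cons.hyps(1) Cons.IH[OF Cons.prems]] show ?case by (simp add: add.assoc)
qed

lemma graph_after_snoc: "graph_after (us @ [u]) = apply_update u (graph_after us)"
  by (simp add: graph_after_def)

lemma legal_updates_snocD: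
  assumes "legal_updates n m f (us @ [u])"
  shows "legal_updates n m f us" "legal_update n m f (graph_after us) u"
proof -
  have *: "legal_update n m f (graph_after (take i (us @ [u]))) ((us @ [u]) ! i)" if "i \<le> length us" for i
    using assms that by (simp add: legal_updates_def)
  show "legal_updates n m f us"
    unfolding legal_updates_def
  proof (intro allI impI)
    fix i assume "i < length us"
    then show "legal_update n m f (graph_after (take i us)) (us ! i)" using *[of i] by (simp add: nth_append)
  qed
  show "legal_update n m f (graph_after us) u" using *[of "length us"] by simp
qed

context instance_params begin

lemma stack_set_push:
  assumes "stk s' = (stk s)(Suc (sp s) := u)" "sp s' = Suc (sp s)"
  shows "stack_set s' = insert u (stack_set s)"
proof -
  have "{0<..Suc (sp s)} = insert (Suc (sp s)) {0<..sp s}" by auto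
  then show ?thesis unfolding stack_set_def assms by auto
qed

lemma run_unload_loop:
  assumes q: "qr s = a" "a \<le> eend s (er s)" and inj: "inj_on (node s) {a..<eend s (er s)}"
  defines "X \<equiv> node s ` {a..<eend s (er s)}"
  shows "run unload_loop s (\<lambda>t s'. frame {3, 11, 16} {2} s s' \<and> alloc s' = alloc s \<and>
     sp s' = sp s + card X \<and> stack_set s' = stack_set s \<union> X \<and>
     (\<forall>v. wgt s' v = wgt s v - (if v \<in> X then ew s (er s) else 0)) \<and> t \<le> 80 * card X + 30)"
proof -
  let ?b = "ILess xQ (ICell 9 xE)"
  define z where "z = eend s (er s)"
  define I where "I s' \<longleftrightarrow> frame {3, 11, 16} {2} s s' \<and> a \<le> qr s' \<and> qr s' \<le> z \<and> alloc s' = alloc s \<and>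
     sp s' = sp s + (qr s' - a) \<and> stack_set s' = stack_set s \<union> node s ` {a..<qr s'} \<and>
     (\<forall>v. wgt s' v = wgt s v - (if v \<in> node s ` {a..<qr s'} then ew s (er s) else 0))" for s'
  define V where "V s' = 80 * (z - qr s')" for s' :: store
  have cX: "card X = z - a" unfolding X_def z_def using card_image[OF inj] by simp
  have "run unload_loop s (\<lambda>t s'. I s' \<and> \<not> bval ?b s' \<and> t + V s' \<le> V s + (1 + bcost ?b))"
    unfolding unload_loop_def
  proof (rule run_While_nat, goal_cases)
    case 1
    show ?case using q by (auto simp: I_def frame_refl z_def)
  next
    case (2 s1)
    then have I1: "I s1" and b: "bval ?b s1" by blast+
    have fr: "frame {3, 11, 16} {2} s s1" and q1: "a \<le> qr s1" and al: "alloc s1 = alloc s"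
      and sp: "sp s1 = sp s + (qr s1 - a)" and st: "stack_set s1 = stack_set s \<union> node s ` {a..<qr s1}"
      and w: "\<And>v. wgt s1 v = wgt s v - (if v \<in> node s ` {a..<qr s1} then ew s (er s) else 0)"
      using I1 by (auto simp: I_def)
    have B: "node s1 = node s" "er s1 = er s" "eend s1 = eend s" "ew s1 = ew s"
      using frame_ibank[OF fr] frame_rbank[OF fr] by simp_all
    have lt: "qr s1 < z" using b by (simp add: B z_def)
    define u where "u = node s (qr s1)"
    \<comment> \<open>Each endpoint occurs once in the block, so its weight is reduced once.\<close>
    have new: "u \<notin> node s ` {a..<qr s1}"
      unfolding u_def using inj lt q1 by (auto simp: z_def dest!: inj_onD)
    define s2 where "s2 = write_i 16 0 (Suc (qr s1)) (write_i 11 (Suc (sp s1)) u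
        (write_i 3 (Suc 0) (Suc (sp s1)) (write_r 2 u (wgt s1 u - ew s (er s)) s1)))"
    have fr2: "frame {3, 11, 16} {2} s s2"
      by (rule frame_trans[OF fr]) (auto simp: frame_def s2_def)
    have q2: "qr s2 = Suc (qr s1)" by (simp add: s2_def)
    have img: "node s ` {a..<qr s2} = insert u (node s ` {a..<qr s1})"
      using q1 by (auto simp: q2 u_def less_Suc_eq)
    have st2: "stack_set s2 = insert u (stack_set s1)" by (rule stack_set_push) (simp_all add: s2_def)
    have "I s2"
      unfolding I_def
    proof (intro conjI allI)
      show "stack_set s2 = stack_set s \<union> node s ` {a..<qr s2}" using st2 st img by auto
      show "wgt s2 v = wgt s v - (if v \<in> node s ` {a..<qr s2} then ew s (er s) else 0)" for v
        unfolding img using w[of v] w[of u] new by (simp add: s2_def)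
    qed (use fr2 q1 lt al sp in \<open>auto simp: q2, auto simp: s2_def\<close>)
    moreover have "V s2 + 80 \<le> V s1" using lt by (simp add: V_def q2)
    ultimately show ?case
      by (simp add: run_simps B u_def[symmetric] s2_def[symmetric])
  qed
  then show ?thesis
  proof (rule run_mono, goal_cases)
    case *: (1 t s')
    then have fr: "frame {3, 11, 16} {2} s s'" by (simp add: I_def)
    have "er s' = er s" "eend s' = eend s" using frame_ibank[OF fr] by simp_all
    then have q': "qr s' = z" using * by (auto simp: I_def z_def)
    show ?case
      using * q unfolding I_def q' X_def[folded z_def, symmetric] by (simp add: V_def cX)
  qed
qed

lemma state_ok_frame:
  assumes ok: "state_ok X G s" and fr: "frame {1, 14, 15, 16} {5} s s'"
  shows "state_ok X G s'" "pot G s' = pot G s"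
proof -
  note F = frame_ibank[OF fr] frame_rbank[OF fr]
  show "state_ok X G s'"
    using ok settled_frame[OF _ fr] by (auto simp: state_ok_def stack_set_def calm_def F)
  show "pot G s' = pot G s" by (simp add: pot_def records_def gap_def F cong: if_cong)
qed

lemma run_insert_edge:
  assumes wf: "wf_graph G" and wf': "wf_graph (G(e := Some (set xs)))" and e: "e \<notin> dom G" and xs: "distinct xs"
    and ok: "state_ok {} G s" and inp: "ibank s 1 = bank_of_list (encode_update (Insert e xs))"
  shows "run insert_edge s (\<lambda>t s'. state_ok {} (G(e := Some (set xs))) s' \<and>
    real t + pot (G(e := Some (set xs))) s' \<le> pot G s + (5000 * real f * (4 * real L / \<epsilon>) + 5000 * real f + 200 * (real f * real L)))"
proof -
  let ?S = "set xs" and ?k = "length xs" and ?A = "alloc s"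
  let ?G = "G(e := Some (set xs))"
  have Ge: "?G e = Some ?S" by simp
  note Sw = wf_edgeD[OF wf' Ge]
  have GN: "G(e := None) = G" using e by (auto simp: domIff)
  have kf: "?k \<le> f" using Sw(4) distinct_card[OF xs] by simp
  have in1: "ibank s 1 1 = e" "ibank s 1 2 = ?k" "ibank s (Suc 0) (Suc 0) = e" "\<And>i. i < ?k \<Longrightarrow> ibank s 1 (3 + i) = xs ! i"
    using inp by (simp_all add: bank_of_list_def numeral_2_eq_2 numeral_3_eq_3)
  obtain M where M: "M \<le> L" and st: "settled M G s" using ok by (auto simp: state_ok_def)
  have l: "linked {} M G s" and w: "weighted G s" and lev: "\<And>u. u < n \<Longrightarrow> lev s u \<le> M"
    and sync: "\<And>e. e \<in> dom G \<Longrightarrow> elv s e = edge_level G (lev s) e"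
    using st by (auto simp: settled_def)
  define s1 where "s1 = write_i 16 0 3 (write_i 8 e (Suc ?A) (write_i 15 0 e s))"
  have B1: "ibank s1 b = ibank s b" if "b \<notin> {8, 15, 16}" for b using that by (auto simp: s1_def)
  have "qr s1 = 3" "ibank s1 1 2 = ?k" using in1 by (simp_all add: s1_def)
  from run_load_loop[OF this] obtain t2 s2 where x2: "exec load_loop s1 t2 s2" and fr2: "frame {3, 4, 16} {} s1 s2"
    and al2: "alloc s2 = ?A + ?k" and sp2: "sp s2 = sp s" and nd2: "\<And>r. r \<le> ?A \<Longrightarrow> node s2 r = node s r"
    and nw2: "\<And>i. i < ?k \<Longrightarrow> node s2 (Suc (?A + i)) = xs ! i" and t2: "t2 \<le> 60 * ?k + 30"
    unfolding run_def using in1(4) by (auto simp: B1)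
  have B2: "ibank s2 b = ibank s b" if "b \<notin> {3, 4, 8, 15, 16}" for b using frame_ibank[OF fr2, of b] B1 that by simp
  have R2: "rbank s2 = rbank s" using frame_rbank[OF fr2] by (auto simp: s1_def)
  have e2: "er s2 = e" "est s2 = (est s)(e := Suc ?A)" using frame_ibank[OF fr2] by (simp_all add: s1_def)
  define s3 where "s3 = write_r 4 e 0 (write_i 9 e (Suc (?A + ?k)) s2)"
  have B3: "ibank s3 b = ibank s b" if "b \<notin> {3, 4, 8, 9, 15, 16}" for b using that B2 by (simp add: s3_def)
  have R3: "rbank s3 b = rbank s b" if "b \<noteq> 4" for b using that R2 by (simp add: s3_def)
  have s3: "ibank s3 3 = ibank s2 3" "node s3 = node s2" "est s3 = (est s)(e := Suc ?A)"
    "eend s3 = (eend s)(e := Suc (?A + ?k))" "er s3 = e" "ew s3 = (ew s)(e := 0)"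
    using e2 B2 R2 by (simp_all add: s3_def)
  have stk3: "stack_set s3 = stack_set s" using sp2 by (simp add: stack_set_def s3 B3)
  \<comment> \<open>Removing the absent \<open>e\<close> accounts for the new value of
    \<open>est\<close>, under which all records left by an earlier edge with the same identifier
    remain outdated.\<close>
  have "linked {} M (G(e := None)) s3"
  proof (rule linked_unlink[OF l])
    show "stack_set s3 \<subseteq> {..<n}" using linkedD(2)[OF l] stk3 by simp
  qed (use B3 R3 al2 nd2 in \<open>auto simp: s3\<close>)
  then have l3: "linked {} M G s3" by (simp only: GN)
  have bij: "bij_betw (node s3) {Suc ?A..<Suc (?A + ?k)} ?S"
    by (rule bij_betw_shift[OF bij_betw_nth[OF xs refl refl]]) (simp add: s3 nw2)
  have "run refresh s3 (\<lambda>t s'. linked {} M ?G s' \<and> weighted ?G s' \<and> refreshed e ?S s3 s' \<and> t \<le> 400 * card ?S + 400)"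
  proof (rule run_refresh[OF l3])
    show "er s3 = e" by (rule s3)
    show "finite (dom G)" using wf by (simp add: wf_graph_def)
    show "est s3 e \<le> eend s3 e" "eend s3 e \<le> Suc (alloc s3)" "bij_betw (node s3) {est s3 e..<eend s3 e} ?S"
      using bij al2 by (simp_all add: s3)
    show "wgt s3 v = sum (ew s3) (inc (G(e := None)) v) + (if v \<in> ?S then ew s3 e else 0)" if "v < n" for v
    proof -
      have "sum (ew s3) (inc G v) = sum (ew s) (inc G v)"
        using not_incident_delete[of e G v] GN by (intro sum.cong refl) (auto simp: s3)
      then show ?thesis using w that unfolding GN by (simp add: weighted_def R3 s3)
    qed
    show "ew s3 e' = \<mu> / \<beta> ^ elv s3 e'" if "e' \<in> dom G" "e' \<noteq> e" for e'
      using w that by (simp add: weighted_def s3 B3)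
    show "lev s3 v \<le> M" if "v \<in> ?S" for v using that lev Sw(3) by (auto simp: B3)
  qed (use Sw in auto)
  then obtain t4 s4 where x4: "exec refresh s3 t4 s4" and l4: "linked {} M ?G s4" and w4: "weighted ?G s4"
    and r4: "refreshed e ?S s3 s4" and t4: "t4 \<le> 400 * card ?S + 400"
    unfolding run_def by blast
  note r4' = r4[unfolded refreshed_def]
  have fr4: "refresh_frame s3 s4" using r4' by (rule conjunct1)
  have elv4: "elv s4 = (elv s)(e := Max (lev s ` ?S))" and rec4: "records s4 \<le> records s3 + card ?S"
      and sp4: "sp s4 = sp s + card ?S" and st4: "stack_set s4 = stack_set s \<union> ?S"
      and wg4: "\<And>u. u \<notin> ?S \<Longrightarrow> wgt s4 u = wgt s u"
      and lo4: "\<And>u. lo s4 u = (if u \<in> ?S then min (lo s u) (Max (lev s ` ?S)) else lo s u)"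
      using r4' by (simp_all add: B3 R3 s3 sp2 stk3)
  have lev4: "lev s4 = lev s" using frame_ibank[OF fr4] by (simp add: B3)
  have rec3: "records s3 = records s" by (simp add: records_def B3)
  have "settled M ?G s4"
    unfolding settled_def
  proof (intro conjI allI impI ballI)
    fix e' assume e': "e' \<in> dom ?G"
    show "elv s4 e' = edge_level ?G (lev s4) e'"
    proof (cases "e' = e")
      case True
      then show ?thesis using edge_level_Some[of ?G e ?S "lev s"] by (simp add: elv4 lev4)
    next
      case False
      then have "e' \<in> dom G" using e' by simp
      then show ?thesis using sync[of e'] False edge_level_cong[of G e' ?G "lev s"] by (simp add: elv4 lev4)
    qed
  qed (use l4 w4 lev lev4 in auto)
  moreover have "calm s4 u" if "u < n" "u \<notin> stack_set s4" for u
    using ok that st4 wg4[of u] by (simp add: state_ok_def calm_def lev4)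
  ultimately have ok4: "state_ok {} ?G s4" using M by (auto simp: state_ok_def)
  \<comment> \<open>The term of a formerly isolated endpoint may jump from 0 to \<open>L\<close>,
    and the pointer of any other endpoint may fall by up to \<open>L\<close>.\<close>
  have "gap ?G s4 \<le> gap G s + card ?S * L"
  proof (rule gap_le[OF Sw(3)])
    fix u
    show "(if inc ?G u = {} then 0 else L - lo s4 u)
       \<le> (if inc G u = {} then 0 else L - lo s u) + (if u \<in> ?S then L else 0)"
      using lo4[of u] incident_insert[of G e ?S u] unfolding GN by auto
  qed
  also have "card ?S * L \<le> f * L" using Sw(4) by (rule mult_le_mono1)
  finally have gap4: "real (gap ?G s4) \<le> real (gap G s) + real f * real L"
    by (metis add_left_mono of_nat_add of_nat_le_iff of_nat_mult)
  have P: "5000 * real f * (level_pot ?G (lev s4) / \<epsilon>)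
      \<le> 5000 * real f * (level_pot G (lev s) / \<epsilon>) + 5000 * real f * (4 * real L / \<epsilon>)"
  proof -
    have "level_pot ?G (lev s) \<le> level_pot G (lev s) + 4 * real L"
      using level_pot_insert[OF wf', of "lev s"] by (simp only: GN)
    then have "level_pot ?G (lev s) / \<epsilon> \<le> level_pot G (lev s) / \<epsilon> + 4 * real L / \<epsilon>"
      using divide_right_mono[OF _ less_imp_le[OF eps_pos]] unfolding add_divide_distrib[symmetric] by blast
    from mult_left_mono[OF this, of "5000 * real f"] show ?thesis unfolding lev4 by (simp only: distrib_left)
  qed
  have cS: "card ?S \<le> f" by (rule Sw(4))
  have "real (t2 + t4) + 200 \<le> 2000 * real f" using t2 t4 cS kf f_pos by linarith
  moreover have "real (records s4) \<le> real (records s) + real f" using rec4 rec3 cS by linarith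
  moreover have "real (sp s4) \<le> real (sp s) + real f" using sp4 cS by linarith
  ultimately have T: "real (t2 + t4) + 200 + pot ?G s4 \<le> pot G s + (5000 * real f * (4 * real L / \<epsilon>) + 5000 * real f + 200 * (real f * real L))"
    unfolding pot_def using P gap4 by linarith
  show ?thesis
    unfolding insert_edge_def
    apply (simp add: run_Seq run_ISet run_RSet in1 s1_def[symmetric] del: of_nat_add)
    apply (rule runI[OF x2])
    apply (simp add: run_Seq run_ISet run_RSet e2 al2 s3_def[symmetric] del: of_nat_add)
    apply (rule runI[OF x4])
    using ok4 T by simp
qed

text \<open>The remaining edges keep their levels and no pointer moves; the cost consists of one
  pass over the endpoints, their entries on the stack, and the increase allowed by
  \<open>level_pot_delete\<close>.\<close>

lemma run_delete_edge:
  assumes wf: "wf_graph G" and e: "G e = Some S"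
    and ok: "state_ok {} G s" and inp: "ibank s 1 = bank_of_list (encode_update (Delete e))"
  shows "run delete_edge s (\<lambda>t s'. state_ok {} (G(e := None)) s' \<and>
    real t + pot (G(e := None)) s' \<le> pot G s + (5000 * real f * (4 / \<epsilon> / \<epsilon>) + 5000 * real f))"
proof -
  let ?G = "G(e := None)"
  note Sw = wf_edgeD[OF wf e]
  have in1: "ibank s 1 1 = e" "ibank s (Suc 0) (Suc 0) = e" using inp by (simp_all add: bank_of_list_def)
  obtain M where M: "M \<le> L" and st: "settled M G s" using ok by (auto simp: state_ok_def)
  have l: "linked {} M G s" and w: "weighted G s" and lev: "\<And>u. u < n \<Longrightarrow> lev s u \<le> M"
    and sync: "\<And>e. e \<in> dom G \<Longrightarrow> elv s e = edge_level G (lev s) e"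
    using st by (auto simp: settled_def)
  note D = linkedD(6-9)[OF l e]
  define s1 where "s1 = write_i 16 0 (est s e) (write_i 15 0 e s)"
  have B1: "ibank s1 b = ibank s b" if "b \<notin> {15, 16}" for b using that by (auto simp: s1_def)
  have s1: "qr s1 = est s e" "er s1 = e" "rbank s1 = rbank s" by (simp_all add: s1_def)
  have X: "node s ` {est s e..<eend s e} = S" using D(4) by (simp add: bij_betw_def)
  have S1: "stack_set s1 = stack_set s" by (simp add: stack_set_def B1)
  have "est s e \<le> eend s1 (er s1)" "inj_on (node s1) {est s e..<eend s1 (er s1)}"
    using D by (simp_all add: s1 B1 bij_betw_def)
  from run_unload_loop[OF s1(1) this] obtain t2 s2 where x2: "exec unload_loop s1 t2 s2" and fr2: "frame {3, 11, 16} {2} s1 s2"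
    and al2: "alloc s2 = alloc s" and sp2: "sp s2 = sp s + card S" and st2: "stack_set s2 = stack_set s \<union> S"
    and w2: "\<And>v. wgt s2 v = wgt s v - (if v \<in> S then ew s e else 0)" and t2: "t2 \<le> 80 * card S + 30"
    unfolding run_def by (auto simp: s1 B1 X S1)
  have B2: "ibank s2 b = ibank s b" if "b \<notin> {3, 11, 15, 16}" for b using frame_ibank[OF fr2, of b] B1 that by simp
  have R2: "rbank s2 b = rbank s b" if "b \<noteq> 2" for b using frame_rbank[OF fr2, of b] that by (simp add: s1)
  have e2: "er s2 = e" using frame_ibank[OF fr2] by (simp add: s1)
  define s3 where "s3 = write_i 8 e (Suc (alloc s)) s2"
  have B3: "ibank s3 b = ibank s b" if "b \<notin> {3, 8, 11, 15, 16}" for b using that B2 by (simp add: s3_def)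
  have R3: "rbank s3 = rbank s2" by (simp add: s3_def)
  have s3: "ibank s3 3 = ibank s2 3" "stack_set s3 = stack_set s2" by (simp_all add: s3_def stack_set_def)
  have l3: "linked {} M ?G s3"
  proof (rule linked_unlink[OF l])
    show "stack_set s3 \<subseteq> {..<n}" using linkedD(2)[OF l] Sw(3) st2 by (simp add: s3)
    show "est s3 = (est s)(e := Suc (alloc s))" by (simp add: s3_def B2)
  qed (use B3 R3 R2 al2 in \<open>auto simp: s3\<close>)
  have W3: "weighted ?G s3"
    unfolding weighted_def
  proof (intro conjI allI impI ballI)
    fix v assume v: "v < n"
    show "wgt s3 v = (\<Sum>e'\<in>inc ?G v. ew s3 e')"
      using weighted_split[OF wf e w v] w2[of v] by (simp add: R3 R2)
  next
    fix e' assume "e' \<in> dom ?G"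
    then show "ew s3 e' = \<mu> / \<beta> ^ elv s3 e'" using w by (simp add: weighted_def R3 R2 B3)
  qed
  have lev3: "lev s3 = lev s" by (simp add: B3)
  have "settled M ?G s3"
    unfolding settled_def
  proof (intro conjI allI impI ballI)
    fix e' assume "e' \<in> dom ?G"
    then have "e' \<in> dom G" "e' \<noteq> e" by (auto split: if_splits)
    then show "elv s3 e' = edge_level ?G (lev s3) e'"
      using sync[of e'] edge_level_cong[of G e' ?G "lev s"] by (simp add: lev3 B3)
  qed (use l3 W3 lev lev3 in auto)
  moreover have "calm s3 u" if "u < n" "u \<notin> stack_set s3" for u
    using ok that st2 w2[of u] by (simp add: state_ok_def calm_def lev3 s3 R3)
  ultimately have ok3: "state_ok {} ?G s3" using M by (auto simp: state_ok_def)
  have "gap ?G s3 \<le> gap G s"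
    unfolding gap_def by (rule sum_mono) (auto simp: B3 incident_edges_def)
  then have gap3: "real (gap ?G s3) \<le> real (gap G s)" by simp
  have rec3: "records s3 = records s" by (simp add: records_def B3)
  have P: "5000 * real f * (level_pot ?G (lev s3) / \<epsilon>)
      \<le> 5000 * real f * (level_pot G (lev s) / \<epsilon>) + 5000 * real f * (4 / \<epsilon> / \<epsilon>)"
  proof -
    have "level_pot ?G (lev s) \<le> level_pot G (lev s) + 4 / \<epsilon>"
      using M by (intro level_pot_delete[OF wf e]) (use lev in \<open>fastforce\<close>)
    then have "level_pot ?G (lev s) / \<epsilon> \<le> level_pot G (lev s) / \<epsilon> + 4 / \<epsilon> / \<epsilon>"
      using divide_right_mono[OF _ less_imp_le[OF eps_pos]] unfolding add_divide_distrib[symmetric] by blast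
    from mult_left_mono[OF this, of "5000 * real f"] show ?thesis unfolding lev3 by (simp only: distrib_left)
  qed
  have cS: "card S \<le> f" by (rule Sw(4))
  have "real t2 + 200 \<le> 2000 * real f" using t2 cS f_pos by linarith
  moreover have "real (sp s3) \<le> real (sp s) + real f" using sp2 s3 cS by simp
  ultimately have T: "real t2 + 200 + pot ?G s3 \<le> pot G s + (5000 * real f * (4 / \<epsilon> / \<epsilon>) + 5000 * real f)"
    unfolding pot_def using P gap3 rec3 by linarith
  show ?thesis
    unfolding delete_edge_def
    apply (simp add: run_Seq run_ISet run_RSet in1 s1_def[symmetric] del: of_nat_add)
    apply (rule runI[OF x2])
    using ok3 T by (simp add: run_Seq run_ISet run_RSet e2 al2 s3_def[symmetric])
qed

lemma wf_update:
  assumes wf: "wf_graph G" and legal: "legal_update n m f G u"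
  shows "wf_graph (apply_update u G)"
proof (cases u)
  case (Insert e xs)
  have "finite (dom G)" using wf by (simp add: wf_graph_def)
  then have "card (insert e (dom G)) \<le> Suc (card (dom G))" by (simp add: card_insert_if)
  then show ?thesis using wf legal Insert by (auto simp: wf_graph_def)
next
  case (Delete e)
  have "card (dom G - {e}) \<le> card (dom G)" using wf by (intro card_mono) (auto simp: wf_graph_def)
  then show ?thesis using wf legal Delete by (auto simp: wf_graph_def)
qed

text \<open>
  Before the first update the entry 0 of the weight table is missing; the algorithm writes it at
  the beginning of every update.
\<close>

definition ready :: "hypergraph \<Rightarrow> store \<Rightarrow> bool" where
  "ready G s \<longleftrightarrow> state_ok {} G (write_r 3 0 \<mu> s) \<and> sp s = 0"

text \<open>An insertion accounts for \<open>L\<close> and a deletion for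
  \<open>1 / \<epsilon>\<close>, both times \<open>f / \<epsilon>\<close> from the scaling in
  \<open>pot\<close>. The potential alone needs the factor 20000; the rest absorbs the lower order
  terms.\<close>

definition update_bound :: real where
  "update_bound = 30000 * (real f * (real L + 1 / \<epsilon>) / \<epsilon>)"

lemma pot_write_tab: "pot G (write_r 3 0 y s) = pot G s"
  by (simp add: pot_def records_def gap_def cong: if_cong)

lemma state_ok_tables: "state_ok X G s \<Longrightarrow> \<exists>M. tables M s"
  by (auto simp: state_ok_def settled_def linked_def)

lemma run_algorithm:
  assumes wf: "wf_graph G" and legal: "legal_update n m f G u" and rd: "ready G s"
  shows "run algorithm (receive u s) (\<lambda>t s'. ready (apply_update u G) s' \<and>
    real t + pot (apply_update u G) s' \<le> pot G s + update_bound)"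
proof -
  let ?G = "apply_update u G"
  have wf': "wf_graph ?G" by (rule wf_update[OF wf legal])
  define s1 where "s1 = write_r 3 0 \<mu> (receive u s)"
  have ok0: "state_ok {} G (write_r 3 0 \<mu> s)" using rd by (simp add: ready_def)
  have fr: "frame {1, 14, 15, 16} {5} (write_r 3 0 \<mu> s) s1" by (auto simp: frame_def s1_def receive_def)
  have ok1: "state_ok {} G s1" and pot1: "pot G s1 = pot G s"
    using state_ok_frame[OF ok0 fr] pot_write_tab by simp_all
  have mu: "rbank (receive u s) 0 (Suc 0) = \<mu>"
    using state_ok_tables[OF ok0] by (auto simp: tables_def receive_def)
  have inp: "ibank s1 1 = bank_of_list (encode_update u)" "ibank s1 (Suc 0) = bank_of_list (encode_update u)"
    by (simp_all add: s1_def receive_def)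
  define a where "a = real f * real L / \<epsilon>"
  define b where "b = real f / \<epsilon> / \<epsilon>"
  have e1: "1 \<le> 1 / \<epsilon>" using eps_pos eps_less_1 by simp
  have fe: "real f \<le> real f / \<epsilon>" using mult_left_mono[OF e1, of "real f"] by simp
  have "real f / \<epsilon> \<le> real f / \<epsilon> / \<epsilon>"
    using mult_left_mono[OF e1, of "real f / \<epsilon>"] eps_pos by simp
  then have fb: "real f \<le> b" using fe by (simp add: b_def)
  have fL: "real f * real L \<le> a" using mult_left_mono[OF e1, of "real f * real L"] by (simp add: a_def)
  have f1: "1 \<le> real f" using f_pos by simp
  have a0: "0 \<le> a" using eps_pos by (simp add: a_def)
  have bd: "update_bound = 30000 * a + 30000 * b"
    by (simp add: update_bound_def a_def b_def distrib_left add_divide_distrib)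
  have "run (Cond (ILess (ICell 1 (INum 0)) (INum 2)) insert_edge delete_edge) s1
    (\<lambda>t s'. state_ok {} ?G s' \<and> real t + pot ?G s' + 30 \<le> pot G s + update_bound)"
  proof (cases u)
    case (Insert e xs)
    have bv: "bval (ILess (ICell 1 (INum 0)) (INum 2)) s1" using Insert by (simp add: inp bank_of_list_def)
    have wfI: "wf_graph (G(e := Some (set xs)))" using wf' Insert by simp
    have eI: "e \<notin> dom G" "distinct xs" using legal Insert by auto
    have inpI: "ibank s1 1 = bank_of_list (encode_update (Insert e xs))" using inp Insert by simp
    have 1: "5000 * real f * (4 * real L / \<epsilon>) = 20000 * a" by (simp add: a_def)
    have 2: "5000 * real f * (4 * real L / \<epsilon>) + 5000 * real f + 200 * (real f * real L) + 50 \<le> update_bound"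
      unfolding 1 bd using fb fL f1 a0 by linarith
    show ?thesis
      unfolding run_Cond if_P[OF bv]
      by (rule run_mono[OF run_insert_edge[OF wf wfI eI ok1 inpI]]) (use 2 pot1 Insert in auto)
  next
    case (Delete e)
    have bv: "\<not> bval (ILess (ICell 1 (INum 0)) (INum 2)) s1" using Delete by (simp add: inp bank_of_list_def)
    obtain S where S: "G e = Some S" using legal Delete by auto
    have inpD: "ibank s1 1 = bank_of_list (encode_update (Delete e))" using inp Delete by simp
    have 1: "5000 * real f * (4 / \<epsilon> / \<epsilon>) = 20000 * b" by (simp add: b_def)
    have 2: "5000 * real f * (4 / \<epsilon> / \<epsilon>) + 5000 * real f + 50 \<le> update_bound"
      unfolding 1 bd using fb fL f1 a0 by linarith
    show ?thesis
      unfolding run_Cond if_not_P[OF bv]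
      by (rule run_mono[OF run_delete_edge[OF wf S ok1 inpD]]) (use 2 pot1 Delete in auto)
  qed
  then obtain t2 s2 where x2: "exec (Cond (ILess (ICell 1 (INum 0)) (INum 2)) insert_edge delete_edge) s1 t2 s2"
    and ok2: "state_ok {} ?G s2" and t2: "real t2 + pot ?G s2 + 30 \<le> pot G s + update_bound"
    unfolding run_def by blast
  from run_main_loop[OF wf' ok2] obtain t3 s3 where x3: "exec main_loop s2 t3 s3"
    and ok3: "state_ok {} ?G s3" and sp3: "sp s3 = 0" and t3: "real t3 + pot ?G s3 \<le> pot ?G s2 + 10"
    unfolding run_def by blast
  \<comment> \<open>The tables of \<open>s3\<close> already contain the entry 0, so the write in
    \<open>ready\<close> changes nothing.\<close>
  have "tab s3 0 = \<mu>" using state_ok_tables[OF ok3] by (auto simp: tables_def)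
  then have "write_r 3 0 \<mu> s3 = s3" by (auto simp: write_r_def)
  then have "ready ?G s3" using ok3 sp3 by (simp add: ready_def)
  then show ?thesis
    unfolding algorithm_def run_Seq run_RSet
    apply (simp only: ival.simps rval.simps mu s1_def[symmetric])
    apply (rule runI[OF x2])
    apply (rule runI[OF x3])
    using t2 t3 by simp
qed

text \<open>As the potential starts at 0, the costs telescope to a bound on the time itself.\<close>

lemma ready_init:
  "ready Map.empty (init_store n m f \<mu> c \<epsilon>)" "pot Map.empty (init_store n m f \<mu> c \<epsilon>) = 0"
proof -
  let ?i = "init_store n m f \<mu> c \<epsilon>"
  define s where "s = write_r 3 0 \<mu> ?i"
  have ib: "ibank s b x = 0" if "b \<noteq> 0" for b x using that by (simp add: s_def init_store_def)
  have inc: "inc Map.empty v = {}" for v by (simp add: incident_edges_def)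
  have wg: "wgt s v = 0" for v by (simp add: s_def init_store_def)
  have tb: "tables 0 s" by (auto simp: tables_def s_def init_store_def bank_of_list_def)
  have ss: "stack_set s = {}" by (simp add: stack_set_def ib)
  have "linked {} 0 Map.empty s"
    by (rule linkedI[OF tb]) (simp_all add: ss ib)
  then have "settled 0 Map.empty s" by (simp add: settled_def weighted_def inc wg ib)
  moreover have "calm s u" if "u < n" for u using c_pos[OF that] by (simp add: calm_def wg ib)
  ultimately have "state_ok {} Map.empty s" by (auto simp: state_ok_def)
  then show "ready Map.empty ?i" by (simp add: ready_def s_def init_store_def)
  have "pot Map.empty s = 0"
    by (simp add: pot_def records_def gap_def level_pot_def edge_pot_def node_pot_def ib inc)
  then show "pot Map.empty ?i = 0" by (simp add: s_def pot_write_tab)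
qed

text \<open>Induction from the right, because the legality of an update depends on the graph left by
  its predecessors. The bound retains the final potential so that the next update can spend
  it.\<close>

lemma serves_algorithm:
  assumes "legal_updates n m f us"
  shows "\<exists>t s. serves algorithm (init_store n m f \<mu> c \<epsilon>) us t s \<and> wf_graph (graph_after us) \<and>
    ready (graph_after us) s \<and> real t + pot (graph_after us) s \<le> real (length us) * update_bound"
  using assms
proof (induction us rule: rev_induct)
  case Nil
  have "wf_graph Map.empty" by (simp add: wf_graph_def)
  then show ?case using serves.Nil[of algorithm "init_store n m f \<mu> c \<epsilon>"] ready_init
    by (intro exI[of _ 0] exI[of _ "init_store n m f \<mu> c \<epsilon>"]) (simp add: graph_after_def)
next
  case (snoc u us)
  note lg = legal_updates_snocD[OF snoc.prems]
  from snoc.IH[OF lg(1)] obtain t s where s: "serves algorithm (init_store n m f \<mu> c \<epsilon>) us t s"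
    "wf_graph (graph_after us)" "ready (graph_after us) s"
    "real t + pot (graph_after us) s \<le> real (length us) * update_bound" by blast
  from run_algorithm[OF s(2) lg(2) s(3)] obtain t' s' where s': "exec algorithm (receive u s) t' s'"
    "ready (graph_after (us @ [u])) s'"
    "real t' + pot (graph_after (us @ [u])) s' \<le> pot (graph_after us) s + update_bound"
    unfolding run_def graph_after_snoc by blast
  have "real (t + t') + pot (graph_after (us @ [u])) s' \<le> real (length (us @ [u])) * update_bound"
    using s(4) s'(3) by (simp add: algebra_simps)
  then show ?case
    using serves_snoc[OF s(1) s'(1)] wf_update[OF s(2) lg(2)] s'(2) unfolding graph_after_snoc[symmetric] by blast
qed

text \<open>An empty stack leaves no node exempt from \<open>calm\<close>, and in a settled store
  the recorded weights are the true ones.\<close>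

lemma ready_partition:
  assumes "ready G s"
  shows "is_partition \<alpha> \<beta> n m \<mu> c (level_of s)" "partition_invariant \<alpha> \<beta> n f \<mu> c G (level_of s)"
proof -
  let ?s = "write_r 3 0 \<mu> s"
  have ok: "state_ok {} G ?s" and "stack_set ?s = {}" using assms by (auto simp: ready_def stack_set_def)
  then obtain M where M: "M \<le> L" "settled M G ?s" and cm: "\<And>u. u < n \<Longrightarrow> calm ?s u" by (auto simp: state_ok_def)
  have lv: "level_of s = lev s" by (simp add: level_of_def fun_eq_iff)
  have "lev s v \<le> L" if "v < n" for v
  proof -
    have "lev ?s v \<le> M" using M(2) that unfolding settled_def by blast
    then show ?thesis using M(1) by simp
  qed
  then show "is_partition \<alpha> \<beta> n m \<mu> c (level_of s)" by (simp add: is_partition_def lv)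
  have "W G (lev s) v = wgt s v" if "v < n" for v using settled_weight[OF M(2) that] by simp
  then show "partition_invariant \<alpha> \<beta> n f \<mu> c G (level_of s)"
    using cm unfolding partition_invariant_def c_star_eq lv by (simp add: calm_def)
qed

text \<open>The polynomial bounds on \<open>\<mu>\<close> and on the inverse capacities make the
  argument of the logarithm polynomial in \<open>m\<close> and \<open>n\<close>, so its natural
  logarithm is at most a multiple of \<open>ln (m + n)\<close> plus a constant. Division by
  \<open>ln \<beta> \<ge> \<epsilon> / 2\<close> yields the factor
  \<open>1 / \<epsilon>\<close>.\<close>

lemma max_level_bound:
  assumes K: "K > 0" and pb: "poly_bounded K n \<mu> c"
  shows "real L + 1 / \<epsilon> \<le> (2 * (6 + 2 * \<bar>ln K\<bar>) / ln 2 + 2 + 4 * K) * (ln (real (m + n)) / \<epsilon>)"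
proof -
  define l where "l = ln (real (m + n))"
  have l2: "ln 2 \<le> l" unfolding l_def using m_pos n_pos by (intro ln_mono) auto
  have ln2: "0 < ln (2::real)" by simp
  have l0: "0 < l" using l2 ln2 by linarith
  define X where "X = real m * \<mu> * \<alpha> / c_min n c"
  have "c_min n c \<in> c ` {..<n}" unfolding c_min_def using n_pos by (intro Min_in) (auto simp: lessThan_empty_iff)
  then obtain v where v: "v < n" "c_min n c = c v" by auto
  have cm: "0 < c_min n c" using c_pos v by simp
  define Y where "Y = K * real n powr K"
  have Y0: "0 < Y" using K n_pos by (simp add: Y_def)
  have Y: "\<mu> \<le> Y" "1 / c_min n c \<le> Y" using pb v by (simp_all add: poly_bounded_def Y_def)
  have "0 \<le> 1 / real f" "1 / real f \<le> 1" using f_pos by simp_all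
  then have a5: "\<alpha> \<le> 5" and a0: "0 < \<alpha>" using eps_less_1 eps_pos unfolding alpha_eq by linarith+
  have X0: "0 < X" using m_pos mu_pos a0 cm by (simp add: X_def)
  have "X = real m * (\<mu> * (\<alpha> * (1 / c_min n c)))" by (simp add: X_def)
  also have "\<dots> \<le> real m * (Y * (5 * Y))"
    using Y a5 a0 mu_pos cm Y0 by (intro mult_left_mono mult_mono) auto
  finally have XY: "X \<le> real m * (Y * (5 * Y))" .
  have "ln X \<le> ln (real m * (Y * (5 * Y)))" using X0 XY by (intro ln_mono) auto
  also have "\<dots> = ln (real m) + 2 * ln Y + ln 5" using m_pos Y0 by (simp add: ln_mult)
  also have "ln Y = ln K + K * ln (real n)" using K n_pos by (simp add: Y_def ln_mult ln_powr)
  finally have lnX: "ln X \<le> ln (real m) + 2 * ln K + 2 * K * ln (real n) + ln 5" by (simp add: algebra_simps)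
  have "ln (real m) \<le> l" "ln (real n) \<le> l" unfolding l_def using m_pos n_pos by (auto intro!: ln_mono)
  then have "K * ln (real n) \<le> K * l" "ln (real m) \<le> l" using K by auto
  moreover have "ln (5::real) \<le> 4" using ln_le_minus_one[of "5::real"] by simp
  ultimately have lnX': "ln X \<le> l + 2 * K * l + (4 + 2 * \<bar>ln K\<bar>)" using lnX by (simp add: algebra_simps)
  define Z where "Z = 4 + 2 * \<bar>ln K\<bar>"
  have Z0: "0 \<le> Z" by (simp add: Z_def)
  have ZK: "ln X \<le> l + 2 * K * l + Z" using lnX' by (simp add: Z_def)
  \<comment> \<open>This is \<open>ln x \<le> x - 1\<close> at \<open>x = 1 / \<beta>\<close>,
    together with \<open>\<beta> < 2\<close>.\<close>
  have lb: "\<epsilon> / 2 \<le> ln \<beta>"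
  proof -
    have "ln (1 / \<beta>) \<le> 1 / \<beta> - 1" using beta_pos by (intro ln_le_minus_one) simp
    then have "1 - 1 / \<beta> \<le> ln \<beta>" using beta_pos by (simp add: ln_div)
    moreover have "1 - 1 / \<beta> = \<epsilon> / \<beta>" using beta_pos by (simp add: beta_eq field_simps)
    moreover have "\<epsilon> / 2 \<le> \<epsilon> / \<beta>"
      using eps_pos eps_less_1 beta_pos by (intro divide_left_mono) (auto simp: beta_eq)
    ultimately show ?thesis by linarith
  qed
  have R0: "0 \<le> l + 2 * K * l + Z" using l0 K Z0 by simp
  have "log \<beta> X \<le> (l + 2 * K * l + Z) / ln \<beta>"
    unfolding log_def using ZK beta_gt_1 by (intro divide_right_mono) auto
  also have "\<dots> \<le> (l + 2 * K * l + Z) / (\<epsilon> / 2)"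
    using lb R0 eps_pos beta_gt_1 by (intro divide_left_mono) (auto intro!: mult_pos_pos)
  finally have lg: "log \<beta> X \<le> 2 * (l + 2 * K * l + Z) / \<epsilon>" by (simp add: mult.commute)
  have nn: "0 \<le> 2 * (l + 2 * K * l + Z) / \<epsilon>" using R0 eps_pos by simp
  \<comment> \<open>The 1 comes from rounding up. A negative ceiling is cut off by
    \<open>nat\<close>, which the nonnegative right-hand side covers.\<close>
  have "real L \<le> 2 * (l + 2 * K * l + Z) / \<epsilon> + 1"
    unfolding max_level_def X_def[symmetric] using lg nn by linarith
  moreover have "1 \<le> 1 / \<epsilon>" using eps_pos eps_less_1 by simp
  ultimately have "real L + 1 / \<epsilon> \<le> 2 * (l + 2 * K * l + Z) / \<epsilon> + 2 / \<epsilon>" by simp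
  also have "\<dots> = (2 * l + 4 * K * l + 2 * (Z + 1)) / \<epsilon>" by (simp add: add_divide_distrib)
  \<comment> \<open>Since \<open>m\<close> and \<open>n\<close> are positive, \<open>l\<close> is at
    least \<open>ln 2\<close>, so a constant is at most itself times
    \<open>l / ln 2\<close>.\<close>
  also have "\<dots> \<le> (2 * l + 4 * K * l + 2 * (6 + 2 * \<bar>ln K\<bar>) / ln 2 * l) / \<epsilon>"
  proof (intro divide_right_mono add_left_mono)
    have "2 * (6 + 2 * \<bar>ln K\<bar>) * 1 \<le> 2 * (6 + 2 * \<bar>ln K\<bar>) * (l / ln 2)"
      using l2 ln2 by (intro mult_left_mono) auto
    then show "2 * (Z + 1) \<le> 2 * (6 + 2 * \<bar>ln K\<bar>) / ln 2 * l" by (simp add: Z_def)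
  qed (use eps_pos in simp)
  also have "\<dots> = (2 * (6 + 2 * \<bar>ln K\<bar>) / ln 2 + 2 + 4 * K) * (l / \<epsilon>)"
    by (simp add: distrib_right add_divide_distrib)
  finally show ?thesis by (simp only: l_def)
qed

lemma serves_within_bound:
  assumes K: "K > 0" and pb: "poly_bounded K n \<mu> c" and legal: "legal_updates n m f us"
  shows "\<exists>t s. serves algorithm (init_store n m f \<mu> c \<epsilon>) us t s \<and>
    is_partition \<alpha> \<beta> n m \<mu> c (level_of s) \<and>
    partition_invariant \<alpha> \<beta> n f \<mu> c (graph_after us) (level_of s) \<and>
    real t \<le> 30000 * (2 * (6 + 2 * \<bar>ln K\<bar>) / ln 2 + 2 + 4 * K) *
      (real (length us) * (real f * ln (real (m + n)) / \<epsilon>\<^sup>2))"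
proof -
  obtain t s where s: "serves algorithm (init_store n m f \<mu> c \<epsilon>) us t s" "wf_graph (graph_after us)"
    "ready (graph_after us) s" "real t + pot (graph_after us) s \<le> real (length us) * update_bound"
    using serves_algorithm[OF legal] by blast
  let ?C = "2 * (6 + 2 * \<bar>ln K\<bar>) / ln 2 + 2 + 4 * K"
  have "state_ok {} (graph_after us) (write_r 3 0 \<mu> s)" using s(3) by (simp add: ready_def)
  then have "0 \<le> pot (graph_after us) s" using pot_nonneg[OF s(2)] pot_write_tab by metis
  then have "real t \<le> real (length us) * update_bound" using s(4) by simp
  also have "update_bound \<le> 30000 * (real f * (?C * (ln (real (m + n)) / \<epsilon>)) / \<epsilon>)"
    unfolding update_bound_def using max_level_bound[OF K pb] eps_pos
    by (intro mult_left_mono divide_right_mono) auto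
  then have "real (length us) * update_bound
      \<le> real (length us) * (30000 * (real f * (?C * (ln (real (m + n)) / \<epsilon>)) / \<epsilon>))"
    by (rule mult_left_mono) simp
  also have "\<dots> = 30000 * ?C * (real (length us) * (real f * ln (real (m + n)) / \<epsilon>\<^sup>2))"
    by (simp add: power2_eq_square)
  finally show ?thesis using s(1) ready_partition[OF s(3)] by blast
qed

end

theorem theorem4:
  "\<exists>p. \<forall>K>0. \<exists>C>0.
     \<forall>(n::nat) (m::nat) (f::nat) (\<mu>::real) (c::nat \<Rightarrow> real) (\<epsilon>::real) (\<alpha>::real) (\<beta>::real).
       n \<ge> 1 \<and> m \<ge> 1 \<and> f \<ge> 1 \<and> \<mu> \<ge> 1 \<and> (\<forall>v<n. c v > 0) \<and> poly_bounded K n \<mu> c \<and>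
       0 < \<epsilon> \<and> \<epsilon> < 1 \<and> \<alpha> = 1 + 1 / real f + 3 * \<epsilon> \<and> \<beta> = 1 + \<epsilon> \<longrightarrow>
       (\<forall>us. legal_updates n m f us \<longrightarrow>
          (\<exists>t s. serves p (init_store n m f \<mu> c \<epsilon>) us t s \<and>
                 is_partition \<alpha> \<beta> n m \<mu> c (level_of s) \<and>
                 partition_invariant \<alpha> \<beta> n f \<mu> c (graph_after us) (level_of s) \<and>
                 real t \<le> C * (real (length us) * (real f * ln (real (m + n)) / \<epsilon>\<^sup>2))))"
proof (intro exI[of _ algorithm] allI impI, goal_cases)
  case (1 K)
  \<comment> \<open>The factor 30000 comes from \<open>update_bound\<close> and the rest from
    \<open>max_level_bound\<close>. Only this constant depends on \<open>K\<close>; the program does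
    not.\<close>
  let ?C = "30000 * (2 * (6 + 2 * \<bar>ln K\<bar>) / ln 2 + 2 + 4 * K)"
  show ?case
  proof (rule exI[of _ ?C], intro conjI allI impI, goal_cases)
    case 1
    show ?case using \<open>K > 0\<close> by (intro mult_pos_pos add_nonneg_pos) auto
  next
    case (2 n m f \<mu> c \<epsilon> \<alpha> \<beta> us)
    interpret instance_params n m f \<mu> c \<epsilon> \<alpha> \<beta> using 2(1) by unfold_locales auto
    show ?case using serves_within_bound[OF \<open>K > 0\<close> _ 2(2)] 2(1) by blast
  qed
qed

end
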